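(* Fix a source schema $\mathcal{S}$ and a target schema $\mathcal{T}$. A LAV schema mapping $M=(\mathcal{S},\mathcal{T},\Sigma)$ is uniquely characterized (w.r.t. the class of all LAV schema mappings over $\mathcal{S},\mathcal{T}$) by some pair of finite sets of positive and negative schema-mapping examples if and only if $M$ is logically equivalent to a c-acyclic LAV schema mapping. Moreover, if $M$ is c-acyclic, then such a uniquely characterizing pair of finite sets of positive and negative schema-mapping examples can be constructed in time polynomial in the size of $M$.
   Context: A LAV schema mapping is a triple $M=(\mathcal{S},\mathcal{T},\Sigma)$ where $\mathcal{S},\mathcal{T}$ are disjoint finite relational schemas and $\Sigma$ is a finite set of first-order sentences (LAV constraints) of the form $\forall\mathbf{x}(\alpha(\mathbf{x})\to\exists\mathbf{y}\,\phi(\mathbf{x},\mathbf{y}))$, where $\alpha$ is a single atom with a relation of $\mathcal{S}$ and $\phi$ is a conjunction of atoms with relations from $\mathcal{T}$. A schema-mapping example is a pair $(I,J)$ of a finite $\mathcal{S}$-structure $I$ and a finite $\mathcal{T}$-structure $J$; it is positive for $M$ if $I\cup J$ (a structure over $\mathcal{S}\cup\mathcal{T}$) satisfies all of $\Sigma$, negative otherwise. Two LAV mappings over $\mathcal{S},\mathcal{T}$ are logically equivalent if they have the same positive examples. A pair $(E^+,E^-)$ uniquely characterizes $M$ if every example in $E^+$ is positive and every example in $E^-$ negative for $M$, and every LAV mapping over $\mathcal{S},\mathcal{T}$ with this property is logically equivalent to $M$. The right-hand side $\exists\mathbf{y}\phi(\mathbf{x},\mathbf{y})$ of a constraint is viewed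 as a not-necessarily-safe CQ with free variables $\mathbf{x}$; its canonical structure has as elements the variables $\mathbf{x},\mathbf{y}$, as facts the atoms of $\phi$, and $\mathbf{x}$ as distinguished tuple. The incidence graph of a structure is the bipartite multigraph on its elements and facts with one edge per occurrence of an element in a fact; a structure is c-acyclic if every cycle of its incidence graph (including length-2 cycles from parallel edges) contains a distinguished element. $M$ is c-acyclic if the canonical structure of the right-hand side of each of its constraints is c-acyclic. *)

theory Defs
  imports Main "HOL-Computational_Algebra.Polynomial"
begin

section \<open>Schemas, structures and canonical structures\<close>

text \<open>A schema maps each of its relation symbols to an arity.\<close>

type_synonym schema = "nat \<rightharpoonup> nat"

text \<open>Used both for facts (arguments are elements) and for atoms (arguments are variables).\<close>

type_synonym fact = "nat \<times> nat list"

record struct =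
  univ :: "nat set"
  facts :: "fact set"

definition over_schema :: "schema \<Rightarrow> fact \<Rightarrow> bool" where
  "over_schema S f \<longleftrightarrow> S (fst f) = Some (length (snd f))"

text \<open>As usual in model theory, structures have a nonempty universe, whose elements need not
  all occur in facts. The fact set is finite because the schema and the universe are.
  Up to isomorphism, finite structures have their elements in \<^typ>\<open>nat\<close>.\<close>

definition finite_structure :: "schema \<Rightarrow> struct \<Rightarrow> bool" where
  "finite_structure S A \<longleftrightarrow> finite (univ A) \<and> univ A \<noteq> {} \<and>
     (\<forall>f\<in>facts A. over_schema S f \<and> set (snd f) \<subseteq> univ A)"

definition struct_union :: "struct \<Rightarrow> struct \<Rightarrow> struct" where
  "struct_union A B = \<lparr>univ = univ A \<union> univ B, facts = facts A \<union> facts B\<rparr>"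

section \<open>LAV schema mappings\<close>

text \<open>The universally quantified variables are those of the atom \<open>lhs\<close>, in which a variable may be
  repeated. The right-hand side quantifies \<open>exvars\<close> existentially over the
  conjunction \<open>rhs\<close>, which need not mention all variables of \<open>lhs\<close>.\<close>

record lav =
  lhs :: fact
  exvars :: "nat list"
  rhs :: "fact list"

definition lav_constraint :: "schema \<Rightarrow> schema \<Rightarrow> lav \<Rightarrow> bool" where
  "lav_constraint S T c \<longleftrightarrow>
     over_schema S (lhs c) \<and>
     distinct (exvars c) \<and> set (exvars c) \<inter> set (snd (lhs c)) = {} \<and>
     (\<forall>f\<in>set (rhs c). over_schema T f \<and> set (snd f) \<subseteq> set (snd (lhs c)) \<union> set (exvars c))"

definition satisfies :: "struct \<Rightarrow> lav \<Rightarrow> bool" where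
  "satisfies A c \<longleftrightarrow>
     (\<forall>h. (\<forall>x\<in>set (snd (lhs c)). h x \<in> univ A) \<longrightarrow>
          (fst (lhs c), map h (snd (lhs c))) \<in> facts A \<longrightarrow>
          (\<exists>g. (\<forall>x\<in>set (snd (lhs c)). g x = h x) \<and>
               (\<forall>y\<in>set (exvars c). g y \<in> univ A) \<and>
               (\<forall>f\<in>set (rhs c). (fst f, map g (snd f)) \<in> facts A)))"

text \<open>With the schemas fixed, a mapping is given by its set of constraints.\<close>

definition lav_mapping :: "schema \<Rightarrow> schema \<Rightarrow> lav set \<Rightarrow> bool" where
  "lav_mapping S T M \<longleftrightarrow> finite M \<and> (\<forall>c\<in>M. lav_constraint S T c)"

section \<open>Schema-mapping examples\<close>

definition mapping_example :: "schema \<Rightarrow> schema \<Rightarrow> struct \<times> struct \<Rightarrow> bool" where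
  "mapping_example S T e \<longleftrightarrow> finite_structure S (fst e) \<and> finite_structure T (snd e)"

definition positive_example :: "schema \<Rightarrow> schema \<Rightarrow> lav set \<Rightarrow> struct \<times> struct \<Rightarrow> bool" where
  "positive_example S T M e \<longleftrightarrow>
     mapping_example S T e \<and> (\<forall>c\<in>M. satisfies (struct_union (fst e) (snd e)) c)"

definition negative_example :: "schema \<Rightarrow> schema \<Rightarrow> lav set \<Rightarrow> struct \<times> struct \<Rightarrow> bool" where
  "negative_example S T M e \<longleftrightarrow> mapping_example S T e \<and> \<not> positive_example S T M e"

definition logically_equivalent :: "schema \<Rightarrow> schema \<Rightarrow> lav set \<Rightarrow> lav set \<Rightarrow> bool" where
  "logically_equivalent S T M N \<longleftrightarrow>
     (\<forall>e. positive_example S T M e \<longleftrightarrow> positive_example S T N e)"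

definition fits ::
  "schema \<Rightarrow> schema \<Rightarrow> lav set \<Rightarrow> (struct \<times> struct) set \<Rightarrow> (struct \<times> struct) set \<Rightarrow> bool" where
  "fits S T M Ep En \<longleftrightarrow>
     (\<forall>e\<in>Ep. positive_example S T M e) \<and> (\<forall>e\<in>En. negative_example S T M e)"

definition uniquely_characterizes ::
  "schema \<Rightarrow> schema \<Rightarrow> (struct \<times> struct) set \<Rightarrow> (struct \<times> struct) set \<Rightarrow> lav set \<Rightarrow> bool" where
  "uniquely_characterizes S T Ep En M \<longleftrightarrow>
     fits S T M Ep En \<and>
     (\<forall>N. lav_mapping S T N \<and> fits S T N Ep En \<longrightarrow> logically_equivalent S T N M)"

section \<open>c-acyclicity\<close>

datatype inode = Elem nat | Fact fact

text \<open>The edge \<open>(f, i)\<close> stands for the occurrence of an element at position \<open>i\<close> of \<open>f\<close>.\<close>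

definition incidence_edges :: "struct \<Rightarrow> (fact \<times> nat) set" where
  "incidence_edges A = {(f, i). f \<in> facts A \<and> i < length (snd f)}"

definition ends :: "fact \<times> nat \<Rightarrow> inode set" where
  "ends e = {Elem (snd (fst e) ! snd e), Fact (fst e)}"

text \<open>A cycle with vertices \<open>vs\<close> and edges \<open>es\<close>; length 2 means two parallel edges
  (loops do not exist, so length 1 is impossible).\<close>

definition incidence_cycle :: "struct \<Rightarrow> inode list \<Rightarrow> (fact \<times> nat) list \<Rightarrow> bool" where
  "incidence_cycle A vs es \<longleftrightarrow>
     vs \<noteq> [] \<and> length vs = length es \<and> distinct vs \<and> distinct es \<and>
     set es \<subseteq> incidence_edges A \<and>
     (\<forall>i<length es. ends (es ! i) = {vs ! i, vs ! (Suc i mod length es)})"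

definition c_acyclic :: "struct \<Rightarrow> nat list \<Rightarrow> bool" where
  "c_acyclic A xs \<longleftrightarrow>
     (\<forall>vs es. incidence_cycle A vs es \<longrightarrow> (\<exists>x\<in>set xs. Elem x \<in> set vs))"

definition canonical_structure :: "lav \<Rightarrow> struct" where
  "canonical_structure c =
     \<lparr>univ = set (snd (lhs c)) \<union> set (exvars c), facts = set (rhs c)\<rparr>"

definition distinguished :: "lav \<Rightarrow> nat list" where
  "distinguished c = remdups (snd (lhs c))"

definition c_acyclic_mapping :: "lav set \<Rightarrow> bool" where
  "c_acyclic_mapping M \<longleftrightarrow> (\<forall>c\<in>M. c_acyclic (canonical_structure c) (distinguished c))"

section \<open>Time-bounded computation\<close>

text \<open>Time is measured in a first-order functional language over binary trees (the language F of
  N. D. Jones, \<^emph>\<open>Computability and Complexity from a Programming Perspective\<close>, with several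
  mutually recursive one-argument functions). A program is the list of its function bodies.
  Unlike under unit costs, every step that builds or copies a tree is charged the
  size of that tree, so the time bounds both the number of steps and the size of
  every intermediate tree. Hence this model and Turing machines simulate each other with
  polynomial overhead.\<close>

datatype tree = Leaf | Node tree tree

fun tsize :: "tree \<Rightarrow> nat" where
  "tsize Leaf = 1"
| "tsize (Node l r) = Suc (tsize l + tsize r)"

fun left :: "tree \<Rightarrow> tree" where
  "left Leaf = Leaf"
| "left (Node l r) = l"

fun right :: "tree \<Rightarrow> tree" where
  "right Leaf = Leaf"
| "right (Node l r) = r"

datatype expr =
    Arg
  | ELeaf
  | ENode expr expr
  | ELeft expr
  | ERight expr
  | EIf expr expr expr
  | ECall nat expr

type_synonym program = "expr list"

text \<open>\<open>eval P x e v t\<close>: with \<open>x\<close> as the argument of the current function, \<open>e\<close> evaluates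
  to \<open>v\<close> in time \<open>t\<close>. The tree \<^const>\<open>Leaf\<close> is the truth value false.\<close>

inductive eval :: "program \<Rightarrow> tree \<Rightarrow> expr \<Rightarrow> tree \<Rightarrow> nat \<Rightarrow> bool" for P where
  eval_arg: "eval P x Arg x (tsize x)"
| eval_leaf: "eval P x ELeaf Leaf 1"
| eval_node: "eval P x a u s \<Longrightarrow> eval P x b v t \<Longrightarrow>
    eval P x (ENode a b) (Node u v) (s + t + tsize (Node u v))"
| eval_left: "eval P x a u s \<Longrightarrow> eval P x (ELeft a) (left u) (s + tsize (left u))"
| eval_right: "eval P x a u s \<Longrightarrow> eval P x (ERight a) (right u) (s + tsize (right u))"
| eval_if_true: "eval P x a (Node u v) s \<Longrightarrow> eval P x b w t \<Longrightarrow>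
    eval P x (EIf a b c) w (Suc (s + t))"
| eval_if_false: "eval P x a Leaf s \<Longrightarrow> eval P x c w t \<Longrightarrow>
    eval P x (EIf a b c) w (Suc (s + t))"
| eval_call: "f < length P \<Longrightarrow> eval P x a u s \<Longrightarrow> eval P u (P ! f) w t \<Longrightarrow>
    eval P x (ECall f a) w (Suc (s + t))"

text \<open>Execution starts with the first function of the program.\<close>

definition runs :: "program \<Rightarrow> tree \<Rightarrow> tree \<Rightarrow> nat \<Rightarrow> bool" where
  "runs P x v t \<longleftrightarrow> eval P x (ECall 0 Arg) v t"

inductive_cases eval_argE: "eval P x Arg v t"
inductive_cases eval_leafE: "eval P x ELeaf v t"
inductive_cases eval_nodeE: "eval P x (ENode a b) v t"
inductive_cases eval_leftE: "eval P x (ELeft a) v t"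
inductive_cases eval_rightE: "eval P x (ERight a) v t"
inductive_cases eval_ifE: "eval P x (EIf a b c) v t"
inductive_cases eval_callE: "eval P x (ECall f a) v t"

lemma eval_deterministic:
  assumes "eval P x e v t" and "eval P x e v' t'"
  shows "v = v' \<and> t = t'"
  using assms
proof (induction arbitrary: v' t' rule: eval.induct)
  case eval_arg
  then show ?case by (rule eval_argE) simp
next
  case eval_leaf
  then show ?case by (rule eval_leafE) simp
next
  case eval_node
  from eval_node.prems show ?case
    by (rule eval_nodeE) (simp, metis eval_node.IH)
next
  case eval_left
  from eval_left.prems show ?case
    by (rule eval_leftE) (metis eval_left.IH)
next
  case eval_right
  from eval_right.prems show ?case
    by (rule eval_rightE) (metis eval_right.IH)
next
  case eval_if_true
  from eval_if_true.prems show ?case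
    by (rule eval_ifE) (metis eval_if_true.IH tree.distinct(1))+
next
  case eval_if_false
  from eval_if_false.prems show ?case
    by (rule eval_ifE) (metis eval_if_false.IH tree.distinct(1))+
next
  case eval_call
  from eval_call.prems show ?case
    by (rule eval_callE) (metis eval_call.IH)
qed

lemma tsize_le_time: "eval P x e v t \<Longrightarrow> tsize v \<le> t"
  by (induction rule: eval.induct) auto

section \<open>Encoding mappings and examples as trees\<close>

text \<open>Numbers are encoded in binary, least significant bit first.\<close>

fun enc_nat :: "nat \<Rightarrow> tree" where
  "enc_nat n =
     (if n = 0 then Leaf
      else Node (if odd n then Node Leaf Leaf else Leaf) (enc_nat (n div 2)))"

declare enc_nat.simps [simp del]

fun enc_list :: "('a \<Rightarrow> tree) \<Rightarrow> 'a list \<Rightarrow> tree" where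
  "enc_list enc [] = Leaf"
| "enc_list enc (x # xs) = Node (enc x) (enc_list enc xs)"

fun enc_pair :: "('a \<Rightarrow> tree) \<Rightarrow> ('b \<Rightarrow> tree) \<Rightarrow> 'a \<times> 'b \<Rightarrow> tree" where
  "enc_pair enca encb (a, b) = Node (enca a) (encb b)"

definition enc_fact :: "fact \<Rightarrow> tree" where
  "enc_fact = enc_pair enc_nat (enc_list enc_nat)"

definition enc_lav :: "lav \<Rightarrow> tree" where
  "enc_lav c =
     Node (enc_fact (lhs c)) (Node (enc_list enc_nat (exvars c)) (enc_list enc_fact (rhs c)))"

definition enc_mapping :: "lav list \<Rightarrow> tree" where
  "enc_mapping = enc_list enc_lav"

text \<open>For output, a finite structure is listed by its elements and its facts.\<close>

type_synonym listed_struct = "nat list \<times> fact list"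

definition struct_of :: "listed_struct \<Rightarrow> struct" where
  "struct_of A = \<lparr>univ = set (fst A), facts = set (snd A)\<rparr>"

definition examples_of :: "(listed_struct \<times> listed_struct) list \<Rightarrow> (struct \<times> struct) set" where
  "examples_of es = map_prod struct_of struct_of ` set es"

definition enc_examples :: "(listed_struct \<times> listed_struct) list \<Rightarrow> tree" where
  "enc_examples =
     (let enc_struct = enc_pair (enc_list enc_nat) (enc_list enc_fact)
      in enc_list (enc_pair enc_struct enc_struct))"

end

theory Submission
  imports Defs "HOL-Library.FuncSet" "HOL-Library.Nat_Bijection"
begin

text \<open>A mapping is determined up to equivalence by the canonical structures obtained by chasing a
  single source fact, one for each pattern of equalities, and c-acyclicity survives the chase.
  A minimal retract \<open>q\<close> of such a structure, found by arc consistency, is separated from every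
  structure strictly below it by the structures \<open>weaken A q f\<close>: every element \<open>b\<close> is replaced by
  replicas that each name one fact at which \<open>b\<close> fails, and a fact is kept if one of its replicas
  blames another fact. If \<open>q\<close> does not map into \<open>p\<close>, arc consistency deletes pairs of elements; the
  fact responsible for a deletion is the label, and the pair of a fact that was deleted first blames
  another fact.

  Conversely, take a constraint of an equivalent mapping of minimal size with a cycle through an
  occurrence of an existential variable. Use many copies of the right-hand side and let this
  occurrence always refer to a later copy. By the pigeonhole principle finitely many examples do not
  notice the change, but along the cycle the index of the copy would have to increase.\<close>

section \<open>Structures over a set of distinguished elements\<close>

type_synonym 'a atom = "nat \<times> 'a list"

text \<open>A left-hand side is a single atom, so a mapping acts on each source fact separately and
  only the chase of one fact per equality pattern matters; with fixed schemas there are constantly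
  many patterns. For one pattern the positive example bounds the chase of a competitor from above
  and the weakenings bound it from below. Blaming one fact per replica, not a set of facts, keeps
  the weakenings polynomial: an existential element has one replica per fact containing it, plus
  \<open>Full\<close>, and a fact of bounded arity has polynomially many lifts. Acyclicity enters
  twice: arc consistency is complete because \<open>q\<close> is a forest, and \<open>q\<close>
  avoids its weakenings because blame passed on from fact to fact cannot go on for ever in a forest.
  Minimality makes the endomorphisms of \<open>q\<close> bijective, so that blame can be pulled back
  along them. The time bound is proved for every input. On a cyclic mapping the program still halts
  in time, though its output need not characterize anything; hence every loop is bounded by the
  length of a list and not by an argument about forests.\<close>

abbreviation img :: "('a \<Rightarrow> 'b) \<Rightarrow> 'a atom \<Rightarrow> 'b atom" where
  "img h f \<equiv> (fst f, map h (snd f))"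

definition elems :: "'a atom set \<Rightarrow> 'a set" where
  "elems X = (\<Union>f\<in>X. set (snd f))"

definition hom_over :: "'a set \<Rightarrow> ('a \<Rightarrow> 'a) \<Rightarrow> 'a atom set \<Rightarrow> 'a atom set \<Rightarrow> bool" where
  "hom_over A h q p \<longleftrightarrow> (\<forall>a\<in>A. h a = a) \<and> (\<forall>f\<in>q. img h f \<in> p)"

definition maps_over :: "'a set \<Rightarrow> 'a atom set \<Rightarrow> 'a atom set \<Rightarrow> bool" where
  "maps_over A q p \<longleftrightarrow> (\<exists>h. hom_over A h q p)"

lemma hom_over_comp: "hom_over A h q p \<Longrightarrow> hom_over A k p r \<Longrightarrow> hom_over A (k \<circ> h) q r"
  unfolding hom_over_def by (force simp: comp_def)

lemma maps_over_trans: "maps_over A q p \<Longrightarrow> maps_over A p r \<Longrightarrow> maps_over A q r"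
  unfolding maps_over_def using hom_over_comp by blast

lemma maps_over_mono: "q \<subseteq> p \<Longrightarrow> maps_over A q p"
  unfolding maps_over_def hom_over_def by (rule exI[of _ id]) (auto simp: subset_iff)

section \<open>Forests of facts relative to the distinguished elements\<close>

definition leaf_fact :: "'a set \<Rightarrow> 'a atom set \<Rightarrow> 'a atom \<Rightarrow> bool" where
  "leaf_fact A X f \<longleftrightarrow>
     (\<forall>i j. i < j \<and> j < length (snd f) \<and> snd f ! i = snd f ! j \<longrightarrow> snd f ! i \<in> A) \<and>
     (\<exists>b. \<forall>x\<in>set (snd f) - A. x \<noteq> b \<longrightarrow> (\<forall>g\<in>X - {f}. x \<notin> set (snd g)))"

text \<open>Berge acyclicity after deleting \<open>A\<close>, phrased as hereditary leaf removal:
  inductions over facts use it in this form, and subsets inherit it.\<close>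

definition forest :: "'a set \<Rightarrow> 'a atom set \<Rightarrow> bool" where
  "forest A q \<longleftrightarrow> (\<forall>X\<subseteq>q. X \<noteq> {} \<longrightarrow> (\<exists>f\<in>X. leaf_fact A X f))"

lemma forest_subset: "forest A q \<Longrightarrow> p \<subseteq> q \<Longrightarrow> forest A p"
  unfolding forest_def by (meson order_trans)

lemma forest_no_repeat:
  assumes "forest A q" "f \<in> q" "i < j" "j < length (snd f)" "snd f ! i = snd f ! j"
  shows "snd f ! i \<in> A"
proof -
  have "leaf_fact A {f} f" using assms(1,2) unfolding forest_def by (metis empty_subsetI insert_not_empty insert_subset singletonD)
  then show ?thesis using assms(3-5) unfolding leaf_fact_def by blast
qed

lemma forest_unique_position:
  assumes "forest A q" "f \<in> q" "(b, x) \<in> set (zip (snd f) ys)" "(b, y) \<in> set (zip (snd f) ys)" "b \<notin> A"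
  shows "x = y"
proof -
  obtain i j where ij: "i < length (snd f)" "i < length ys" "snd f ! i = b" "ys ! i = x"
    "j < length (snd f)" "j < length ys" "snd f ! j = b" "ys ! j = y"
    using assms(3,4) by (auto simp: in_set_zip)
  then have "i = j"
    using forest_no_repeat[OF assms(1,2), of i j] forest_no_repeat[OF assms(1,2), of j i] assms(5)
    by (metis linorder_neqE_nat)
  then show ?thesis using ij by simp
qed

text \<open>Remove a leaf: it points elsewhere through its only shared element, so no other fact points
  to it.\<close>

lemma forest_no_escape:
  assumes "finite Y" "forest A Y" "Y \<noteq> {}"
    and "\<And>G. G \<in> Y \<Longrightarrow> \<exists>b\<in>set (snd G) - A. lab b \<in> Y \<and> lab b \<noteq> G \<and> b \<in> set (snd (lab b))"
  shows False
  using assms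
proof (induction "card Y" arbitrary: Y rule: less_induct)
  case less
  obtain f where f: "f \<in> Y" "leaf_fact A Y f"
    using less.prems(2,3) unfolding forest_def by blast
  obtain c where c: "\<And>x g. x \<in> set (snd f) - A \<Longrightarrow> x \<noteq> c \<Longrightarrow> g \<in> Y - {f} \<Longrightarrow> x \<notin> set (snd g)"
    using f(2) unfolding leaf_fact_def by blast
  obtain b where b: "b \<in> set (snd f) - A" "lab b \<in> Y" "lab b \<noteq> f" "b \<in> set (snd (lab b))"
    using less.prems(4)[OF f(1)] by blast
  have bc: "b = c" using c[of b "lab b"] b by blast
  show False
  proof (rule less.hyps[of "Y - {f}"])
    show "card (Y - {f}) < card Y" using f(1) less.prems(1) by (meson card_Diff1_less)
    show "finite (Y - {f})" using less.prems(1) by simp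
    show "forest A (Y - {f})" using less.prems(2) forest_subset by blast
    show "Y - {f} \<noteq> {}" using b by blast
    fix G assume G: "G \<in> Y - {f}"
    then obtain x where x: "x \<in> set (snd G) - A" "lab x \<in> Y" "lab x \<noteq> G" "x \<in> set (snd (lab x))"
      using less.prems(4) by blast
    have "lab x \<noteq> f"
    proof
      assume "lab x = f"
      then have "x = c" using c[of x G] x G by blast
      then show False using bc b(3) \<open>lab x = f\<close> by simp
    qed
    then show "\<exists>b\<in>set (snd G) - A. lab b \<in> Y - {f} \<and> lab b \<noteq> G \<and> b \<in> set (snd (lab b))"
      using x by blast
  qed
qed

section \<open>Arc consistency on forests\<close>

definition supports :: "'a set \<Rightarrow> ('a \<times> 'a) set \<Rightarrow> 'a \<times> 'a \<Rightarrow> 'a atom \<Rightarrow> 'a atom \<Rightarrow> bool" where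
  "supports A W be f f' \<longleftrightarrow> fst f = fst f' \<and> length (snd f) = length (snd f') \<and>
     (\<forall>(x, y)\<in>set (zip (snd f) (snd f')). (if x \<in> A then y = x else (x, y) \<in> W) \<and>
       (x = fst be \<longrightarrow> y = snd be))"

text \<open>One round of arc consistency with whole facts as constraints. All pairs are tested
  against the same old \<open>W\<close>, so each deleted pair has a definite time of deletion, which
  later singles out the fact to blame.\<close>

definition revise :: "'a set \<Rightarrow> 'a atom set \<Rightarrow> 'a atom set \<Rightarrow> ('a \<times> 'a) set \<Rightarrow> ('a \<times> 'a) set" where
  "revise A q p W = {be\<in>W. \<forall>f\<in>q. fst be \<in> set (snd f) \<longrightarrow> (\<exists>f'\<in>p. supports A W be f f')}"

lemma zip_map_eq:
  assumes "length xs = length ys" "\<And>x y. (x, y) \<in> set (zip xs ys) \<Longrightarrow> h x = y"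
  shows "map h xs = ys"
  using assms by (induction xs ys rule: list_induct2) auto

text \<open>Peel off leaf facts. A leaf meets the remaining facts in at most one existential
  element; the value chosen for it there has a support in \<open>p\<close>, and this fact supplies
  the values of the other elements. Facts lying within \<open>A\<close> have no candidates to prune,
  hence the separate last assumption.\<close>

lemma arc_consistent_hom:
  assumes "finite X" "forest A X" "X \<subseteq> q" "W \<subseteq> revise A q p W"
    and "\<And>b. b \<in> elems X - A \<Longrightarrow> \<exists>e. (b, e) \<in> W"
    and "\<And>f. f \<in> X \<Longrightarrow> set (snd f) \<subseteq> A \<Longrightarrow> f \<in> p"
  shows "\<exists>h. hom_over A h X p \<and> (\<forall>b\<in>elems X - A. (b, h b) \<in> W)"
  using assms
proof (induction "card X" arbitrary: X rule: less_induct)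
  case less
  show ?case
  proof (cases "X = {}")
    case True
    then show ?thesis by (intro exI[of _ id]) (auto simp: hom_over_def elems_def)
  next
    case False
    then obtain f where f: "f \<in> X" "leaf_fact A X f"
      using less.prems(2) unfolding forest_def by blast
    let ?Y = "X - {f}"
    have "\<exists>h. hom_over A h ?Y p \<and> (\<forall>b\<in>elems ?Y - A. (b, h b) \<in> W)"
    proof (rule less.hyps)
      show "card ?Y < card X" using f(1) less.prems(1) by (meson card_Diff1_less)
      show "forest A ?Y" using less.prems(2) forest_subset by blast
      show "\<exists>e. (b, e) \<in> W" if "b \<in> elems ?Y - A" for b
        using that less.prems(5)[of b] by (auto simp: elems_def)
    qed (use less.prems in auto)
    then obtain h where h: "hom_over A h ?Y p" "\<And>b. b \<in> elems ?Y - A \<Longrightarrow> (b, h b) \<in> W"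
      by blast
    obtain c where c: "\<And>x. x \<in> set (snd f) - A \<Longrightarrow> x \<noteq> c \<Longrightarrow> x \<notin> elems ?Y"
      using f(2) unfolding leaf_fact_def elems_def by blast
    show ?thesis
    proof (cases "set (snd f) \<subseteq> A")
      case True
      then have "img h f = f"
        using h(1) unfolding hom_over_def by (cases f) (auto simp: map_idI subset_iff)
      then have "hom_over A h X p"
        using h(1) less.prems(6)[OF f(1) True] unfolding hom_over_def by auto
      moreover have "elems X - A = elems ?Y - A" using True unfolding elems_def by blast
      ultimately show ?thesis using h(2) by auto
    next
      case False
      \<comment> \<open>If the connecting element \<open>c\<close> is not an existential element of
        \<open>f\<close>, then \<open>f\<close> is detached from the rest and any of its existential
        elements can start the extension.\<close>
      obtain b where b: "b \<in> set (snd f) - A" "\<And>x. x \<in> set (snd f) - A \<Longrightarrow> x \<noteq> b \<Longrightarrow> x \<notin> elems ?Y"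
        using False c by (metis Diff_iff subsetI)
      obtain e where e: "(b, e) \<in> W" "b \<in> elems ?Y \<Longrightarrow> e = h b"
      proof (cases "b \<in> elems ?Y")
        case True then show ?thesis using h(2) b(1) that by blast
      next
        case False
        have "b \<in> elems X - A" using b(1) f(1) unfolding elems_def by blast
        then show ?thesis using less.prems(5) False that by blast
      qed
      have "(b, e) \<in> revise A q p W" using less.prems(4) e(1) by blast
      then obtain f' where f': "f' \<in> p" "supports A W (b, e) f f'"
        using f(1) less.prems(3) b(1) unfolding revise_def by auto
      let ?Z = "zip (snd f) (snd f')"
      \<comment> \<open>Old values are kept, and a new element takes the value at its position in
        \<open>f'\<close>; this position is unique in a forest.\<close>
      define k where "k x = (if x \<in> A \<or> x \<in> elems ?Y then h x else SOME y. (x, y) \<in> set ?Z)" for x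
      have len: "length (snd f) = length (snd f')" using f'(2) unfolding supports_def by blast
      have kZ: "k x = y" if xy: "(x, y) \<in> set ?Z" for x y
      proof -
        have sup: "if x \<in> A then y = x else (x, y) \<in> W" "x = b \<longrightarrow> y = e"
          using f'(2) xy unfolding supports_def by auto
        have xf: "x \<in> set (snd f)" using xy by (meson set_zip_leftD)
        consider "x \<in> A" | "x \<notin> A" "x \<in> elems ?Y" | "x \<notin> A" "x \<notin> elems ?Y" by blast
        then show ?thesis
        proof cases
          case 1 then show ?thesis using h(1) sup unfolding k_def hom_over_def by auto
        next
          case 2
          then have "x = b" using b(2) xf by blast
          then show ?thesis using 2 sup e(2) unfolding k_def by auto
        next
          case 3
          have "(x, SOME y. (x, y) \<in> set ?Z) \<in> set ?Z" using xy by (rule someI)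
          from forest_unique_position[OF less.prems(2) f(1) this xy 3(1)]
          show ?thesis using 3 unfolding k_def by auto
        qed
      qed
      have kf: "img k f = f'"
      proof -
        have "map k (snd f) = snd f'" by (rule zip_map_eq[OF len]) (use kZ in blast)
        moreover have "fst f = fst f'" using f'(2) unfolding supports_def by blast
        ultimately show ?thesis by (simp add: prod_eq_iff)
      qed
      have kh: "k x = h x" if "x \<in> elems ?Y" for x using that unfolding k_def by auto
      have "hom_over A k X p"
        unfolding hom_over_def
      proof (intro conjI ballI)
        fix a assume "a \<in> A" then show "k a = a" using h(1) unfolding k_def hom_over_def by auto
      next
        fix g assume g: "g \<in> X"
        show "img k g \<in> p"
        proof (cases "g = f")
          case True then show ?thesis using kf f'(1) by metis
        next
          case False
          then have gY: "g \<in> ?Y" using g by blast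
          have eq: "img k g = img h g" using gY kh by (auto simp: elems_def)
          show ?thesis unfolding eq using h(1) gY unfolding hom_over_def by blast
        qed
      qed
      moreover have "(x, k x) \<in> W" if x: "x \<in> elems X - A" for x
      proof (cases "x \<in> elems ?Y")
        case True then show ?thesis using h(2) x kh by auto
      next
        case False
        then have "x \<in> set (snd f)" using x unfolding elems_def by blast
        then obtain y where "(x, y) \<in> set ?Z" using len
          by (metis in_set_impl_in_set_zip1)
        moreover from this have "(x, y) \<in> W" using x f'(2) unfolding supports_def by auto
        ultimately show ?thesis using kZ by metis
      qed
      ultimately show ?thesis by blast
    qed
  qed
qed

definition stage :: "'a set \<Rightarrow> 'a atom set \<Rightarrow> 'a atom set \<Rightarrow> nat \<Rightarrow> ('a \<times> 'a) set" where
  "stage A q p n = (revise A q p ^^ n) (elems q \<times> elems p)"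

lemma revise_subset: "revise A q p W \<subseteq> W"
  unfolding revise_def by blast

lemma stage_Suc: "stage A q p (Suc n) = revise A q p (stage A q p n)"
  unfolding stage_def by simp

lemma stage_antimono: "m \<le> n \<Longrightarrow> stage A q p n \<subseteq> stage A q p m"
  by (induction n rule: dec_induct) (use revise_subset stage_Suc in \<open>fastforce+\<close>)

lemma finite_elems: "finite X \<Longrightarrow> finite (elems X)"
  unfolding elems_def by simp

text \<open>A round that changes the set loses an element, and once a round changes nothing all
  later ones change nothing.\<close>

lemma funpow_decreasing_stable:
  assumes "finite W" "\<And>V. F V \<subseteq> V" "card W \<le> n"
  shows "F ((F ^^ n) W) = (F ^^ n) (W :: 'a set)"
proof -
  have fin: "finite ((F ^^ k) W)" for k
    by (induction k) (use assms in \<open>auto intro: finite_subset\<close>)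
  have "\<exists>k\<le>n. F ((F ^^ k) W) = (F ^^ k) W"
  proof (rule ccontr)
    assume neg: "\<not> ?thesis"
    have "k \<le> Suc n \<Longrightarrow> card ((F ^^ k) W) + k \<le> card W" for k
    proof (induction k)
      case (Suc k)
      have "F ((F ^^ k) W) \<subset> (F ^^ k) W" using neg Suc.prems assms(2) by (metis Suc_le_mono psubsetI)
      then have "card (F ((F ^^ k) W)) < card ((F ^^ k) W)" using fin psubset_card_mono by blast
      then show ?case using Suc by simp
    qed simp
    from this[of "Suc n"] assms(3) show False by simp
  qed
  then obtain k where k: "k \<le> n" "F ((F ^^ k) W) = (F ^^ k) W" by blast
  have "(F ^^ (k + d)) W = (F ^^ k) W" for d by (induction d) (use k in auto)
  from this[of "n - k"] this[of "Suc (n - k)"] k(1) show ?thesis by simp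
qed

lemma stage_stable:
  assumes "finite q" "finite p" "card (elems q \<times> elems p) \<le> n"
  shows "revise A q p (stage A q p n) = stage A q p n"
  unfolding stage_def using assms
  by (intro funpow_decreasing_stable revise_subset) (auto simp: finite_elems)

text \<open>The right-hand side is a single check after pruning. It says at once that every
  existential element has kept a candidate and that the facts over \<open>A\<close> lie in
  \<open>p\<close>, as \<open>arc_consistent_hom\<close> requires.\<close>

lemma arc_consistency_decides:
  assumes "finite q" "forest A q" "W = revise A q p W"
    and "\<And>h. hom_over A h q p \<Longrightarrow> \<forall>b\<in>elems q. (b, h b) \<in> W"
  shows "maps_over A q p \<longleftrightarrow> (\<forall>f\<in>q. \<exists>f'\<in>p. fst f = fst f' \<and> length (snd f) = length (snd f') \<and>
     (\<forall>(x, y)\<in>set (zip (snd f) (snd f')). if x \<in> A then y = x else (x, y) \<in> W))" (is "_ \<longleftrightarrow> ?R")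
proof
  assume "maps_over A q p"
  then obtain h where h: "hom_over A h q p" unfolding maps_over_def by blast
  show ?R
  proof
    fix f assume f: "f \<in> q"
    have "\<forall>(x, y)\<in>set (zip (snd f) (map h (snd f))). if x \<in> A then y = x else (x, y) \<in> W"
    proof clarify
      fix x y assume xy: "(x, y) \<in> set (zip (snd f) (map h (snd f)))"
      then have "y = h x" "x \<in> set (snd f)" by (auto simp: in_set_zip)
      then show "if x \<in> A then y = x else (x, y) \<in> W"
        using h assms(4)[OF h] f unfolding hom_over_def elems_def by auto
    qed
    moreover have "img h f \<in> p" using h f unfolding hom_over_def by blast
    ultimately show "\<exists>f'\<in>p. fst f = fst f' \<and> length (snd f) = length (snd f') \<and>
     (\<forall>(x, y)\<in>set (zip (snd f) (snd f')). if x \<in> A then y = x else (x, y) \<in> W)"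
      by (intro bexI[of _ "img h f"]) auto
  qed
next
  assume R: ?R
  have "\<exists>h. hom_over A h q p \<and> (\<forall>b\<in>elems q - A. (b, h b) \<in> W)"
  proof (rule arc_consistent_hom[where q = q])
    show "\<exists>e. (b, e) \<in> W" if "b \<in> elems q - A" for b
    proof -
      obtain f where f: "f \<in> q" "b \<in> set (snd f)" "b \<notin> A" using \<open>b \<in> elems q - A\<close> unfolding elems_def by blast
      then obtain f' where f': "fst f = fst f'" "length (snd f) = length (snd f')"
        "\<forall>(x, y)\<in>set (zip (snd f) (snd f')). if x \<in> A then y = x else (x, y) \<in> W"
        using R by blast
      obtain y where y: "(b, y) \<in> set (zip (snd f) (snd f'))"
        using f(2) f'(2) by (metis in_set_impl_in_set_zip1)
      show ?thesis using bspec[OF f'(3) y] f(3) by auto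
    qed
    show "f \<in> p" if f: "f \<in> q" "set (snd f) \<subseteq> A" for f
    proof -
      obtain f' where f': "f' \<in> p" "fst f = fst f'" "length (snd f) = length (snd f')"
        "\<forall>(x, y)\<in>set (zip (snd f) (snd f')). if x \<in> A then y = x else (x, y) \<in> W" using R f by blast
      have "map id (snd f) = snd f'"
      proof (rule zip_map_eq[OF f'(3)])
        fix x y assume "(x, y) \<in> set (zip (snd f) (snd f'))"
        then show "id x = y" using f'(4) f(2) by (auto dest: set_zip_leftD split: if_splits)
      qed
      then have "f = f'" using f'(2) by (simp add: prod_eq_iff)
      then show ?thesis using f'(1) by simp
    qed
  qed (use assms in auto)
  then show "maps_over A q p" unfolding maps_over_def by blast
qed

lemma hom_in_revise:
  assumes "hom_over A h q p" "\<forall>b\<in>elems q. (b, h b) \<in> W"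
  shows "\<forall>b\<in>elems q. (b, h b) \<in> revise A q p W"
proof
  fix b assume b: "b \<in> elems q"
  have "\<exists>f'\<in>p. supports A W (b, h b) f f'" if "f \<in> q" for f
  proof
    show "img h f \<in> p" using assms(1) that unfolding hom_over_def by blast
    show "supports A W (b, h b) f (img h f)"
      using assms that unfolding supports_def hom_over_def elems_def
      by (auto simp: in_set_zip)
  qed
  then show "(b, h b) \<in> revise A q p W" using b assms(2) unfolding revise_def by auto
qed

lemma hom_in_stage:
  assumes "hom_over A h q p"
  shows "\<forall>b\<in>elems q. (b, h b) \<in> stage A q p n"
proof (induction n)
  case 0
  then show ?case using assms unfolding stage_def elems_def hom_over_def by force
next
  case (Suc n)
  then show ?case using hom_in_revise[OF assms] unfolding stage_Suc by blast
qed

text \<open>Labels of replicas: \<open>Excl r\<close> marks an existential element at which the fact \<open>r\<close> fails, \<open>Fake\<close> an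
  element lying over a distinguished element without being it; \<open>Full\<close> elements do not fail. A fact
  over \<open>g\<close> is excused by a failing element whose failure is not due to \<open>g\<close> itself.\<close>

datatype 'e lab = Full | Fake | Excl "'e atom"

definition reps :: "'e set \<Rightarrow> 'e atom set \<Rightarrow> 'e \<Rightarrow> ('e \<times> 'e lab) set" where
  "reps A q x = insert (x, Full) (if x \<in> A then {(x, Fake)} else {(x, Excl r) |r. r \<in> q \<and> x \<in> set (snd r)})"

text \<open>By the second disjunct the \<open>Full\<close> replicas form a copy of \<open>q\<close>
  without \<open>f\<close>. By the first, a lift of any fact, even of \<open>f\<close>, is present
  as soon as one of its replicas is \<open>Fake\<close> or blames a different fact.\<close>

definition allowed :: "'e atom \<Rightarrow> 'e atom \<Rightarrow> ('e \<times> 'e lab) list \<Rightarrow> bool" where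
  "allowed f g rs \<longleftrightarrow> (\<exists>r\<in>set rs. snd r \<noteq> Full \<and> snd r \<noteq> Excl g) \<or> (g \<noteq> f \<and> (\<forall>r\<in>set rs. snd r = Full))"

definition weaken :: "'e set \<Rightarrow> 'e atom set \<Rightarrow> 'e atom \<Rightarrow> ('e \<times> 'e lab) atom set" where
  "weaken A q f = {(fst g, rs) |g rs. g \<in> q \<and> map fst rs = snd g \<and> (\<forall>r\<in>set rs. r \<in> reps A q (fst r)) \<and> allowed f g rs}"

text \<open>Among the elements of a fact over \<open>G\<close>, take one that is deleted first by arc consistency. If
  \<open>G\<close> were responsible, the fact itself would support the deleted pair.\<close>

lemma weaken_complete:
  assumes "finite q" "finite p" "forest A q"
    and g: "hom_over A g p q" and neg: "\<not> maps_over A q p"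
  shows "\<exists>f\<in>q. \<exists>h. (\<forall>a\<in>A. h a = (a, Full)) \<and> (\<forall>f'\<in>p. img h f' \<in> weaken A q f)"
proof -
  let ?n = "card (elems q \<times> elems p)"
  let ?st = "stage A q p"
  define W where "W = ?st ?n"
  have stable: "W = revise A q p W" unfolding W_def using stage_stable[OF assms(1,2)] by blast
  have W_le: "W \<subseteq> ?st m" for m
  proof (cases "m \<le> ?n")
    case True then show ?thesis unfolding W_def by (rule stage_antimono)
  next
    case False
    have "?st (?n + d) = W" for d
      by (induction d) (use stable in \<open>auto simp: W_def stage_Suc\<close>)
    from this[of "m - ?n"] False show ?thesis by simp
  qed
  \<comment> \<open>This \<open>f\<close> selects the weakening into which \<open>p\<close> maps. If
    there were none, the surviving pairs would contain a homomorphism.\<close>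
  have "\<exists>f\<in>q. (set (snd f) \<subseteq> A \<and> f \<notin> p) \<or> (\<exists>b\<in>set (snd f) - A. \<forall>e. (b, e) \<notin> W)"
  proof (rule ccontr)
    assume no: "\<not> ?thesis"
    have "\<exists>h. hom_over A h q p \<and> (\<forall>b\<in>elems q - A. (b, h b) \<in> W)"
      by (rule arc_consistent_hom[where q = q])
        (use assms(1,3) stable no in \<open>auto simp: elems_def\<close>)
    with neg show False unfolding maps_over_def by blast
  qed
  then obtain f where f: "f \<in> q" "(set (snd f) \<subseteq> A \<and> f \<notin> p) \<or> (\<exists>b\<in>set (snd f) - A. \<forall>e. (b, e) \<notin> W)"
    by blast
  \<comment> \<open>Each element \<open>e\<close> of \<open>p\<close> is regarded as a candidate for
    its image \<open>g e\<close>. \<open>tm e\<close> is the first stage without this pair, and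
    \<open>rn e\<close> is a fact at which the pair had no support one stage earlier.\<close>
  define dead where "dead e \<longleftrightarrow> g e \<notin> A \<and> (g e, e) \<notin> W" for e
  define tm where "tm e = (LEAST n. (g e, e) \<notin> ?st n)" for e
  define rn where "rn e = (SOME r. r \<in> q \<and> g e \<in> set (snd r) \<and> (\<forall>f'\<in>p. \<not> supports A (?st (tm e - 1)) (g e, e) r f'))" for e
  have tm: "(g e, e) \<notin> ?st (tm e)" if "dead e" for e
    unfolding tm_def by (rule LeastI[of _ ?n]) (use that in \<open>auto simp: dead_def W_def\<close>)
  have tm_in: "(g e, e) \<in> ?st n" if "n < tm e" for e n
    using not_less_Least[of n "\<lambda>n. (g e, e) \<notin> ?st n"] that unfolding tm_def by blast
  have rn: "rn e \<in> q \<and> g e \<in> set (snd (rn e)) \<and> (\<forall>f'\<in>p. \<not> supports A (?st (tm e - 1)) (g e, e) (rn e) f')"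
    if e: "dead e" "e \<in> elems p" for e
    unfolding rn_def
  proof (rule someI_ex)
    have "tm e \<noteq> 0"
    proof
      assume "tm e = 0"
      then have "(g e, e) \<notin> elems q \<times> elems p" using tm[OF e(1)] unfolding stage_def by simp
      moreover have "g e \<in> elems q" using e(2) g unfolding elems_def hom_over_def by force
      ultimately show False using e(2) by blast
    qed
    then obtain m where m: "tm e = Suc m" using not0_implies_Suc by blast
    have "(g e, e) \<in> ?st m" using tm_in m by simp
    moreover have "(g e, e) \<notin> revise A q p (?st m)" using tm[OF e(1)] unfolding m stage_Suc by simp
    ultimately show "\<exists>r. r \<in> q \<and> g e \<in> set (snd r) \<and> (\<forall>f'\<in>p. \<not> supports A (?st (tm e - 1)) (g e, e) r f')"
      unfolding m revise_def mem_Collect_eq fst_conv diff_Suc_1 by blast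
  qed
  define h where "h e = (g e, if dead e then Excl (rn e) else if g e \<in> A \<and> e \<notin> A then Fake else Full)" for e
  have ga: "g a = a" if "a \<in> A" for a using g that unfolding hom_over_def by blast
  have "img h f' \<in> weaken A q f" if f': "f' \<in> p" for f'
  proof -
    let ?G = "img g f'"
    have G: "?G \<in> q" using g f' unfolding hom_over_def by blast
    have el: "e \<in> elems p" if "e \<in> set (snd f')" for e using that f' unfolding elems_def by blast
    have "\<forall>r\<in>set (map h (snd f')). r \<in> reps A q (fst r)"
    proof
      fix r assume "r \<in> set (map h (snd f'))"
      then obtain e where e: "e \<in> set (snd f')" and r: "r = h e" by auto
      show "r \<in> reps A q (fst r)"
      proof (cases "dead e")
        case True
        then have "h e = (g e, Excl (rn e))" "g e \<notin> A" unfolding h_def dead_def by auto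
        then show ?thesis using rn[OF True el[OF e]] unfolding reps_def r by (simp del: split_paired_Ex)
      qed (auto simp: h_def reps_def r)
    qed
    moreover have "allowed f ?G (map h (snd f'))"
    proof (cases "\<exists>e\<in>set (snd f'). g e \<in> A \<and> e \<notin> A")
      case True
      then obtain e where e: "e \<in> set (snd f')" "g e \<in> A" "e \<notin> A" by blast
      then have "snd (h e) = Fake" unfolding h_def dead_def by simp
      moreover have "h e \<in> set (map h (snd f'))" using e(1) by simp
      ultimately show ?thesis unfolding allowed_def by (metis lab.distinct(1,5))
    next
      case noFake: False
      show ?thesis
      proof (cases "\<exists>e\<in>set (snd f'). dead e")
        case False
        \<comment> \<open>With only \<open>Full\<close> labels no pair of this fact was deleted,
          whereas \<open>f\<close> is missing over \<open>A\<close> or has an element all of whose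
          pairs were deleted.\<close>
        have "?G \<noteq> f"
        proof
          assume Gf: "?G = f"
          have sf: "set (snd f) = g ` set (snd f')" unfolding Gf[symmetric] snd_conv by (rule list.set_map)
          from f(2) show False
          proof
            assume 1: "set (snd f) \<subseteq> A \<and> f \<notin> p"
            then have "\<forall>e\<in>set (snd f'). g e = e" using noFake ga unfolding sf by blast
            then have "?G = f'" by (simp add: map_idI prod_eq_iff)
            then show False using 1 f' Gf by simp
          next
            assume "\<exists>b\<in>set (snd f) - A. \<forall>e. (b, e) \<notin> W"
            then show False using False unfolding sf dead_def by blast
          qed
        qed
        then show ?thesis using False noFake unfolding allowed_def h_def by auto
      next
        case True
        then obtain e where e: "e \<in> set (snd f')" "dead e"
          "\<And>y. y \<in> set (snd f') \<Longrightarrow> dead y \<Longrightarrow> tm e \<le> tm y"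
          using ex_has_least_nat[of "\<lambda>e. e \<in> set (snd f') \<and> dead e" _ tm] by blast
        have "rn e \<noteq> ?G"
        proof
          assume r: "rn e = ?G"
          have "supports A (?st (tm e - 1)) (g e, e) ?G f'"
            unfolding supports_def
          proof (intro conjI ballI, simp, simp, clarify)
            fix x y assume xy: "(x, y) \<in> set (zip (snd ?G) (snd f'))"
            then have x: "x = g y" "y \<in> set (snd f')" by (auto simp: in_set_zip)
            have ee: "(g e, e) \<in> set (zip (snd ?G) (snd f'))"
              using e(1) by (auto simp: in_set_zip in_set_conv_nth)
            \<comment> \<open>\<open>g e\<close> is existential and so occurs only once in this
              fact; this settles the last clause of \<open>supports\<close>.\<close>
            have "y = e" if "x = g e"
              using forest_unique_position[OF assms(3) G xy[unfolded that] ee] e(2) unfolding dead_def by blast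
            moreover have "y = x" if "x \<in> A" using that x noFake ga by metis
            moreover have "(x, y) \<in> ?st (tm e - 1)" if "x \<notin> A"
            proof (cases "dead y")
              case True
              \<comment> \<open>Stage 0 contains all pairs of elements, so a deletion always has a
                preceding stage.\<close>
              have "tm e - 1 < tm e"
              proof (rule ccontr)
                assume "\<not> ?thesis"
                then have "tm e = 0" by simp
                then have "(g e, e) \<notin> elems q \<times> elems p" using tm[OF e(2)] unfolding stage_def by simp
                moreover have "g e \<in> elems q" unfolding elems_def by (rule UN_I[OF G]) (use e(1) in simp)
                ultimately show False using el[OF e(1)] by blast
              qed
              then show ?thesis using e(3)[OF x(2) True] tm_in x(1) by simp
            next
              case False
              then show ?thesis using that x(1) W_le unfolding dead_def by blast
            qed
            ultimately show "(if x \<in> A then y = x else (x, y) \<in> ?st (tm e - 1)) \<and>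
              (x = fst (g e, e) \<longrightarrow> y = snd (g e, e))" by auto
          qed
          then show False using rn[OF e(2) el[OF e(1)]] f' r by metis
        qed
        moreover have "snd (h e) = Excl (rn e)" using e(2) unfolding h_def by simp
        moreover have "h e \<in> set (map h (snd f'))" using e(1) by simp
        ultimately show ?thesis unfolding allowed_def by (metis lab.distinct(3) lab.inject)
      qed
    qed
    ultimately show ?thesis
      unfolding weaken_def using G
      by (intro CollectI exI[of _ ?G] exI[of _ "map h (snd f')"]) (auto simp: h_def)
  qed
  moreover have "\<forall>a\<in>A. h a = (a, Full)" using ga unfolding h_def dead_def by auto
  ultimately show ?thesis using f(1) by blast
qed

section \<open>Minimal structures and their weakenings\<close>

definition rigid :: "'a set \<Rightarrow> 'a atom set \<Rightarrow> bool" where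
  "rigid A q \<longleftrightarrow> (\<forall>f\<in>q. \<not> maps_over A q (q - {f}))"

text \<open>An endomorphism that misses a fact would itself witness that this fact is
  redundant.\<close>

lemma rigid_surj:
  assumes "rigid A q" "hom_over A g q q"
  shows "img g ` q = q"
proof (rule ccontr)
  assume "img g ` q \<noteq> q"
  then obtain f where "f \<in> q" "f \<notin> img g ` q" using assms(2) unfolding hom_over_def by blast
  then have "hom_over A g q (q - {f})" using assms(2) unfolding hom_over_def by blast
  then show False using assms(1) \<open>f \<in> q\<close> unfolding rigid_def maps_over_def by blast
qed

lemma elems_img: "elems (img g ` q) = g ` elems q"
  unfolding elems_def by auto

lemma rigid_inj:
  assumes "finite q" "rigid A q" "hom_over A g q q"
  shows "inj_on g (elems q)" and "g ` elems q = elems q"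
proof -
  show *: "g ` elems q = elems q"
    using rigid_surj[OF assms(2,3)] elems_img[of g q] by simp
  then show "inj_on g (elems q)" using finite_elems[OF assms(1)] by (simp add: eq_card_imp_inj_on)
qed

text \<open>Beneath \<open>h\<close> lies an endomorphism \<open>g\<close> of \<open>q\<close>,
  bijective by rigidity, so no \<open>Fake\<close> replica is hit and blamed facts can be pulled
  back along \<open>g\<close>. The fact over \<open>f\<close> has to blame another fact; that one
  contains a failing element and has to blame a further one, and so on, which
  \<open>forest_no_escape\<close> excludes.\<close>

lemma weaken_avoids:
  assumes "finite q" "forest A q" "rigid A q" "f \<in> q"
    and h: "\<forall>a\<in>A. h a = (a, Full)" "\<forall>f'\<in>q. img h f' \<in> weaken A q f"
  shows False
proof -
  define g where "g = fst \<circ> h"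
  have inst: "img g G \<in> q \<and> (\<forall>x\<in>set (snd G). h x \<in> reps A q (g x)) \<and> allowed f (img g G) (map h (snd G))"
    if "G \<in> q" for G
  proof -
    have "img h G \<in> weaken A q f" using h(2) that by blast
    then obtain g' where "fst G = fst g'" "g' \<in> q" "map fst (map h (snd G)) = snd g'"
      "\<forall>r\<in>set (map h (snd G)). r \<in> reps A q (fst r)" "allowed f g' (map h (snd G))"
      unfolding weaken_def by auto
    moreover from this have "g' = img g G" unfolding g_def by (simp add: prod_eq_iff)
    ultimately show ?thesis unfolding g_def by auto
  qed
  have hom: "hom_over A g q q" using inst h(1) unfolding hom_over_def g_def by auto
  note inj = rigid_inj[OF assms(1,3) hom] and surj = rigid_surj[OF assms(3) hom]
  have nA: "g x \<notin> A" if "x \<in> elems q" "x \<notin> A" for x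
  proof
    assume "g x \<in> A"
    then have "g (g x) = g x" using hom unfolding hom_over_def by blast
    moreover have "g x \<in> elems q" using inj(2) that(1) by blast
    ultimately have "g x = x" using inj(1) that(1) by (meson inj_onD)
    then show False using \<open>g x \<in> A\<close> that(2) by simp
  qed
  have cases: "snd (h x) = Full \<or> (x \<notin> A \<and> (\<exists>r\<in>q. snd (h x) = Excl r \<and> g x \<in> set (snd r)))"
    if xe: "x \<in> elems q" for x
  proof -
    obtain G where "G \<in> q" "x \<in> set (snd G)" using xe unfolding elems_def by blast
    then have "h x \<in> reps A q (g x)" using inst by blast
    then show ?thesis
    proof (cases "x \<in> A")
      case True then show ?thesis using h(1) by simp
    next
      case False
      then show ?thesis using \<open>h x \<in> reps A q (g x)\<close> nA[OF xe False] unfolding reps_def by auto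
    qed
  qed
  \<comment> \<open>Labels name facts on the image side of \<open>g\<close>; \<open>pull\<close>
    returns them to the side on which \<open>h\<close> is defined.\<close>
  define pull where "pull r = (SOME G. G \<in> q \<and> img g G = r)" for r
  have pull: "pull r \<in> q \<and> img g (pull r) = r" if "r \<in> q" for r
    unfolding pull_def
  proof (rule someI_ex)
    have "r \<in> img g ` q" unfolding surj by (rule that)
    then show "\<exists>G. G \<in> q \<and> img g G = r" by (elim imageE) (rule exI, rule conjI, assumption, rule sym)
  qed
  define lab where "lab x = (case snd (h x) of Excl r \<Rightarrow> pull r | _ \<Rightarrow> undefined)" for x
  define Y where "Y = {G\<in>q. \<exists>x\<in>set (snd G). snd (h x) \<noteq> Full}"
  have esc: "\<exists>b\<in>set (snd G) - A. lab b \<in> Y \<and> lab b \<noteq> G \<and> b \<in> set (snd (lab b))"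
    if G: "G \<in> q" "\<exists>x\<in>set (snd G). snd (h x) \<noteq> Full \<and> snd (h x) \<noteq> Excl (img g G)" for G
  proof -
    obtain x where x: "x \<in> set (snd G)" "snd (h x) \<noteq> Full" "snd (h x) \<noteq> Excl (img g G)" using G(2) by blast
    have xe: "x \<in> elems q" using x(1) G(1) unfolding elems_def by blast
    obtain r where r: "x \<notin> A" "r \<in> q" "snd (h x) = Excl r" "g x \<in> set (snd r)"
      using cases[OF xe] x(2) by blast
    have lx: "lab x = pull r" unfolding lab_def r(3) by simp
    have "snd r = map g (snd (pull r))" using conjunct2[OF pull[OF r(2)]] by (metis snd_conv)
    then have "g x \<in> g ` set (snd (pull r))" using r(4) by simp
    then obtain y where y: "y \<in> set (snd (pull r))" "g x = g y" by blast
    have "y \<in> elems q" using y(1) pull[OF r(2)] unfolding elems_def by blast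
    then have "x = y" using inj(1) xe y(2) by (meson inj_onD)
    then have xp: "x \<in> set (snd (lab x))" using y lx by simp
    have "lab x \<noteq> G" using x(3) r(3) lx pull[OF r(2)] by metis
    moreover have "lab x \<in> Y" unfolding Y_def using xp lx pull[OF r(2)] x(2) by auto
    ultimately show ?thesis using xp x(1) r(1) by blast
  qed
  have escY: "\<exists>b\<in>set (snd G) - A. lab b \<in> Y \<and> lab b \<noteq> G \<and> b \<in> set (snd (lab b))" if "G \<in> Y" for G
  proof (rule esc)
    show "G \<in> q" using that unfolding Y_def by blast
    then show "\<exists>x\<in>set (snd G). snd (h x) \<noteq> Full \<and> snd (h x) \<noteq> Excl (img g G)"
      using inst[of G] that unfolding Y_def allowed_def by auto
  qed
  \<comment> \<open>Over \<open>f\<close> the lift with all labels \<open>Full\<close> is forbidden,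
    so the fact that \<open>g\<close> sends to \<open>f\<close> starts the chain of blame.\<close>
  have "\<exists>b\<in>set (snd (pull f)) - A. lab b \<in> Y \<and> lab b \<noteq> pull f \<and> b \<in> set (snd (lab b))"
    by (rule esc) (use inst[of "pull f"] pull[OF assms(4)] in \<open>auto simp: allowed_def\<close>)
  then have "Y \<noteq> {}" by blast
  moreover have "finite Y" "Y \<subseteq> q" unfolding Y_def using assms(1) by auto
  ultimately show False using forest_no_escape[of Y A lab] forest_subset[OF assms(2)] escY by blast
qed

section \<open>Cycles of the incidence graph and leaves\<close>

lemma walk_contains_cycle:
  assumes e: "\<And>k. e k \<in> incidence_edges A" "\<And>k. ends (e k) = {v k, v (Suc k)}"
    and step: "\<And>k. v (Suc (Suc k)) \<noteq> v k" "\<And>k. v (Suc k) \<noteq> v k" and fin: "finite (range v)"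
  shows "\<exists>vs es. incidence_cycle A vs es \<and> set vs \<subseteq> range v"
proof -
  have "\<not> inj v" using fin finite_imageD infinite_UNIV_nat by blast
  then obtain a b where "a < b" "v a = v b" unfolding inj_def by (metis linorder_neqE_nat)
  then have ex: "\<exists>j. v j \<in> v ` {..<j}" by (metis image_eqI lessThan_iff)
  \<comment> \<open>Stop at the first vertex that was visited before: the vertices from
    \<open>i\<close> up to \<open>j - 1\<close> are then distinct.\<close>
  define j where "j = (LEAST j. v j \<in> v ` {..<j})"
  have "v j \<in> v ` {..<j}" unfolding j_def using ex by (rule LeastI_ex)
  then obtain i where ij: "i < j" "v i = v j" by auto
  have new: "v k \<noteq> v l" if "k < l" "l < j" for k l
  proof -
    have "v l \<notin> v ` {..<l}"
      using not_less_Least[of l "\<lambda>j. v j \<in> v ` {..<j}"] that(2) unfolding j_def by blast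
    then show ?thesis using that(1) by (metis imageI lessThan_iff)
  qed
  have inj: "v k = v l \<Longrightarrow> k = l" if "k < j" "l < j" for k l
    using new[of k l] new[of l k] that by (metis linorder_neqE_nat)
  \<comment> \<open>As the vertices before \<open>j\<close> are distinct, an edge could be repeated
    only by going straight back along it, and the walk never backtracks.\<close>
  have edges_ne: "e k \<noteq> e l" if "i \<le> k" "k < l" "l < j" for k l
  proof
    assume "e k = e l"
    then have "{v k, v (Suc k)} = {v l, v (Suc l)}" using e(2) by metis
    moreover have "v k \<noteq> v l" using inj[of k l] that by auto
    ultimately have *: "v k = v (Suc l)" "v (Suc k) = v l" by (auto simp: doubleton_eq_iff)
    have "Suc l = j" using inj[of k "Suc l"] * that by (metis Suc_lessI less_SucI less_irrefl_nat order.strict_trans)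
    then have "k = i" using * ij inj[of k i] that by auto
    moreover have "l = Suc k" using inj[of "Suc k" l] * that by auto
    ultimately have "j = Suc (Suc i)" using \<open>Suc l = j\<close> by simp
    then show False using ij(2) step(1)[of i] by simp
  qed
  let ?vs = "map v [i..<j]" and ?es = "map e [i..<j]"
  have "distinct ?vs" by (auto simp: distinct_map inj_on_def intro: inj)
  moreover have "distinct ?es"
    unfolding distinct_map inj_on_def using edges_ne by (auto, metis linorder_neqE_nat)
  moreover have "ends (?es ! k) = {?vs ! k, ?vs ! (Suc k mod length ?es)}" if "k < length ?es" for k
  proof (cases "Suc k < j - i")
    case True
    then show ?thesis using e(2) by simp
  next
    case False
    then have "Suc k = j - i" using that by simp
    moreover from this have "Suc (i + k) = j" by simp
    ultimately show ?thesis using e(2)[of "i + k"] that ij by simp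
  qed
  ultimately have "incidence_cycle A ?vs ?es"
    unfolding incidence_cycle_def using ij(1) e(1) by auto
  then show ?thesis by (intro exI[of _ ?vs] exI[of _ ?es]) auto
qed

text \<open>Without a leaf, every fact can be left through a shared existential element different
  from the one it was entered by. This yields an endless walk without backtracking that avoids
  \<open>xs\<close>, hence a cycle. Repeated positions in one fact are the cycles of length
  two.\<close>

lemma c_acyclic_forest:
  assumes "c_acyclic A xs" "finite (facts A)"
  shows "forest (set xs) (facts A)"
  unfolding forest_def
proof (intro allI impI, rule ccontr)
  fix X assume X: "X \<subseteq> facts A" "X \<noteq> {}" and noleaf: "\<not> (\<exists>f\<in>X. leaf_fact (set xs) X f)"
  have norep: "snd f ! i \<in> set xs" if f: "f \<in> X" "i < j" "j < length (snd f)" "snd f ! i = snd f ! j" for f i j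
  proof -
    let ?vs = "[Elem (snd f ! i), Fact f]" and ?es = "[(f, i), (f, j)]"
    have "incidence_cycle A ?vs ?es"
      unfolding incidence_cycle_def using f X(1)
      by (auto simp: incidence_edges_def ends_def less_Suc_eq)
    then show ?thesis using assms(1) unfolding c_acyclic_def by fastforce
  qed
  have next_elem: "\<exists>y\<in>set (snd f) - set xs. y \<noteq> b \<and> (\<exists>g\<in>X - {f}. y \<in> set (snd g))" if "f \<in> X" for f b
    using noleaf norep that unfolding leaf_fact_def by (metis (no_types, lifting))
  \<comment> \<open>A state of the walk is a fact together with the element through which the walk
    is going to leave it.\<close>
  define ok where "ok s \<longleftrightarrow> fst s \<in> X \<and> snd s \<in> set (snd (fst s)) - set xs \<and>
    (\<exists>g\<in>X - {fst s}. snd s \<in> set (snd g))" for s :: "fact \<times> nat"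
  define nxt where "nxt s s' \<longleftrightarrow> fst s' \<noteq> fst s \<and> snd s' \<noteq> snd s \<and> snd s \<in> set (snd (fst s'))"
    for s s' :: "fact \<times> nat"
  have "\<exists>s. ok s"
  proof -
    obtain f where f: "f \<in> X" using X(2) by blast
    show ?thesis using next_elem[OF f] f unfolding ok_def by fastforce
  qed
  moreover have "\<exists>s'. ok s' \<and> nxt s s'" if s: "ok s" for s
  proof -
    obtain g where g: "g \<in> X" "g \<noteq> fst s" "snd s \<in> set (snd g)" using s unfolding ok_def by blast
    obtain y where "y \<in> set (snd g) - set xs" "y \<noteq> snd s" "\<exists>h\<in>X - {g}. y \<in> set (snd h)"
      using next_elem[OF g(1)] by blast
    then have "ok (g, y) \<and> nxt s (g, y)" using g unfolding ok_def nxt_def by simp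
    then show ?thesis by blast
  qed
  ultimately obtain s where s: "\<And>n. ok (s n)" "\<And>n. nxt (s n) (s (Suc n))"
    using dependent_nat_choice[of "\<lambda>_ s. ok s" "\<lambda>_. nxt"] by metis
  define v where "v k = (if even k then Fact (fst (s (k div 2))) else Elem (snd (s (k div 2))))" for k
  have "\<exists>e. e \<in> incidence_edges A \<and> ends e = {v k, v (Suc k)}" for k
  proof -
    let ?n = "k div 2"
    let ?f = "if even k then fst (s ?n) else fst (s (Suc ?n))" and ?x = "snd (s ?n)"
    have "?x \<in> set (snd ?f)" "?f \<in> X" using s[of ?n] s(1)[of "Suc ?n"] unfolding ok_def nxt_def by auto
    then obtain p where p: "p < length (snd ?f)" "snd ?f ! p = ?x" by (metis in_set_conv_nth)
    then have "(?f, p) \<in> incidence_edges A" using \<open>?f \<in> X\<close> X(1) unfolding incidence_edges_def by auto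
    moreover have "ends (?f, p) = {v k, v (Suc k)}"
      unfolding ends_def fst_conv snd_conv p(2) v_def by auto
    ultimately show ?thesis by blast
  qed
  then obtain e where e: "\<And>k. e k \<in> incidence_edges A" "\<And>k. ends (e k) = {v k, v (Suc k)}" by metis
  have "v (Suc (Suc k)) \<noteq> v k" "v (Suc k) \<noteq> v k" for k
    using s(2)[of "k div 2"] unfolding v_def nxt_def by auto
  moreover have "finite (range v)"
  proof (rule finite_subset)
    show "range v \<subseteq> Fact ` X \<union> Elem ` (elems X)"
      using s(1) unfolding v_def ok_def elems_def by auto
    show "finite (Fact ` X \<union> Elem ` (elems X))"
      using finite_subset[OF X(1) assms(2)] finite_elems by blast
  qed
  ultimately obtain vs es where c: "incidence_cycle A vs es" "set vs \<subseteq> range v"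
    using walk_contains_cycle[of e A v, OF e] by metis
  obtain x where "x \<in> set xs" "Elem x \<in> range v" using assms(1) c unfolding c_acyclic_def by blast
  then show False using s(1) unfolding v_def ok_def by (auto split: if_splits)
qed

section \<open>Chasing a single source fact\<close>

type_synonym ctup = "fact \<times> nat list \<times> fact list"
text \<open>\<open>Inl a\<close> is an argument of the source fact; \<open>Inr (d, v)\<close> is the
  witness for the variable \<open>v\<close> of the constraint with tuple \<open>d\<close>. The tag
  keeps witnesses of different constraints apart, and tuples, unlike records, inherit an encoding
  from products and lists.\<close>

type_synonym velem = "nat + ctup \<times> nat"

definition tup :: "lav \<Rightarrow> ctup" where "tup c = (lhs c, exvars c, rhs c)"

lemma tup_inject: "tup c = tup d \<longleftrightarrow> c = d"
  by (cases c; cases d) (auto simp: tup_def)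

abbreviation univars :: "lav \<Rightarrow> nat set" where
  "univars c \<equiv> set (snd (lhs c))"

definition matches :: "lav \<Rightarrow> fact \<Rightarrow> bool" where
  "matches c \<phi> \<longleftrightarrow> fst (lhs c) = fst \<phi> \<and> (\<exists>h. map h (snd (lhs c)) = snd \<phi>)"

text \<open>The value is looked up in the zipped arguments and not taken from a chosen matching
  function, so that the same expression can be computed on lists.\<close>

definition place :: "lav \<Rightarrow> fact \<Rightarrow> nat \<Rightarrow> velem" where
  "place c \<phi> v = (let ps = filter (\<lambda>p. fst p = v) (zip (snd (lhs c)) (snd \<phi>))
     in if ps = [] then Inr (tup c, v) else Inl (snd (hd ps)))"

text \<open>The oblivious chase: a single atom matches a fact in at most one way on its variables,
  so each constraint adds at most one copy of its right-hand side.\<close>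

definition chase :: "lav set \<Rightarrow> fact \<Rightarrow> velem atom set" where
  "chase M \<phi> = {img (place c \<phi>) f |c f. c \<in> M \<and> matches c \<phi> \<and> f \<in> set (rhs c)}"

abbreviation dist :: "velem set" where "dist \<equiv> range Inl"

lemma place_eq:
  assumes "map h (snd (lhs c)) = snd \<phi>"
  shows "place c \<phi> v = (if v \<in> univars c then Inl (h v) else Inr (tup c, v))"
proof -
  have z: "zip (snd (lhs c)) (snd \<phi>) = map (\<lambda>x. (x, h x)) (snd (lhs c))"
    unfolding assms[symmetric] by (simp add: zip_map2 zip_same_conv_map)
  let ?ps = "filter (\<lambda>p. fst p = v) (zip (snd (lhs c)) (snd \<phi>))"
  have "?ps = [] \<longleftrightarrow> v \<notin> univars c" unfolding z by (auto simp: filter_empty_conv)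
  moreover have "snd (hd ?ps) = h v" if "?ps \<noteq> []"
    using hd_in_set[OF that] unfolding z by auto
  ultimately show ?thesis unfolding place_def Let_def by auto
qed

lemma place_Inr: "matches c \<phi> \<Longrightarrow> place c \<phi> v = Inr (d, w) \<longleftrightarrow> v = w \<and> d = tup c \<and> v \<notin> univars c"
proof -
  assume "matches c \<phi>"
  then obtain h where "map h (snd (lhs c)) = snd \<phi>" unfolding matches_def by blast
  from place_eq[OF this, of v] show ?thesis by auto
qed

lemma finite_chase: "finite M \<Longrightarrow> finite (chase M \<phi>)"
proof -
  assume "finite M"
  then have "finite (\<Union>c\<in>M. (\<lambda>f. img (place c \<phi>) f) ` set (rhs c))" by simp
  then show ?thesis by (rule rev_finite_subset) (unfold chase_def, blast)
qed

text \<open>Facts of different constraints share only distinguished elements, and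
  \<open>place\<close> is injective on the existential variables of one constraint. A leaf of the
  part of \<open>X\<close> that stems from one constraint, found in its right-hand side, is
  therefore a leaf of \<open>X\<close>.\<close>

lemma forest_chase:
  assumes "\<And>c. c \<in> M \<Longrightarrow> forest (univars c) (set (rhs c))"
  shows "forest dist (chase M \<phi>)"
  unfolding forest_def
proof (intro allI impI)
  fix X assume X: "X \<subseteq> chase M \<phi>" "X \<noteq> {}"
  show "\<exists>f\<in>X. leaf_fact dist X f"
  proof (cases "\<exists>f\<in>X. set (snd f) \<subseteq> dist")
    case True
    then obtain f where f: "f \<in> X" "set (snd f) \<subseteq> dist" by blast
    have "leaf_fact dist X f" using f(2) unfolding leaf_fact_def by (auto simp: subset_iff)
    then show ?thesis using f(1) by blast
  next
    case False
    obtain f1 where f1: "f1 \<in> X" using X(2) by blast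
    obtain c g1 where c: "c \<in> M" "matches c \<phi>" "g1 \<in> set (rhs c)" "f1 = img (place c \<phi>) g1"
      using X(1) f1 unfolding chase_def by blast
    let ?s = "place c \<phi>" and ?A = "univars c"
    define Z where "Z = {f\<in>X. \<exists>g\<in>set (rhs c). f = img ?s g}"
    \<comment> \<open>Placing may identify universally quantified variables and thereby facts, so
      one preimage is chosen for each placed fact.\<close>
    define pre where "pre f = (SOME g. g \<in> set (rhs c) \<and> f = img ?s g)" for f
    have pre: "pre f \<in> set (rhs c) \<and> f = img ?s (pre f)" if "f \<in> Z" for f
      unfolding pre_def by (rule someI_ex) (use that in \<open>unfold Z_def, blast\<close>)
    have inZ: "f \<in> Z" if fX: "f \<in> X" and fw: "Inr (tup c, w) \<in> set (snd f)" for f w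
    proof -
      obtain c' g where g: "matches c' \<phi>" "g \<in> set (rhs c')" "f = img (place c' \<phi>) g"
        using X(1) fX unfolding chase_def by blast
      then obtain u where u: "place c' \<phi> u = Inr (tup c, w)" using fw by auto
      have "c' = c" using iffD1[OF place_Inr[OF g(1)] u] tup_inject[of c c'] by simp
      then show ?thesis using g fX unfolding Z_def by blast
    qed
    have "f1 \<in> Z" using f1 c unfolding Z_def by blast
    then have ne: "pre ` Z \<noteq> {}" and sub: "pre ` Z \<subseteq> set (rhs c)" using pre by auto
    have "\<exists>g\<in>pre ` Z. leaf_fact ?A (pre ` Z) g"
      by (rule assms[OF c(1), unfolded forest_def, rule_format, OF sub ne])
    then have "\<exists>f0\<in>Z. leaf_fact ?A (pre ` Z) (pre f0)" by simp
    then obtain f0 where f0: "f0 \<in> Z" "leaf_fact ?A (pre ` Z) (pre f0)" by blast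
    let ?g0 = "pre f0"
    have sf0: "snd f0 = map ?s (snd ?g0)" using pre[OF f0(1)] by (metis snd_conv)
    have "leaf_fact dist X f0"
      unfolding leaf_fact_def
    proof (intro conjI allI impI)
      fix i j assume ij: "i < j \<and> j < length (snd f0) \<and> snd f0 ! i = snd f0 ! j"
      show "snd f0 ! i \<in> dist"
      proof (rule ccontr)
        assume nd: "snd f0 ! i \<notin> dist"
        obtain d w where w: "snd f0 ! i = Inr (d, w)" using nd by (metis obj_sumE rangeI surj_pair)
        have len: "length (snd f0) = length (snd ?g0)" unfolding sf0 by (rule length_map)
        then have jl: "j < length (snd ?g0)" "i < length (snd ?g0)" using ij by auto
        have e1: "snd f0 ! i = ?s (snd ?g0 ! i)" unfolding sf0 by (rule nth_map[OF jl(2)])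
        have e2: "snd f0 ! j = ?s (snd ?g0 ! j)" unfolding sf0 by (rule nth_map[OF jl(1)])
        have e3: "snd f0 ! i = snd f0 ! j" using ij by blast
        have "?s (snd ?g0 ! i) = Inr (d, w)" by (rule trans[OF e1[symmetric] w])
        moreover have "?s (snd ?g0 ! j) = Inr (d, w)"
          by (rule trans[OF e2[symmetric] trans[OF e3[symmetric] w]])
        ultimately have "snd ?g0 ! i = w" "snd ?g0 ! j = w" "w \<notin> ?A"
          by (auto dest!: iffD1[OF place_Inr[OF c(2)]])
        then show False
          using conjunct1[OF f0(2)[unfolded leaf_fact_def], rule_format, of i j] ij jl by simp
      qed
    next
      obtain b where b: "\<And>x g. x \<in> set (snd ?g0) - ?A \<Longrightarrow> x \<noteq> b \<Longrightarrow> g \<in> pre ` Z - {?g0} \<Longrightarrow> x \<notin> set (snd g)"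
        using conjunct2[OF f0(2)[unfolded leaf_fact_def]] by blast
      show "\<exists>b. \<forall>x\<in>set (snd f0) - dist. x \<noteq> b \<longrightarrow> (\<forall>g\<in>X - {f0}. x \<notin> set (snd g))"
      proof (intro exI[of _ "Inr (tup c, b)"] ballI impI notI)
        fix x f assume x: "x \<in> set (snd f0) - dist" "x \<noteq> Inr (tup c, b)" "f \<in> X - {f0}" "x \<in> set (snd f)"
        have "x \<in> ?s ` set (snd ?g0)" using x(1) unfolding sf0 by simp
        then obtain w where w: "w \<in> set (snd ?g0)" "x = ?s w" by blast
        have xw: "x = Inr (tup c, w)" "w \<notin> ?A"
        proof -
          obtain d u where "x = Inr (d, u)" using x(1) by (metis DiffD2 obj_sumE rangeI surj_pair)
          then show "x = Inr (tup c, w)" "w \<notin> ?A" using place_Inr[OF c(2), of w d u] w(2) by auto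
        qed
        have fZ: "f \<in> Z" using inZ x(3,4) xw(1) by blast
        have sf: "snd f = map ?s (snd (pre f))" using pre[OF fZ] by (metis snd_conv)
        have "x \<in> ?s ` set (snd (pre f))" using x(4) unfolding sf by simp
        then obtain u where u: "u \<in> set (snd (pre f))" "?s u = Inr (tup c, w)" using xw(1) by auto
        have wf: "w \<in> set (snd (pre f))" using u(1) iffD1[OF place_Inr[OF c(2)] u(2)] by simp
        have "pre f \<noteq> ?g0"
        proof
          assume "pre f = ?g0"
          then have "img ?s (pre f) = img ?s ?g0" by simp
          then have "f = f0"
            using trans[OF conjunct2[OF pre[OF fZ]] trans[OF _ conjunct2[OF pre[OF f0(1)], symmetric]]] by blast
          then show False using x(3) by blast
        qed
        moreover have "w \<noteq> b" using x(2) xw(1) by blast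
        ultimately show False using b[of w "pre f"] w(1) wf xw(2) fZ by blast
      qed
    qed
    then show ?thesis using f0(1) unfolding Z_def by blast
  qed
qed

section \<open>Firing at one source fact and homomorphisms from the chase\<close>

definition fires :: "lav \<Rightarrow> 'b atom \<Rightarrow> 'b atom set \<Rightarrow> bool" where
  "fires c \<psi> J \<longleftrightarrow> (\<forall>h. img h (lhs c) = \<psi> \<longrightarrow>
     (\<exists>g. (\<forall>x\<in>univars c. g x = h x) \<and> (\<forall>f\<in>set (rhs c). img g f \<in> J)))"

text \<open>Universal property of the chase. The witnesses of the single constraints can be glued
  because they are tagged by constraint and agree with \<open>val\<close> on the arguments.\<close>

lemma chase_hom_if_fires:
  assumes "\<forall>c\<in>M. fires c (img val \<phi>) J"
  shows "\<exists>h. (\<forall>a. h (Inl a) = val a) \<and> (\<forall>f\<in>chase M \<phi>. img h f \<in> J)"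
proof -
  have "\<exists>g. matches c \<phi> \<longrightarrow> c \<in> M \<longrightarrow> (\<exists>h. map h (snd (lhs c)) = snd \<phi> \<and>
      (\<forall>x\<in>univars c. g x = val (h x)) \<and> (\<forall>f\<in>set (rhs c). img g f \<in> J))" for c
  proof (cases "matches c \<phi> \<and> c \<in> M")
    case True
    then obtain h where h: "fst (lhs c) = fst \<phi>" "map h (snd (lhs c)) = snd \<phi>" unfolding matches_def by blast
    have "img (val \<circ> h) (lhs c) = img val \<phi>" using h by (metis list.map_comp)
    then obtain g where "\<forall>x\<in>univars c. g x = (val \<circ> h) x" "\<forall>f\<in>set (rhs c). img g f \<in> J"
      using assms True unfolding fires_def by blast
    then show ?thesis using h by (intro exI[of _ g]) auto
  qed blast
  then obtain G where G: "\<And>c. matches c \<phi> \<Longrightarrow> c \<in> M \<Longrightarrow> \<exists>h. map h (snd (lhs c)) = snd \<phi> \<and>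
      (\<forall>x\<in>univars c. G c x = val (h x)) \<and> (\<forall>f\<in>set (rhs c). img (G c) f \<in> J)"
    by metis
  define k where "k e = (case e of Inl a \<Rightarrow> val a | Inr (d, v) \<Rightarrow> G (inv tup d) v)" for e
  have inv: "inv tup (tup c) = c" for c by (rule inv_f_f) (auto simp: inj_def tup_inject)
  have "img k f \<in> J" if fc: "f \<in> chase M \<phi>" for f
  proof -
    obtain c g where c: "c \<in> M" "matches c \<phi>" "g \<in> set (rhs c)" "f = img (place c \<phi>) g"
      using fc unfolding chase_def by blast
    obtain h where h: "map h (snd (lhs c)) = snd \<phi>" "\<forall>x\<in>univars c. G c x = val (h x)"
      "\<forall>f\<in>set (rhs c). img (G c) f \<in> J" using G[OF c(2,1)] by blast
    have "k (place c \<phi> v) = G c v" for v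
      unfolding place_eq[OF h(1)] k_def using h(2) inv by auto
    then have "img k f = img (G c) g" unfolding c(4) by simp
    then show ?thesis using h(3) c(3) by metis
  qed
  then show ?thesis by (intro exI[of _ k]) (auto simp: k_def)
qed

text \<open>Injectivity of \<open>val\<close> prevents \<open>img val \<phi>\<close> from having
  more equalities than \<open>\<phi>\<close>, so it triggers no constraint that the chase of
  \<open>\<phi>\<close> left out.\<close>

lemma fires_if_chase_hom:
  assumes "\<forall>a. h (Inl a) = val a" "\<forall>f\<in>chase M \<phi>. img h f \<in> J" "inj_on val (set (snd \<phi>))" "c \<in> M"
  shows "fires c (img val \<phi>) J"
  unfolding fires_def
proof (intro allI impI)
  fix k assume k: "img k (lhs c) = img val \<phi>"
  let ?i = "the_inv_into (set (snd \<phi>)) val"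
  have mk: "map k (snd (lhs c)) = map val (snd \<phi>)" "fst (lhs c) = fst \<phi>" using k by simp_all
  have "map (?i \<circ> k) (snd (lhs c)) = map ?i (map val (snd \<phi>))" using mk(1) by (metis list.map_comp)
  also have "\<dots> = snd \<phi>" using assms(3) by (simp add: map_idI the_inv_into_f_f)
  finally have mi: "map (?i \<circ> k) (snd (lhs c)) = snd \<phi>" .
  then have m: "matches c \<phi>" using mk(2) unfolding matches_def by blast
  show "\<exists>g. (\<forall>x\<in>univars c. g x = k x) \<and> (\<forall>f\<in>set (rhs c). img g f \<in> J)"
  proof (intro exI[of _ "h \<circ> place c \<phi>"] conjI ballI)
    fix x assume x: "x \<in> univars c"
    have "k x \<in> val ` set (snd \<phi>)" using x mk(1) by (metis image_eqI list.set_map)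
    then have "val (?i (k x)) = k x" using assms(3) by (simp add: f_the_inv_into_f)
    then show "(h \<circ> place c \<phi>) x = k x" using x assms(1) place_eq[OF mi] by simp
  next
    fix f assume "f \<in> set (rhs c)"
    then have "img (place c \<phi>) f \<in> chase M \<phi>" unfolding chase_def using assms(4) m by blast
    then have "img h (img (place c \<phi>) f) \<in> J" using assms(2) by blast
    then show "img (h \<circ> place c \<phi>) f \<in> J" by simp
  qed
qed

section \<open>Polynomial-time computable functions\<close>

lemma poly_nat_mono: "m \<le> n \<Longrightarrow> poly p m \<le> poly (p :: nat poly) n"
  by (induction p) (auto intro: add_mono mult_mono)

section \<open>Linking programs by relocation of calls\<close>

lemma eval_append: "eval P x e v t \<Longrightarrow> eval (P @ Q) x e v t"
  by (induction rule: eval.induct)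
    (auto intro: eval.intros simp: nth_append simp del: tsize.simps left.simps right.simps One_nat_def)

fun shift :: "nat \<Rightarrow> expr \<Rightarrow> expr" where
  "shift n Arg = Arg"
| "shift n ELeaf = ELeaf"
| "shift n (ENode a b) = ENode (shift n a) (shift n b)"
| "shift n (ELeft a) = ELeft (shift n a)"
| "shift n (ERight a) = ERight (shift n a)"
| "shift n (EIf a b c) = EIf (shift n a) (shift n b) (shift n c)"
| "shift n (ECall f a) = ECall (n + f) (shift n a)"

lemma eval_shift: "eval P x e v t \<Longrightarrow> eval (Q @ map (shift (length Q)) P) x (shift (length Q) e) v t"
proof (induction rule: eval.induct)
  case (eval_call f x a u s w t)
  show ?case unfolding shift.simps
    by (rule eval.eval_call[OF _ eval_call.IH(1)]) (use eval_call in \<open>auto simp: nth_append\<close>)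
qed (auto intro: eval.intros simp del: tsize.simps left.simps right.simps One_nat_def)

lemma eval_call': "f < length P \<Longrightarrow> P ! f = e \<Longrightarrow> eval P x a u s \<Longrightarrow> eval P u e w t \<Longrightarrow>
    eval P x (ECall f a) w (Suc (s + t))"
  using eval_call by blast

section \<open>Types with an injective encoding as trees\<close>

class encodable =
  fixes encode :: "'a \<Rightarrow> tree"
  assumes encode_inject: "encode x = encode y \<Longrightarrow> x = y"

lemma encode_eq_iff: "encode x = encode y \<longleftrightarrow> x = y"
  using encode_inject by blast

instantiation tree :: encodable
begin
definition encode_tree :: "tree \<Rightarrow> tree" where "encode_tree t = t"
instance by standard (simp add: encode_tree_def)
end

instantiation bool :: encodable
begin
definition encode_bool :: "bool \<Rightarrow> tree" where "encode_bool b = (if b then Node Leaf Leaf else Leaf)"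
instance by standard (simp add: encode_bool_def split: if_splits)
end

instantiation nat :: encodable
begin
definition encode_nat :: "nat \<Rightarrow> tree" where "encode_nat n = enc_nat n"
instance
proof
  fix x y :: nat
  assume "encode x = encode y"
  then show "x = y"
    unfolding encode_nat_def
  proof (induction x arbitrary: y rule: less_induct)
    case (less x)
    show ?case
    proof (cases "x = 0 \<or> y = 0")
      case True
      then show ?thesis using less.prems
        by (subst (asm) (1 2) enc_nat.simps) (auto split: if_splits)
    next
      case False
      then have "odd x = odd y" "enc_nat (x div 2) = enc_nat (y div 2)"
        using less.prems by (subst (asm) (1 2) enc_nat.simps; auto split: if_splits)+
      moreover from this(2) have "x div 2 = y div 2" using less.IH[of "x div 2" "y div 2"] False by simp
      ultimately show ?thesis by (metis odd_two_times_div_two_succ even_two_times_div_two)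
    qed
  qed
qed
end

instantiation prod :: (encodable, encodable) encodable
begin
definition encode_prod :: "'a \<times> 'b \<Rightarrow> tree" where "encode_prod = enc_pair encode encode"
instance by standard (auto simp: encode_prod_def dest: encode_inject)
end

instantiation list :: (encodable) encodable
begin
definition encode_list :: "'a list \<Rightarrow> tree" where "encode_list = enc_list encode"
instance
proof
  fix xs ys :: "'a list"
  show "encode xs = encode ys \<Longrightarrow> xs = ys"
    unfolding encode_list_def
  proof (induction xs arbitrary: ys)
    case Nil then show ?case by (cases ys) auto
  next
    case (Cons x xs) then show ?case by (cases ys) (auto dest: encode_inject)
  qed
qed
end

instantiation sum :: (encodable, encodable) encodable
begin
definition encode_sum :: "'a + 'b \<Rightarrow> tree" where
  "encode_sum s = (case s of Inl a \<Rightarrow> Node Leaf (encode a) | Inr b \<Rightarrow> Node (Node Leaf Leaf) (encode b))"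
instance by standard (auto simp: encode_sum_def dest: encode_inject split: sum.splits)
end

lemma encode_pair: "encode (a, b) = Node (encode a) (encode b)"
  by (simp add: encode_prod_def)

lemma encode_Nil: "encode [] = Leaf" and encode_Cons: "encode (x # xs) = Node (encode x) (encode xs)"
  by (simp_all add: encode_list_def)

abbreviation size_of :: "'a::encodable \<Rightarrow> nat" where "size_of x \<equiv> tsize (encode x)"

lemma tsize_pos: "0 < tsize t" by (cases t) auto

text \<open>The unit is an expression inside a program, so that a computed function can be inserted
  directly as a subexpression of a larger one.\<close>

definition computes :: "program \<Rightarrow> expr \<Rightarrow> nat poly \<Rightarrow> ('a::encodable \<Rightarrow> 'b::encodable) \<Rightarrow> bool" where
  "computes P e p f \<longleftrightarrow> (\<forall>x. \<exists>t. eval P (encode x) e (encode (f x)) t \<and> t \<le> poly p (size_of x))"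

definition ptime :: "('a::encodable \<Rightarrow> 'b::encodable) \<Rightarrow> bool" where
  "ptime f \<longleftrightarrow> (\<exists>P e p. computes P e p f)"

lemma computes_append: "computes P e p f \<Longrightarrow> computes (P @ Q) e p f"
  unfolding computes_def using eval_append by meson

lemma computes_shift: "computes P e p f \<Longrightarrow> computes (Q @ map (shift (length Q)) P) (shift (length Q) e) p f"
  unfolding computes_def using eval_shift by meson

lemma computes_mono: "computes P e p f \<Longrightarrow> (\<And>n. poly p n \<le> poly q n) \<Longrightarrow> computes P e q f"
  unfolding computes_def using le_trans by meson

lemma ptime_joint:
  assumes "ptime f" "ptime g"
  obtains P e1 e2 p where "computes P e1 p f" "computes P e2 p g"
proof -
  obtain P e1 p where f: "computes P e1 p f" using assms(1) unfolding ptime_def by blast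
  obtain Q e2 q where g: "computes Q e2 q g" using assms(2) unfolding ptime_def by blast
  have "computes (P @ map (shift (length P)) Q) e1 (p + q) f"
    by (rule computes_mono[OF computes_append[OF f]]) simp
  moreover have "computes (P @ map (shift (length P)) Q) (shift (length P) e2) (p + q) g"
    by (rule computes_mono[OF computes_shift[OF g]]) simp
  ultimately show ?thesis using that by blast
qed

text \<open>Since building a tree is charged by its size, the time bound also bounds the output;
  composition relies on this.\<close>

lemma computesD:
  assumes "computes P e p f"
  obtains t where "eval P (encode x) e (encode (f x)) t" "t \<le> poly p (size_of x)"
    "size_of (f x) \<le> poly p (size_of x)"
  using assms unfolding computes_def by (meson le_trans tsize_le_time)

lemma ptime_size:
  assumes "ptime f"
  obtains p :: "nat poly" where "\<And>x. size_of (f x) \<le> poly p (size_of x)"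
  using assms computesD unfolding ptime_def by metis

lemma ptimeI:
  assumes "\<And>x. \<exists>t. eval P (encode x) e (encode (f x)) t \<and> t \<le> poly p (size_of x)"
  shows "ptime f"
  using assms unfolding ptime_def computes_def by blast

section \<open>Basic closure properties of polynomial time\<close>

lemma ptime_id: "ptime (\<lambda>x. x)"
  by (rule ptimeI[of "[]" Arg _ "[:0, 1:]"]) (auto intro: eval_arg)

lemma ptime_const: "ptime (\<lambda>x. c)"
proof -
  have "\<exists>e t. \<forall>x. eval [] x e c t" for c
  proof (induction c)
    case Leaf show ?case using eval_leaf by blast
  next
    case (Node c1 c2) then show ?case using eval_node by meson
  qed
  then obtain e t where e: "\<And>x. eval [] x e (encode c) t" by blast
  show ?thesis by (rule ptimeI[of "[]" e _ "[:t:]"]) (auto intro: e)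
qed

lemma ptime_comp:
  assumes "ptime f" "ptime g"
  shows "ptime (\<lambda>x. g (f x))"
proof -
  obtain P e1 e2 p where f: "computes P e1 p f" and g: "computes P e2 p g"
    by (rule ptime_joint[OF assms])
  show ?thesis
  proof (rule ptimeI[of "P @ [e2]" "ECall (length P) e1" _ "p + pcompose p p + 1"])
    fix x
    obtain s where s: "eval P (encode x) e1 (encode (f x)) s" "s \<le> poly p (size_of x)"
      "size_of (f x) \<le> poly p (size_of x)" by (rule computesD[OF f]) (rule that)
    obtain t where t: "eval P (encode (f x)) e2 (encode (g (f x))) t" "t \<le> poly p (size_of (f x))"
      by (rule computesD[OF g]) (rule that)
    have "t \<le> poly p (poly p (size_of x))" using t(2) poly_nat_mono[OF s(3), of p] by simp
    then show "\<exists>t. eval (P @ [e2]) (encode x) (ECall (length P) e1) (encode (g (f x))) t \<and>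
        t \<le> poly (p + pcompose p p + 1) (size_of x)"
      using s(2) by (intro exI[of _ "Suc (s + t)"] conjI eval_call'[where e = e2])
        (auto intro: eval_append s t simp: poly_pcompose)
  qed
qed

text \<open>A change of type that leaves the trees alone: the same program serves.\<close>

lemma ptime_recode:
  assumes "ptime g" "\<And>x. encode x = encode (i x)" "\<And>x. encode (f x) = encode (g (i x))"
  shows "ptime f"
proof -
  obtain P e p where "computes P e p g" using assms(1) unfolding ptime_def by blast
  then show ?thesis
    by (intro ptimeI[of P e f p]) (unfold assms(2,3) computes_def, blast)
qed

lemma ptime_Node:
  assumes "ptime f" "ptime g" "\<And>x. encode (h x) = Node (encode (f x)) (encode (g x))"
  shows "ptime h"
proof -
  obtain P e1 e2 p where f: "computes P e1 p f" and g: "computes P e2 p g"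
    by (rule ptime_joint[OF assms(1,2)])
  show ?thesis
  proof (rule ptimeI[of P "ENode e1 e2" _ "4 * p + 1"])
    fix x
    obtain s where s: "eval P (encode x) e1 (encode (f x)) s" "s \<le> poly p (size_of x)"
      "size_of (f x) \<le> poly p (size_of x)" by (rule computesD[OF f]) (rule that)
    obtain t where t: "eval P (encode x) e2 (encode (g x)) t" "t \<le> poly p (size_of x)"
      "size_of (g x) \<le> poly p (size_of x)" by (rule computesD[OF g]) (rule that)
    show "\<exists>t. eval P (encode x) (ENode e1 e2) (encode (h x)) t \<and> t \<le> poly (4 * p + 1) (size_of x)"
      unfolding assms(3)
      by (intro exI conjI, rule eval_node[OF s(1) t(1)]) (use s t in \<open>simp\<close>)
  qed
qed

lemma ptime_left: "(\<And>x. encode (f x) = left (encode x)) \<Longrightarrow> ptime f"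
proof (rule ptimeI[of "[]" "ELeft Arg" _ "[:0, 2:]"])
  fix x assume f: "\<And>x. encode (f x) = left (encode x)"
  have *: "tsize (left t) \<le> tsize t" for t by (cases t) auto
  show "\<exists>t. eval [] (encode x) (ELeft Arg) (encode (f x)) t \<and> t \<le> poly [:0, 2:] (size_of x)"
    unfolding f by (intro exI conjI, rule eval_left[OF eval_arg]) (use *[of "encode x"] in simp)
qed

lemma ptime_right: "(\<And>x. encode (f x) = right (encode x)) \<Longrightarrow> ptime f"
proof (rule ptimeI[of "[]" "ERight Arg" _ "[:0, 2:]"])
  fix x assume f: "\<And>x. encode (f x) = right (encode x)"
  have *: "tsize (right t) \<le> tsize t" for t by (cases t) auto
  show "\<exists>t. eval [] (encode x) (ERight Arg) (encode (f x)) t \<and> t \<le> poly [:0, 2:] (size_of x)"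
    unfolding f by (intro exI conjI, rule eval_right[OF eval_arg]) (use *[of "encode x"] in simp)
qed

lemma ptime_test:
  assumes "ptime c" "ptime f" "ptime g"
  shows "ptime (\<lambda>x. if encode (c x) = Leaf then g x else f x)"
proof -
  obtain P e1 e2 p where fg: "computes P e1 p f" "computes P e2 p g"
    by (rule ptime_joint[OF assms(2,3)])
  obtain Q e3 q where c: "computes Q e3 q c" using assms(1) unfolding ptime_def by blast
  let ?R = "P @ map (shift (length P)) Q" and ?e3 = "shift (length P) e3"
  have c': "computes ?R ?e3 q c" by (rule computes_shift[OF c])
  show ?thesis
  proof (rule ptimeI[of ?R "EIf ?e3 e1 e2" _ "p + q + 1"])
    fix x
    obtain s where s: "eval ?R (encode x) ?e3 (encode (c x)) s" "s \<le> poly q (size_of x)"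
      by (rule computesD[OF c']) (rule that)
    obtain t1 where t1: "eval ?R (encode x) e1 (encode (f x)) t1" "t1 \<le> poly p (size_of x)"
      by (rule computesD[OF computes_append[OF fg(1)]]) (rule that)
    obtain t2 where t2: "eval ?R (encode x) e2 (encode (g x)) t2" "t2 \<le> poly p (size_of x)"
      by (rule computesD[OF computes_append[OF fg(2)]]) (rule that)
    show "\<exists>t. eval ?R (encode x) (EIf ?e3 e1 e2) (encode (if encode (c x) = Leaf then g x else f x)) t \<and>
        t \<le> poly (p + q + 1) (size_of x)"
    proof (cases "encode (c x)")
      case Leaf
      show ?thesis using eval_if_false[OF s(1)[unfolded Leaf] t2(1)] s t2 Leaf by (intro exI conjI) auto
    next
      case (Node u v)
      show ?thesis using eval_if_true[OF s(1)[unfolded Node] t1(1)] s t1 Node by (intro exI conjI) auto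
    qed
  qed
qed

text \<open>The accumulator needs a bound of its own: one step is polynomial in the previous result,
  and iterating such steps may grow exponentially. The fold works from the end of the list, so its
  intermediate results belong to the suffixes of \<open>L x\<close>.\<close>

lemma ptime_foldr:
  fixes L :: "'a::encodable \<Rightarrow> 'c::encodable list"
  assumes "ptime L" "ptime I" "ptime G"
    and bound: "\<And>x ys zs. L x = zs @ ys \<Longrightarrow> size_of (foldr (\<lambda>a s. G (x, a, s)) ys (I x)) \<le> poly b (size_of x)"
  shows "ptime (\<lambda>x. foldr (\<lambda>a s. G (x, a, s)) (L x) (I x))"
proof -
  obtain P eI eL p where IL: "computes P eI p I" "computes P eL p L"
    by (rule ptime_joint[OF assms(2,1)])
  obtain Q eG q where G: "computes Q eG q G" using assms(3) unfolding ptime_def by blast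
  let ?n = "length P" and ?m = "length P + length Q"
  \<comment> \<open>The argument is the pair of \<open>x\<close> and the remaining list. In the
    function table \<open>?m\<close> is this loop, followed by \<open>G\<close> and then by the
    initial value.\<close>
  let ?loop = "EIf (ERight Arg)
      (ECall (Suc ?m) (ENode (ELeft Arg) (ENode (ELeft (ERight Arg))
         (ECall ?m (ENode (ELeft Arg) (ERight (ERight Arg)))))))
      (ECall (Suc (Suc ?m)) (ELeft Arg))"
  let ?R = "(P @ map (shift ?n) Q) @ [?loop, shift ?n eG, eI]"
  have I': "computes ?R eI p I" and L': "computes ?R eL p L" using computes_append IL by blast+
  have G': "computes ?R (shift ?n eG) q G" using computes_append[OF computes_shift[OF G]] by blast
  have R: "?R ! ?m = ?loop" "?R ! Suc ?m = shift ?n eG" "?R ! Suc (Suc ?m) = eI"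
    "?m < length ?R" "Suc ?m < length ?R" "Suc (Suc ?m) < length ?R"
    by (simp_all add: nth_append)
  let ?F = "\<lambda>x ys. foldr (\<lambda>a s. G (x, a, s)) ys (I x)"
  \<comment> \<open>\<open>N\<close>, \<open>q'\<close> and \<open>p'\<close> bound every round
    uniformly, so the total is the number of rounds times a fixed cost; the factor 20 pays for the
    trees copied within one round.\<close>
  have loop: "\<exists>t. eval ?R (encode (x, ys)) ?loop (encode (?F x ys)) t \<and> t \<le> Suc (length ys) * (20 * N + q' + p')"
    if "L x = zs @ ys" and N: "size_of x + size_of ys + poly b (size_of x) + 2 \<le> N"
      and q': "poly q N \<le> q'" and p': "poly p N \<le> p'" for x ys zs N q' p'
    using that(1) N
  proof (induction ys arbitrary: zs)
    case Nil
    obtain t where t: "eval ?R (encode x) eI (encode (I x)) t" "t \<le> poly p (size_of x)"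
      by (rule computesD[OF I']) (rule that)
    have "poly p (size_of x) \<le> poly p N" using Nil.prems(2) by (intro poly_nat_mono) simp
    then have tp: "t \<le> p'" using t(2) p' by simp
    let ?a = "encode (x, [] :: 'c list)"
    have a: "?a = Node (encode x) Leaf" by (simp add: encode_pair encode_Nil)
    have e1: "eval ?R ?a (ERight Arg) Leaf (tsize ?a + tsize (right ?a))"
      using eval_right[OF eval_arg, of ?R ?a] unfolding a by simp
    have e2: "eval ?R ?a (ELeft Arg) (encode x) (tsize ?a + tsize (left ?a))"
      using eval_left[OF eval_arg, of ?R ?a] unfolding a by simp
    note e3 = eval_if_false[OF e1 eval_call'[OF R(6) R(3) e2 t(1)]]
    show ?case
      by (intro exI conjI, unfold foldr_Nil id_apply, rule e3)
        (use tp Nil.prems(2) in \<open>simp add: a encode_Nil\<close>)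
  next
    case (Cons y ys)
    obtain t1 where t1: "eval ?R (encode (x, ys)) ?loop (encode (?F x ys)) t1"
      "t1 \<le> Suc (length ys) * (20 * N + q' + p')"
      using Cons.IH[of "zs @ [y]"] Cons.prems by (auto simp: encode_Cons)
    let ?a = "encode (x, y # ys)" and ?s = "?F x ys"
    obtain t2 where t2: "eval ?R (encode (x, y, ?s)) (shift ?n eG) (encode (G (x, y, ?s))) t2"
      "t2 \<le> poly q (size_of (x, y, ?s))"
      by (rule computesD[OF G']) (rule that)
    have sb: "size_of ?s \<le> poly b (size_of x)" using bound[of x "zs @ [y]" ys] Cons.prems by simp
    have "size_of (x, y, ?s) \<le> N" using Cons.prems(2) sb tsize_pos[of "encode ys"]
      by (simp add: encode_pair encode_Cons)
    then have tq: "t2 \<le> q'" using t2(2) poly_nat_mono[of _ N q] q' le_trans by blast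
    have a: "?a = Node (encode x) (Node (encode y) (encode ys))" by (simp add: encode_pair encode_Cons)
    let ?x = "encode x" and ?y = "encode y" and ?ys = "encode ys"
    have e1: "eval ?R ?a (ERight Arg) (Node ?y ?ys) (tsize ?a + tsize (right ?a))"
      using eval_right[OF eval_arg, of ?R ?a] unfolding a by simp
    have e2: "eval ?R ?a (ELeft Arg) ?x (tsize ?a + tsize (left ?a))"
      using eval_left[OF eval_arg, of ?R ?a] unfolding a by simp
    note e3 = eval_left[OF e1, unfolded left.simps] and e4 = eval_right[OF e1, unfolded right.simps]
    note e5 = eval_node[OF e2 e4, folded encode_pair]
    note e6 = eval_call'[OF R(4) R(1) e5 t1(1)]
    note e7 = eval_node[OF e2 eval_node[OF e3 e6, folded encode_pair], folded encode_pair]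
    note e8 = eval_if_true[OF e1 eval_call'[OF R(5) R(2) e7 t2(1)]]
    show ?case
      by (intro exI conjI, unfold foldr_Cons comp_apply, rule e8)
        (use Cons.prems(2) sb tq t1(2) in \<open>simp add: a encode_pair encode_Cons\<close>)
  qed
  have len: "length ys \<le> size_of ys" for ys :: "'c list"
    by (induction ys) (auto simp: encode_Cons)
  let ?N = "[:2, 1:] + p + b"
  let ?p = "p + [:10, 3:] + p + (1 + p) * (20 * ?N + pcompose q ?N + pcompose p ?N)"
  show ?thesis
  proof (rule ptimeI[of ?R "ECall ?m (ENode Arg eL)" _ ?p])
    fix x
    obtain s where s: "eval ?R (encode x) eL (encode (L x)) s" "s \<le> poly p (size_of x)"
      "size_of (L x) \<le> poly p (size_of x)" by (rule computesD[OF L']) (rule that)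
    obtain t where t: "eval ?R (encode (x, L x)) ?loop (encode (?F x (L x))) t"
      "t \<le> Suc (length (L x)) * (20 * poly ?N (size_of x) + poly q (poly ?N (size_of x)) + poly p (poly ?N (size_of x)))"
      using loop[of x "[]" "L x" "poly ?N (size_of x)"] s(3) by auto
    have "Suc (length (L x)) \<le> 1 + poly p (size_of x)" using len[of "L x"] s(3) by simp
    then have "Suc (length (L x)) * (20 * poly ?N (size_of x) + poly q (poly ?N (size_of x)) + poly p (poly ?N (size_of x)))
      \<le> (1 + poly p (size_of x)) * (20 * poly ?N (size_of x) + poly q (poly ?N (size_of x)) + poly p (poly ?N (size_of x)))"
      by (rule mult_le_mono1)
    also have "\<dots> = poly ((1 + p) * (20 * ?N + pcompose q ?N + pcompose p ?N)) (size_of x)"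
      by (simp add: poly_pcompose)
    finally have t': "t \<le> poly ((1 + p) * (20 * ?N + pcompose q ?N + pcompose p ?N)) (size_of x)" using t(2) by simp
    note e = eval_call'[OF R(4) R(1) eval_node[OF eval_arg s(1), folded encode_pair] t(1)]
    have "Suc (size_of x + s + size_of (x, L x) + t) \<le> poly ?p (size_of x)"
      using s t' unfolding poly_add[of "p + [:10, 3:] + p"] by (simp add: encode_pair)
    then show "\<exists>t. eval ?R (encode x) (ECall ?m (ENode Arg eL)) (encode (?F x (L x))) t \<and> t \<le> poly ?p (size_of x)"
      using e by blast
  qed
qed

lemma eval_left': "eval P x a u s \<Longrightarrow> left u = v \<Longrightarrow> eval P x (ELeft a) v (s + tsize v)"
  using eval_left by blast

lemma eval_right': "eval P x a u s \<Longrightarrow> right u = v \<Longrightarrow> eval P x (ERight a) v (s + tsize v)"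
  using eval_right by blast

lemma eval_call_self: "eval [B] x a u s \<Longrightarrow> eval [B] u B w t \<Longrightarrow> eval [B] x (ECall 0 a) w (Suc (s + t))"
  by (rule eval_call') auto

lemma eval_le: "eval P x e v t \<Longrightarrow> e = e' \<Longrightarrow> v = v' \<Longrightarrow> t \<le> n \<Longrightarrow> \<exists>t. eval P x e' v' t \<and> t \<le> n"
  by blast

section \<open>Equality of trees and an injective numbering\<close>

definition eq_body :: expr where
  "eq_body = EIf (ELeft Arg)
     (EIf (ERight Arg)
       (EIf (ECall 0 (ENode (ELeft (ELeft Arg)) (ELeft (ERight Arg))))
         (ECall 0 (ENode (ERight (ELeft Arg)) (ERight (ERight Arg)))) ELeaf) ELeaf)
     (EIf (ERight Arg) ELeaf (ENode ELeaf ELeaf))"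

text \<open>Each recursive call consumes a node of \<open>a\<close>, and the trees handled in one
  call are bounded by the arguments, so the cost per node is linear in \<open>N\<close>.\<close>

lemma eq_body_eval:
  "tsize a + tsize b + 1 \<le> N \<Longrightarrow>
   \<exists>t. eval [eq_body] (Node a b) eq_body (encode (a = b)) t \<and> t \<le> tsize a * (40 * N)"
proof (induction a arbitrary: b)
  case Leaf
  let ?x = "Node Leaf b"
  have l: "eval [eq_body] ?x (ELeft Arg) Leaf (tsize ?x + tsize Leaf)"
    by (rule eval_left'[OF eval_arg]) simp
  have r: "eval [eq_body] ?x (ERight Arg) b (tsize ?x + tsize b)"
    by (rule eval_right'[OF eval_arg]) simp
  show ?case
  proof (cases b)
    case bLeaf: Leaf
    have r': "eval [eq_body] ?x (ERight Arg) Leaf (tsize ?x + tsize b)" using r unfolding bLeaf .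
    show ?thesis
      by (rule eval_le[OF eval_if_false[OF l eval_if_false[OF r' eval_node[OF eval_leaf eval_leaf]]]])
        (rule eq_body_def[symmetric], use Leaf bLeaf in \<open>simp_all add: encode_bool_def\<close>)
  next
    case (Node b1 b2)
    have r': "eval [eq_body] ?x (ERight Arg) (Node b1 b2) (tsize ?x + tsize b)" using r unfolding Node .
    show ?thesis
      by (rule eval_le[OF eval_if_false[OF l eval_if_true[OF r' eval_leaf]]])
        (rule eq_body_def[symmetric], use Leaf Node in \<open>simp_all add: encode_bool_def\<close>)
  qed
next
  case (Node a1 a2)
  let ?a = "Node a1 a2"
  let ?x = "Node ?a b"
  have l: "eval [eq_body] ?x (ELeft Arg) (Node a1 a2) (tsize ?x + tsize ?a)"
    by (rule eval_left'[OF eval_arg]) simp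
  have r: "eval [eq_body] ?x (ERight Arg) b (tsize ?x + tsize b)"
    by (rule eval_right'[OF eval_arg]) simp
  have N: "tsize a1 + tsize a2 + tsize b + 2 \<le> N" using Node.prems by simp
  show ?case
  proof (cases b)
    case Leaf
    have r': "eval [eq_body] ?x (ERight Arg) Leaf (tsize ?x + tsize b)" using r unfolding Leaf .
    show ?thesis
      by (rule eval_le[OF eval_if_true[OF l eval_if_false[OF r' eval_leaf]]])
        (rule eq_body_def[symmetric], use N Leaf in \<open>simp_all add: encode_bool_def\<close>)
  next
    case b: (Node b1 b2)
    obtain t1 where t1: "eval [eq_body] (Node a1 b1) eq_body (encode (a1 = b1)) t1" "t1 \<le> tsize a1 * (40 * N)"
      using Node.IH(1)[of b1] Node.prems b by auto
    obtain t2 where t2: "eval [eq_body] (Node a2 b2) eq_body (encode (a2 = b2)) t2" "t2 \<le> tsize a2 * (40 * N)"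
      using Node.IH(2)[of b2] Node.prems b by auto
    have r': "eval [eq_body] ?x (ERight Arg) (Node b1 b2) (tsize ?x + tsize b)" using r b by simp
    note c1 = eval_call_self[OF eval_node[OF eval_left'[OF l left.simps(2)] eval_left'[OF r' left.simps(2)]] t1(1)]
      and c2 = eval_call_self[OF eval_node[OF eval_right'[OF l right.simps(2)] eval_right'[OF r' right.simps(2)]] t2(1)]
    show ?thesis
    proof (cases "a1 = b1")
      case True
      have eT: "encode (a1 = b1) = Node Leaf Leaf" using True by (simp add: encode_bool_def)
      show ?thesis
        by (rule eval_le[OF eval_if_true[OF l eval_if_true[OF r' eval_if_true[OF c1[unfolded eT] c2]]]])
          (rule eq_body_def[symmetric], use N b True t1(2) t2(2) in \<open>simp_all add: encode_bool_def algebra_simps\<close>)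
    next
      case False
      have eF: "encode (a1 = b1) = Leaf" using False by (simp add: encode_bool_def)
      show ?thesis
        by (rule eval_le[OF eval_if_true[OF l eval_if_true[OF r' eval_if_false[OF c1[unfolded eF] eval_leaf]]]])
          (rule eq_body_def[symmetric], use N b False t1(2) in \<open>simp_all add: encode_bool_def algebra_simps\<close>)
    qed
  qed
qed

lemma ptime_tree_eq: "ptime (\<lambda>z :: tree \<times> tree. fst z = snd z)"
proof (rule ptimeI[of "[eq_body]" "ECall 0 Arg" _ "[:0, 1:] + 1 + [:0, 40:] * [:0, 1:]"])
  fix z :: "tree \<times> tree"
  obtain a b where z: "z = (a, b)" by (cases z)
  obtain t where t: "eval [eq_body] (Node a b) eq_body (encode (a = b)) t"
    "t \<le> tsize a * (40 * size_of z)"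
    using eq_body_eval[of a b "size_of z"] unfolding z by (auto simp: encode_pair encode_tree_def)
  have ez: "encode z = Node a b" unfolding z by (simp add: encode_pair encode_tree_def)
  have "tsize a * (40 * size_of z) \<le> size_of z * (40 * size_of z)"
    unfolding ez by (rule mult_le_mono1) simp
  then have t': "t \<le> size_of z * (40 * size_of z)" using t(2) by linarith
  show "\<exists>t. eval [eq_body] (encode z) (ECall 0 Arg) (encode (fst z = snd z)) t \<and>
      t \<le> poly ([:0, 1:] + 1 + [:0, 40:] * [:0, 1:]) (size_of z)"
    by (intro eval_le[OF eval_call_self[OF eval_arg t(1)[folded ez]]]) (use t' z in \<open>auto simp: algebra_simps\<close>)
qed

text \<open>A prefix code: preorder traversal, one bit per node of the tree.\<close>

fun serial :: "tree \<Rightarrow> tree \<Rightarrow> tree" where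
  "serial Leaf acc = Node Leaf acc"
| "serial (Node l r) acc = Node (Node Leaf Leaf) (serial l (serial r acc))"

lemma serial_inject: "serial a x = serial b y \<Longrightarrow> a = b \<and> x = y"
proof (induction a arbitrary: x b y)
  case Leaf then show ?case by (cases b) auto
next
  case (Node a1 a2)
  show ?case
  proof (cases b)
    case Leaf then show ?thesis using Node.prems by simp
  next
    case b: (Node b1 b2)
    have "serial a1 (serial a2 x) = serial b1 (serial b2 y)" using Node.prems b by simp
    then have "a1 = b1" "serial a2 x = serial b2 y" using Node.IH(1) by blast+
    then show ?thesis using Node.IH(2) b by blast
  qed
qed

lemma tsize_serial: "tsize (serial t acc) \<le> 4 * tsize t + tsize acc"
proof (induction t arbitrary: acc)
  case (Node l r)
  show ?case using Node.IH(1)[of "serial r acc"] Node.IH(2)[of acc] by simp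
qed simp

text \<open>With the least significant bit first, serializing in front of the code of a positive
  number prepends low digits and thus yields the code of a positive number again.\<close>

lemma enc_nat_serial:
  assumes "n > 0"
  shows "\<exists>m>0. enc_nat m = serial t (enc_nat n)"
  using assms
proof (induction t arbitrary: n)
  case Leaf
  have "enc_nat (2 * n) = Node Leaf (enc_nat n)" using Leaf by (subst enc_nat.simps) simp
  then show ?case using Leaf by (intro exI[of _ "2 * n"]) simp
next
  case (Node l r)
  obtain k where k: "k > 0" "enc_nat k = serial r (enc_nat n)" using Node.IH(2)[OF Node.prems] by blast
  obtain m where m: "m > 0" "enc_nat m = serial l (enc_nat k)" using Node.IH(1)[OF k(1)] by blast
  have "enc_nat (2 * m + 1) = Node (Node Leaf Leaf) (enc_nat m)" by (subst enc_nat.simps) simp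
  then show ?case using m k by (intro exI[of _ "2 * m + 1"]) simp
qed

text \<open>Elements of examples must be natural numbers. The binary digits of this one are the
  serialized value, so its code has linear size and computing it takes no arithmetic. The most
  significant digit 1, from \<open>enc_nat 1\<close>, keeps zero bits below it from being
  lost.\<close>

definition number :: "'a::encodable \<Rightarrow> nat" where
  "number x = (SOME n. enc_nat n = serial (encode x) (enc_nat 1))"

lemma enc_nat_number: "enc_nat (number x) = serial (encode x) (enc_nat 1)"
  unfolding number_def using enc_nat_serial[of 1 "encode x"] by (metis (mono_tags, lifting) someI zero_less_one)

lemma number_inject: "number x = number y \<longleftrightarrow> x = y"
  using enc_nat_number[of x] enc_nat_number[of y] serial_inject encode_inject by metis

definition serial_body :: expr where
  "serial_body = EIf (ELeft Arg)
     (ENode (ENode ELeaf ELeaf) (ECall 0 (ENode (ELeft (ELeft Arg))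
       (ECall 0 (ENode (ERight (ELeft Arg)) (ERight Arg))))))
     (ENode ELeaf (ERight Arg))"

text \<open>In the bound, the factor 5 pays for the tree and for its serialization, which is at most
  four times as large up to the accumulator.\<close>

lemma serial_body_eval:
  "5 * tsize t + tsize acc + 1 \<le> N \<Longrightarrow>
   \<exists>k. eval [serial_body] (Node t acc) serial_body (serial t acc) k \<and> k \<le> tsize t * (40 * N)"
proof (induction t arbitrary: acc)
  case Leaf
  let ?x = "Node Leaf acc"
  have l: "eval [serial_body] ?x (ELeft Arg) Leaf (tsize ?x + tsize Leaf)"
    by (rule eval_left'[OF eval_arg]) simp
  have r: "eval [serial_body] ?x (ERight Arg) acc (tsize ?x + tsize acc)"
    by (rule eval_right'[OF eval_arg]) simp
  show ?case
    by (rule eval_le[OF eval_if_false[OF l eval_node[OF eval_leaf r]]])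
      (rule serial_body_def[symmetric], use Leaf in simp_all)
next
  case (Node a b)
  let ?x = "Node (Node a b) acc"
  have l: "eval [serial_body] ?x (ELeft Arg) (Node a b) (tsize ?x + tsize (Node a b))"
    by (rule eval_left'[OF eval_arg]) simp
  have r: "eval [serial_body] ?x (ERight Arg) acc (tsize ?x + tsize acc)"
    by (rule eval_right'[OF eval_arg]) simp
  have sb: "tsize (serial b acc) \<le> 4 * tsize b + tsize acc" by (rule tsize_serial)
  have sa: "tsize (serial a (serial b acc)) \<le> 4 * tsize a + (4 * tsize b + tsize acc)"
    using tsize_serial[of a "serial b acc"] sb by simp
  obtain k1 where k1: "eval [serial_body] (Node b acc) serial_body (serial b acc) k1" "k1 \<le> tsize b * (40 * N)"
    using Node.IH(2)[of acc] Node.prems by auto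
  obtain k2 where k2: "eval [serial_body] (Node a (serial b acc)) serial_body (serial a (serial b acc)) k2"
    "k2 \<le> tsize a * (40 * N)"
    using Node.IH(1)[of "serial b acc"] Node.prems sb by auto
  note c1 = eval_call_self[OF eval_node[OF eval_right'[OF l right.simps(2)] r] k1(1)]
  note c2 = eval_call_self[OF eval_node[OF eval_left'[OF l left.simps(2)] c1] k2(1)]
  show ?case
    by (rule eval_le[OF eval_if_true[OF l eval_node[OF eval_node[OF eval_leaf eval_leaf] c2]]])
      (rule serial_body_def[symmetric], use Node.prems sa sb k1(2) k2(2) in \<open>simp_all add: algebra_simps\<close>)
qed

lemma ptime_serial: "ptime (\<lambda>t. serial t (enc_nat 1))"
proof (rule ptimeI[of "[serial_body]" "ECall 0 (ENode Arg (ENode (ENode ELeaf ELeaf) ELeaf))" _ "[:50, 50:] + [:0, 1:] * [:400, 400:]"])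
  fix t :: tree
  have e1: "enc_nat 1 = Node (Node Leaf Leaf) Leaf" by (simp add: enc_nat.simps)
  obtain k where k: "eval [serial_body] (Node t (enc_nat 1)) serial_body (serial t (enc_nat 1)) k"
    "k \<le> tsize t * (40 * (5 * tsize t + 6))"
    using serial_body_eval[of t "enc_nat 1" "5 * tsize t + 6"] e1 by auto
  show "\<exists>k. eval [serial_body] (encode t) (ECall 0 (ENode Arg (ENode (ENode ELeaf ELeaf) ELeaf)))
      (encode (serial t (enc_nat 1))) k \<and> k \<le> poly ([:50, 50:] + [:0, 1:] * [:400, 400:]) (size_of t)"
    unfolding encode_tree_def
    by (rule eval_le[OF eval_call_self[OF eval_node[OF eval_arg eval_node[OF eval_node[OF eval_leaf eval_leaf] eval_leaf], folded e1] k(1)]])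
      (use k(2) in \<open>simp_all add: e1[unfolded One_nat_def] algebra_simps\<close>)
qed

lemma ptime_number: "ptime (number :: 'a::encodable \<Rightarrow> nat)"
  by (rule ptime_recode[OF ptime_serial, where i = encode and f = number])
    (simp_all add: encode_tree_def enc_nat_number encode_nat_def)

section \<open>Syntax-directed closure rules, in particular for lists\<close>

named_theorems ptime_intros

lemma ptime_Pair [ptime_intros]:
  "ptime f \<Longrightarrow> ptime g \<Longrightarrow> ptime (\<lambda>x. (f x, g x))"
  by (rule ptime_Node[of f g]) (simp_all add: encode_pair)

lemma ptime_cong:
  assumes "ptime f" "\<And>x. f x = g x"
  shows "ptime g"
proof -
  have "f = g" using assms(2) by (rule ext)
  then show ?thesis using assms(1) by simp
qed

text \<open>Turns a bound for a function on pairs into a rule for its curried form at computed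
  arguments, the shape in which \<open>ptime_intros\<close> meets it.\<close>

lemma ptime_app2:
  assumes "ptime (\<lambda>z. F (fst z) (snd z))" "ptime f" "ptime g"
  shows "ptime (\<lambda>x. F (f x) (g x))"
  using ptime_comp[OF ptime_Pair[OF assms(2,3)] assms(1)] by simp

lemma ptime_fst [ptime_intros]:
  assumes "ptime f" shows "ptime (\<lambda>x. fst (f x))"
  by (rule ptime_comp[OF assms], rule ptime_left) (auto simp: encode_prod_def)

lemma ptime_snd [ptime_intros]:
  assumes "ptime f" shows "ptime (\<lambda>x. snd (f x))"
  by (rule ptime_comp[OF assms], rule ptime_right) (auto simp: encode_prod_def)

lemma ptime_encode [ptime_intros]:
  assumes "ptime f" shows "ptime (\<lambda>x. encode (f x))"
  by (rule ptime_recode[OF assms, where i = "\<lambda>x. x"]) (simp_all add: encode_tree_def)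

lemma ptime_decode:
  assumes "ptime g" "\<And>x. g x = encode (f x)"
  shows "ptime f"
  by (rule ptime_recode[OF assms(1), where i = "\<lambda>x. x"]) (simp_all add: encode_tree_def assms(2))

lemma ptime_eq [ptime_intros]:
  fixes f g :: "'a::encodable \<Rightarrow> 'b::encodable"
  assumes "ptime f" "ptime g"
  shows "ptime (\<lambda>x. f x = g x)"
  using ptime_comp[OF ptime_Pair[OF ptime_encode[OF assms(1)] ptime_encode[OF assms(2)]] ptime_tree_eq]
  by (simp add: encode_eq_iff)

lemma encode_False: "encode b = Leaf \<longleftrightarrow> \<not> b"
  by (simp add: encode_bool_def)

lemma ptime_if [ptime_intros]:
  assumes "ptime b" "ptime f" "ptime g"
  shows "ptime (\<lambda>x. if b x then f x else g x)"
  by (rule ptime_cong[OF ptime_test[OF assms]]) (simp add: encode_False)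

lemma ptime_not [ptime_intros]: "ptime b \<Longrightarrow> ptime (\<lambda>x. \<not> b x)"
  by (rule ptime_cong[OF ptime_if[of b "\<lambda>_. False" "\<lambda>_. True"]]) (auto intro: ptime_const)

lemma ptime_conj [ptime_intros]: "ptime b \<Longrightarrow> ptime c \<Longrightarrow> ptime (\<lambda>x. b x \<and> c x)"
  by (rule ptime_cong[OF ptime_if[of b c "\<lambda>_. False"]]) (auto intro: ptime_const)

lemma ptime_disj [ptime_intros]: "ptime b \<Longrightarrow> ptime c \<Longrightarrow> ptime (\<lambda>x. b x \<or> c x)"
  by (rule ptime_cong[OF ptime_if[of b "\<lambda>_. True" c]]) (auto intro: ptime_const)

lemma ptime_imp [ptime_intros]: "ptime b \<Longrightarrow> ptime c \<Longrightarrow> ptime (\<lambda>x. b x \<longrightarrow> c x)"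
  by (rule ptime_cong[OF ptime_if[of b c "\<lambda>_. True"]]) (auto intro: ptime_const)

lemma ptime_Inl [ptime_intros]:
  "ptime f \<Longrightarrow> ptime (\<lambda>x. Inl (f x) :: 'b::encodable + 'c::encodable)"
  by (rule ptime_Node[OF ptime_const[of Leaf]]) (auto simp: encode_sum_def encode_tree_def)

lemma ptime_Inr [ptime_intros]:
  "ptime f \<Longrightarrow> ptime (\<lambda>x. Inr (f x) :: 'b::encodable + 'c::encodable)"
  by (rule ptime_Node[OF ptime_const[of "Node Leaf Leaf"]]) (auto simp: encode_sum_def encode_tree_def)

lemma ptime_isl [ptime_intros]:
  fixes f :: "'a::encodable \<Rightarrow> 'b::encodable + 'c::encodable"
  assumes "ptime f" shows "ptime (\<lambda>x. isl (f x))"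
proof (rule ptime_comp[OF assms])
  have l: "ptime (\<lambda>s :: 'b + 'c. left (encode s))"
    by (rule ptime_left) (simp add: encode_tree_def)
  show "ptime (isl :: 'b + 'c \<Rightarrow> bool)"
    using ptime_eq[OF l ptime_const[of Leaf]]
    by (rule back_subst[of ptime]) (auto simp: encode_sum_def isl_def fun_eq_iff split: sum.splits)
qed

lemma ptime_Cons [ptime_intros]:
  "ptime f \<Longrightarrow> ptime g \<Longrightarrow> ptime (\<lambda>x. f x # g x)"
  by (rule ptime_Node[of f g]) (simp_all add: encode_Cons)

lemma ptime_tl [ptime_intros]:
  fixes f :: "'a::encodable \<Rightarrow> 'b::encodable list"
  assumes "ptime f" shows "ptime (\<lambda>x. tl (f x))"
proof (rule ptime_comp[OF assms], rule ptime_right)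
  fix l :: "'b list" show "encode (tl l) = right (encode l)"
    by (cases l) (simp_all add: encode_Nil encode_Cons)
qed

lemma ptime_hd [ptime_intros]:
  fixes f :: "'a::encodable \<Rightarrow> 'b::encodable list"
  assumes "ptime f" shows "ptime (\<lambda>x. hd (f x))"
proof (rule ptime_comp[OF assms])
  have l: "ptime (\<lambda>l :: 'b list. left (encode l))"
    by (rule ptime_left) (simp add: encode_tree_def)
  \<comment> \<open>\<open>hd []\<close> is an unspecified but fixed value, so it can be compiled in
    as a constant.\<close>
  have "ptime (\<lambda>l :: 'b list. if l = [] then encode (hd l) else left (encode l))"
    using ptime_if[OF ptime_eq[OF ptime_id ptime_const[of "[]"]] ptime_const[of "encode (hd [] :: 'b)"] l]
    by (rule ptime_cong) simp
  then show "ptime (hd :: 'b list \<Rightarrow> 'b)"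
  proof (rule ptime_decode)
    fix l :: "'b list" show "(if l = [] then encode (hd l) else left (encode l)) = encode (hd l)"
      by (cases l) (simp_all add: encode_Cons)
  qed
qed

lemma length_le_size: "length xs \<le> size_of xs"
  by (induction xs) (auto simp: encode_Cons)

lemma size_le_size: "y \<in> set xs \<Longrightarrow> size_of y \<le> size_of xs"
  by (induction xs) (auto simp: encode_Cons)

lemma size_append: "size_of (xs @ ys) \<le> size_of xs + size_of ys"
  by (induction xs) (auto simp: encode_Cons)

lemma size_suffix: "L = zs @ ys \<Longrightarrow> size_of ys \<le> size_of L"
  by (induction zs arbitrary: L) (auto simp: encode_Cons le_Suc_eq trans_le_add2)

lemma ptime_map [ptime_intros]:
  fixes L :: "'a::encodable \<Rightarrow> 'b::encodable list" and F :: "'a \<Rightarrow> 'b \<Rightarrow> 'c::encodable"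
  assumes F: "ptime (\<lambda>z. F (fst z) (snd z))" and L: "ptime L"
  shows "ptime (\<lambda>x. map (F x) (L x))"
proof -
  obtain p where p: "\<And>z. size_of (F (fst z) (snd z)) \<le> poly p (size_of z)"
    using ptime_size[OF F] by blast
  obtain q where q: "\<And>x. size_of (L x) \<le> poly q (size_of x)" using ptime_size[OF L] by blast
  let ?G = "\<lambda>z :: 'a \<times> 'b \<times> 'c list. F (fst z) (fst (snd z)) # snd (snd z)"
  have G: "ptime ?G"
    by (intro ptime_Cons ptime_app2[OF F] ptime_fst ptime_snd ptime_id)
  have "ptime (\<lambda>x. foldr (\<lambda>a s. ?G (x, a, s)) (L x) [])"
  proof (rule ptime_foldr[OF L ptime_const G, where b = "1 + q * (1 + pcompose p ([:1, 1:] + q))"])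
    fix x ys zs assume ys: "L x = zs @ ys"
    let ?B = "poly p (poly ([:1, 1:] + q) (size_of x))"
    have "size_of (F x y) \<le> ?B" if "y \<in> set (L x)" for y
    proof -
      have "size_of (x, y) \<le> poly ([:1, 1:] + q) (size_of x)"
        using size_le_size[OF that] q[of x] by (simp add: encode_pair)
      then show ?thesis using p[of "(x, y)"] poly_nat_mono[of "size_of (x, y)" _ p] le_trans by fastforce
    qed
    then have "size_of (foldr (\<lambda>a s. ?G (x, a, s)) ys []) \<le> 1 + length ys * (1 + ?B)"
      using ys by (induction ys arbitrary: zs) (fastforce simp: encode_Nil encode_Cons)+
    also have "\<dots> \<le> 1 + poly q (size_of x) * (1 + ?B)"
      using length_le_size[of ys] size_suffix[OF ys] q[of x] by (intro add_left_mono mult_le_mono1) linarith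
    finally show "size_of (foldr (\<lambda>a s. ?G (x, a, s)) ys []) \<le> poly (1 + q * (1 + pcompose p ([:1, 1:] + q))) (size_of x)"
      by (simp add: poly_pcompose)
  qed
  moreover have "foldr (\<lambda>a s. ?G (x, a, s)) l [] = map (F x) l" for x l
    by (induction l) auto
  ultimately show ?thesis by simp
qed

lemma ptime_append [ptime_intros]:
  fixes f g :: "'a::encodable \<Rightarrow> 'b::encodable list"
  assumes "ptime f" "ptime g"
  shows "ptime (\<lambda>x. f x @ g x)"
proof -
  obtain p where p: "\<And>x. size_of (f x) \<le> poly p (size_of x)" using ptime_size[OF assms(1)] by blast
  obtain q where q: "\<And>x. size_of (g x) \<le> poly q (size_of x)" using ptime_size[OF assms(2)] by blast
  let ?G = "\<lambda>z :: 'a \<times> 'b \<times> 'b list. fst (snd z) # snd (snd z)"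
  have eq: "foldr (\<lambda>a s. ?G (x, a, s)) l k = l @ k" for x l k by (induction l) auto
  have "ptime ?G" by (intro ptime_intros ptime_id)
  then have "ptime (\<lambda>x. foldr (\<lambda>a s. ?G (x, a, s)) (f x) (g x))"
  proof (rule ptime_foldr[OF assms, where b = "p + q"])
    fix x ys zs assume "f x = zs @ ys"
    then show "size_of (foldr (\<lambda>a s. ?G (x, a, s)) ys (g x)) \<le> poly (p + q) (size_of x)"
      unfolding eq using size_append[of ys "g x"] size_suffix[of "f x" zs ys] p[of x] q[of x] by simp
  qed
  then show ?thesis by (simp only: eq)
qed

lemma ptime_concat [ptime_intros]:
  fixes f :: "'a::encodable \<Rightarrow> 'b::encodable list list"
  assumes "ptime f"
  shows "ptime (\<lambda>x. concat (f x))"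
proof -
  obtain p where p: "\<And>x. size_of (f x) \<le> poly p (size_of x)" using ptime_size[OF assms(1)] by blast
  let ?G = "\<lambda>z :: 'a \<times> 'b list \<times> 'b list. fst (snd z) @ snd (snd z)"
  have eq: "foldr (\<lambda>a s. ?G (x, a, s)) l [] = concat l" for x l by (induction l) auto
  have sz: "size_of (concat l) \<le> size_of l" for l :: "'b list list"
  proof (induction l)
    case (Cons a l)
    then show ?case using size_append[of a "concat l"] by (simp add: encode_Cons)
  qed (simp add: encode_Nil)
  have "ptime ?G" by (intro ptime_intros ptime_id)
  then have "ptime (\<lambda>x. foldr (\<lambda>a s. ?G (x, a, s)) (f x) [])"
  proof (rule ptime_foldr[OF assms ptime_const, where b = p])
    fix x ys zs assume "f x = zs @ ys"
    then show "size_of (foldr (\<lambda>a s. ?G (x, a, s)) ys []) \<le> poly p (size_of x)"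
      unfolding eq using sz[of ys] size_suffix[of "f x" zs ys] p[of x] by simp
  qed
  then show ?thesis by (simp only: eq)
qed

lemma size_filter: "size_of (filter Q xs) \<le> size_of xs"
  by (induction xs) (auto simp: encode_Cons)

lemma ptime_filter [ptime_intros]:
  fixes L :: "'a::encodable \<Rightarrow> 'b::encodable list"
  assumes F: "ptime (\<lambda>z. F (fst z) (snd z))" and L: "ptime L"
  shows "ptime (\<lambda>x. filter (F x) (L x))"
proof -
  obtain p where p: "\<And>x. size_of (L x) \<le> poly p (size_of x)" using ptime_size[OF L] by blast
  let ?G = "\<lambda>z :: 'a \<times> 'b \<times> 'b list. if F (fst z) (fst (snd z)) then fst (snd z) # snd (snd z) else snd (snd z)"
  have eq: "foldr (\<lambda>a s. ?G (x, a, s)) l [] = filter (F x) l" for x l by (induction l) auto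
  have "ptime ?G" by (intro ptime_intros ptime_id ptime_app2[OF F])
  then have "ptime (\<lambda>x. foldr (\<lambda>a s. ?G (x, a, s)) (L x) [])"
  proof (rule ptime_foldr[OF L ptime_const, where b = p])
    fix x ys zs assume "L x = zs @ ys"
    then show "size_of (foldr (\<lambda>a s. ?G (x, a, s)) ys []) \<le> poly p (size_of x)"
      unfolding eq using size_filter[of "F x" ys] size_suffix[of "L x" zs ys] p[of x] by simp
  qed
  then show ?thesis by (simp only: eq)
qed

lemma ptime_ball [ptime_intros]:
  fixes L :: "'a::encodable \<Rightarrow> 'b::encodable list"
  assumes F: "ptime (\<lambda>z. F (fst z) (snd z))" and L: "ptime L"
  shows "ptime (\<lambda>x. \<forall>y\<in>set (L x). F x y)"
proof -
  have "ptime (\<lambda>x. filter (\<lambda>y. \<not> F x y) (L x) = [])"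
    by (intro ptime_intros ptime_const F L)
  then show ?thesis by (simp add: filter_empty_conv)
qed

lemma ptime_bex [ptime_intros]:
  fixes L :: "'a::encodable \<Rightarrow> 'b::encodable list"
  assumes F: "ptime (\<lambda>z. F (fst z) (snd z))" and L: "ptime L"
  shows "ptime (\<lambda>x. \<exists>y\<in>set (L x). F x y)"
proof -
  have "ptime (\<lambda>x. filter (\<lambda>y. F x y) (L x) \<noteq> [])"
    by (intro ptime_intros ptime_const F L)
  then show ?thesis by (simp add: filter_empty_conv)
qed

lemma ptime_member [ptime_intros]:
  assumes "ptime f" "ptime L"
  shows "ptime (\<lambda>x. f x \<in> set (L x))"
proof -
  have "ptime (\<lambda>z. \<exists>y\<in>set (snd z). y = fst z)"
    by (intro ptime_intros ptime_id)
  from ptime_comp[OF ptime_Pair[OF assms] this] show ?thesis by simp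
qed

text \<open>Cutting off at length \<open>k\<close> keeps \<open>bprod\<close> polynomial on all inputs; with the schemas fixed,
  all lists have bounded length.\<close>

fun bzip :: "nat \<Rightarrow> 'a list \<Rightarrow> 'b list \<Rightarrow> ('a \<times> 'b) list" where
  "bzip 0 xs ys = []"
| "bzip (Suc k) xs ys = (if xs = [] \<or> ys = [] then [] else (hd xs, hd ys) # bzip k (tl xs) (tl ys))"

lemma bzip_eq: "length xs \<le> k \<Longrightarrow> bzip k xs ys = zip xs ys"
proof (induction k arbitrary: xs ys)
  case (Suc k)
  then show ?case by (cases xs; cases ys) auto
qed simp

lemma ptime_bzip [ptime_intros]:
  assumes "ptime f" "ptime g"
  shows "ptime (\<lambda>x. bzip k (f x) (g x))"
  using assms
proof (induction k arbitrary: f g)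
  case 0 then show ?case using ptime_const by simp
next
  case (Suc k)
  show ?case unfolding bzip.simps by (intro ptime_intros ptime_const Suc)
qed

fun bprod :: "nat \<Rightarrow> 'a list list \<Rightarrow> 'a list list" where
  "bprod 0 xss = [[]]"
| "bprod (Suc k) xss = (if xss = [] then [[]]
     else concat (map (\<lambda>x. map (\<lambda>r. x # r) (bprod k (tl xss))) (hd xss)))"

lemma set_bprod: "length xss \<le> k \<Longrightarrow> set (bprod k xss) = {rs. list_all2 (\<lambda>r xs. r \<in> set xs) rs xss}"
proof (induction k arbitrary: xss)
  case (Suc k)
  show ?case
  proof (cases xss)
    case (Cons xs yss)
    then show ?thesis using Suc by (auto simp: list_all2_Cons2)
  qed simp
qed simp

lemma ptime_bprod [ptime_intros]:
  assumes "ptime f"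
  shows "ptime (\<lambda>x. bprod k (f x :: 'b::encodable list list))"
proof -
  have "ptime (\<lambda>xss. bprod k (xss :: 'b list list))"
  proof (induction k)
    case 0 then show ?case using ptime_const by simp
  next
    case (Suc k)
    note IH = ptime_comp[OF _ Suc]
    show ?case unfolding bprod.simps
      by (intro ptime_intros ptime_const ptime_id IH)
  qed
  from ptime_comp[OF assms this] show ?thesis .
qed

section \<open>Characterization by cores and their weakenings\<close>

instantiation lab :: (encodable) encodable
begin
definition encode_lab :: "'a lab \<Rightarrow> tree" where
  "encode_lab l = (case l of Full \<Rightarrow> Leaf | Fake \<Rightarrow> Node Leaf Leaf | Excl f \<Rightarrow> Node (Node Leaf Leaf) (encode f))"
instance by standard (auto simp: encode_lab_def dest: encode_inject split: lab.splits)
end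

definition arity_ok :: "schema \<Rightarrow> 'a atom \<Rightarrow> bool" where
  "arity_ok S f \<longleftrightarrow> S (fst f) = Some (length (snd f))"

lemma arity_ok_nat: "arity_ok S f = over_schema S f"
  by (simp add: arity_ok_def over_schema_def)

lemma arity_ok_img: "arity_ok S (img h f) = arity_ok S f"
  by (simp add: arity_ok_def)

text \<open>The element \<open>0\<close> only keeps the universe nonempty.\<close>

definition listed :: "fact list \<Rightarrow> listed_struct" where
  "listed fs = (0 # concat (map snd fs), fs)"

definition example :: "'b::encodable atom \<Rightarrow> 'b atom list \<Rightarrow> listed_struct \<times> listed_struct" where
  "example \<phi> X = (listed [img number \<phi>], listed (map (img number) X))"

abbreviation ex_struct :: "listed_struct \<times> listed_struct \<Rightarrow> struct \<times> struct" where
  "ex_struct \<equiv> map_prod struct_of struct_of"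

lemma finite_structure_listed:
  assumes "\<forall>f\<in>set fs. over_schema S f"
  shows "finite_structure S (struct_of (listed fs))"
  using assms unfolding finite_structure_def struct_of_def listed_def by auto

text \<open>Every source fact is an injective image of one of these: name each argument by the
  position of its first occurrence. Some patterns are isomorphic, which merely repeats
  examples.\<close>

definition patterns :: "schema \<Rightarrow> fact set" where
  "patterns S = {\<phi>. arity_ok S \<phi> \<and> set (snd \<phi>) \<subseteq> {..<length (snd \<phi>)}}"

lemma maps_over_dist: "maps_over dist X Y \<longleftrightarrow> (\<exists>h. (\<forall>a. h (Inl a) = Inl a) \<and> (\<forall>f\<in>X. img h f \<in> Y))"
  unfolding maps_over_def hom_over_def by auto

section \<open>Examples as homomorphism problems for the chase\<close>

context
  fixes S T :: schema
  assumes disjoint: "dom S \<inter> dom T = {}"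
begin

text \<open>Disjointness of the schemas confines left-hand sides to \<open>I\<close> and right-hand
  sides to \<open>J\<close>, so the union and its universe disappear from the condition.\<close>

lemma positive_iff_fires:
  assumes M: "lav_mapping S T M" and E: "mapping_example S T (I, J)"
  shows "positive_example S T M (I, J) \<longleftrightarrow> (\<forall>c\<in>M. \<forall>\<psi>\<in>facts I. fires c \<psi> (facts J))"
proof -
  have I: "over_schema S f" "set (snd f) \<subseteq> univ I" if "f \<in> facts I" for f
    using E that unfolding mapping_example_def finite_structure_def by auto
  have J: "over_schema T f" "set (snd f) \<subseteq> univ J" if "f \<in> facts J" for f
    using E that unfolding mapping_example_def finite_structure_def by auto
  have dis: "\<not> (over_schema S f \<and> over_schema T g)" if "fst f = fst g" for f g
    using disjoint that unfolding over_schema_def by (metis disjoint_iff domI)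
  have "satisfies (struct_union I J) c \<longleftrightarrow> (\<forall>\<psi>\<in>facts I. fires c \<psi> (facts J))" if "c \<in> M" for c
  proof -
    have c: "over_schema S (lhs c)" "\<And>f. f \<in> set (rhs c) \<Longrightarrow> over_schema T f"
      using M that unfolding lav_mapping_def lav_constraint_def by auto
    show ?thesis
    proof
      assume sat: "satisfies (struct_union I J) c"
      show "\<forall>\<psi>\<in>facts I. fires c \<psi> (facts J)"
        unfolding fires_def
      proof (intro ballI allI impI)
        fix \<psi> h assume psi: "\<psi> \<in> facts I" "img h (lhs c) = \<psi>"
        have m: "img h (lhs c) \<in> facts I" unfolding psi(2) by (rule psi(1))
        have "\<forall>x\<in>univars c. h x \<in> univ (struct_union I J)"
          using I(2)[OF m] unfolding struct_union_def by auto
        moreover have "img h (lhs c) \<in> facts (struct_union I J)" using m unfolding struct_union_def by simp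
        ultimately obtain g where g: "\<forall>x\<in>univars c. g x = h x"
          "\<forall>f\<in>set (rhs c). img g f \<in> facts (struct_union I J)"
          using sat unfolding satisfies_def by blast
        have "img g f \<in> facts J" if f: "f \<in> set (rhs c)" for f
        proof -
          have "img g f \<notin> facts I" using dis[of "img g f" f] c(2)[OF f] I(1)[of "img g f"] by auto
          moreover have "img g f \<in> facts I \<union> facts J" using g(2) f unfolding struct_union_def by auto
          ultimately show ?thesis by blast
        qed
        then show "\<exists>g. (\<forall>x\<in>univars c. g x = h x) \<and> (\<forall>f\<in>set (rhs c). img g f \<in> facts J)"
          using g(1) by blast
      qed
    next
      assume fr: "\<forall>\<psi>\<in>facts I. fires c \<psi> (facts J)"
      obtain u where u: "u \<in> univ I" using E unfolding mapping_example_def finite_structure_def by auto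
      let ?U = "univ (struct_union I J)"
      show "satisfies (struct_union I J) c"
        unfolding satisfies_def
      proof (intro allI impI)
        fix h assume h: "\<forall>x\<in>univars c. h x \<in> ?U" "img h (lhs c) \<in> facts (struct_union I J)"
        have "img h (lhs c) \<notin> facts J" using dis[of "lhs c" "img h (lhs c)"] c(1) J(1) by auto
        then have "img h (lhs c) \<in> facts I" using h(2) unfolding struct_union_def by simp
        then obtain k where k: "\<forall>x\<in>univars c. k x = h x" "\<forall>f\<in>set (rhs c). img k f \<in> facts J"
          using fr unfolding fires_def by blast
        \<comment> \<open>Existential variables that occur in no atom still need a value in the
          universe; \<open>u\<close> provides it.\<close>
        define g where "g v = (if k v \<in> ?U then k v else u)" for v
        have "g x = h x" if "x \<in> univars c" for x using that k(1) h(1) unfolding g_def by auto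
        moreover have "g y \<in> ?U" for y using u unfolding g_def struct_union_def by auto
        moreover have "img g f \<in> facts (struct_union I J)" if f: "f \<in> set (rhs c)" for f
        proof -
          have kf: "img k f \<in> facts J" using k(2) f by blast
          have "k v \<in> ?U" if "v \<in> set (snd f)" for v
            using J(2)[OF kf] that unfolding struct_union_def by auto
          then have eq: "map g (snd f) = map k (snd f)" unfolding g_def by simp
          show ?thesis unfolding eq using kf unfolding struct_union_def by simp
        qed
        ultimately show "\<exists>g. (\<forall>x\<in>univars c. g x = h x) \<and> (\<forall>y\<in>set (exvars c). g y \<in> ?U) \<and>
            (\<forall>f\<in>set (rhs c). img g f \<in> facts (struct_union I J))" by blast
      qed
    qed
  qed
  then show ?thesis unfolding positive_example_def using E by auto
qed

lemma arity_ok_chase: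
  assumes "lav_mapping S T M" "f \<in> chase M \<phi>"
  shows "arity_ok T f"
proof -
  obtain c g where "c \<in> M" "g \<in> set (rhs c)" "f = img (place c \<phi>) g"
    using assms(2) unfolding chase_def by blast
  then show ?thesis using assms(1) unfolding lav_mapping_def lav_constraint_def
    by (simp add: arity_ok_img arity_ok_nat)
qed

lemma mapping_example_example:
  assumes "arity_ok S \<psi>" "\<forall>f\<in>set X. arity_ok T f"
  shows "mapping_example S T (ex_struct (example \<psi> X))"
  unfolding mapping_example_def example_def map_prod_simp fst_conv snd_conv
  using assms
  by (intro conjI finite_structure_listed) (auto simp: arity_ok_img arity_ok_nat[symmetric])

text \<open>As \<open>number\<close> and \<open>d\<close> are injective, the renamed source fact has
  the equality pattern of \<open>\<phi>\<close>, and homomorphisms translate along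
  \<open>number\<close> in both directions.\<close>

lemma example_positive_iff:
  fixes d :: "nat \<Rightarrow> 'b::encodable"
  assumes M: "lav_mapping S T M" and ok: "arity_ok S \<phi>" "\<forall>f\<in>set X. arity_ok T f" and d: "inj d"
  shows "positive_example S T M (ex_struct (example (img d \<phi>) X)) \<longleftrightarrow>
    (\<exists>h. (\<forall>a. h (Inl a) = d a) \<and> (\<forall>f\<in>chase M \<phi>. img h f \<in> set X))"
proof -
  let ?I = "struct_of (listed [img number (img d \<phi>)])" and ?J = "struct_of (listed (map (img number) X))"
  have I: "facts ?I = {img (number \<circ> d) \<phi>}" and J: "facts ?J = img number ` set X"
    unfolding struct_of_def listed_def by auto
  have E: "mapping_example S T (?I, ?J)"
    using mapping_example_example[of "img d \<phi>" X] ok unfolding example_def by (simp add: arity_ok_img)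
  have inj: "inj_on (number \<circ> d) A" for A
    using d by (auto simp: inj_on_def inj_def number_inject)
  have inv: "inv (number :: 'b \<Rightarrow> nat) (number x) = x" for x
    by (rule inv_f_f) (auto simp: inj_def number_inject)
  have ex: "ex_struct (example (img d \<phi>) X) = (?I, ?J)" unfolding example_def by simp
  show ?thesis
    unfolding ex positive_iff_fires[OF M E] I J
  proof
    assume "\<forall>c\<in>M. \<forall>\<psi>\<in>{img (number \<circ> d) \<phi>}. fires c \<psi> (img number ` set X)"
    then have "\<forall>c\<in>M. fires c (img (number \<circ> d) \<phi>) (img number ` set X)" by blast
    from chase_hom_if_fires[OF this] obtain h where h: "\<forall>a. h (Inl a) = (number \<circ> d) a"
      "\<forall>f\<in>chase M \<phi>. img h f \<in> img number ` set X" by blast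
    have "img (inv number \<circ> h) f \<in> set X" if f: "f \<in> chase M \<phi>" for f
    proof -
      obtain x where x: "x \<in> set X" "img h f = img number x" using h(2) f by blast
      have "map (inv number \<circ> h) (snd f) = map (inv number) (map h (snd f))" by simp
      also have "map h (snd f) = map number (snd x)" using x(2) by blast
      also have "map (inv number) (map number (snd x)) = snd x" by (simp add: inv map_idI)
      finally have "img (inv number \<circ> h) f = x" using x(2) by (simp only: prod_eq_iff fst_conv snd_conv)
      then show ?thesis using x(1) by simp
    qed
    then show "\<exists>h. (\<forall>a. h (Inl a) = d a) \<and> (\<forall>f\<in>chase M \<phi>. img h f \<in> set X)"
      using h(1) inv by (intro exI[of _ "inv number \<circ> h"]) auto
  next
    assume "\<exists>h. (\<forall>a. h (Inl a) = d a) \<and> (\<forall>f\<in>chase M \<phi>. img h f \<in> set X)"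
    then obtain h where h: "\<forall>a. h (Inl a) = d a" "\<forall>f\<in>chase M \<phi>. img h f \<in> set X" by blast
    have "img (number \<circ> h) f \<in> img number ` set X" if f: "f \<in> chase M \<phi>" for f
    proof -
      have "img number (img h f) \<in> img number ` set X" using h(2) f by blast
      then show ?thesis by simp
    qed
    then have "fires c (img (number \<circ> d) \<phi>) (img number ` set X)" if "c \<in> M" for c
      using fires_if_chase_hom[of "number \<circ> h" "number \<circ> d" M \<phi> "img number ` set X" c] inj that h(1) by simp
    then show "\<forall>c\<in>M. \<forall>\<psi>\<in>{img (number \<circ> d) \<phi>}. fires c \<psi> (img number ` set X)" by blast
  qed
qed

text \<open>The fact \<open>\<phi>\<close> with its own chase under \<open>N\<close> as target is
  positive for \<open>N\<close>, hence for \<open>M\<close>.\<close>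

lemma chase_maps_if_equivalent:
  assumes "lav_mapping S T M" "lav_mapping S T N" "logically_equivalent S T M N" "arity_ok S \<phi>"
  shows "maps_over dist (chase M \<phi>) (chase N \<phi>)"
proof -
  have "finite (chase N \<phi>)" using assms(2) finite_chase unfolding lav_mapping_def by blast
  then obtain X where X: "set X = chase N \<phi>" using finite_list by blast
  have ok: "\<forall>f\<in>set X. arity_ok T f" unfolding X using arity_ok_chase[OF assms(2)] by blast
  have i: "inj (Inl :: nat \<Rightarrow> velem)" by simp
  have "maps_over dist (chase N \<phi>) (set X)" unfolding X by (rule maps_over_mono) simp
  then have "positive_example S T N (ex_struct (example (img (Inl :: nat \<Rightarrow> velem) \<phi>) X))"
    unfolding example_positive_iff[OF assms(2,4) ok i] maps_over_dist .
  then have "positive_example S T M (ex_struct (example (img (Inl :: nat \<Rightarrow> velem) \<phi>) X))"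
    using assms(3) unfolding logically_equivalent_def by blast
  then show ?thesis
    unfolding example_positive_iff[OF assms(1,4) ok i] maps_over_dist X .
qed

lemma fires_transfer:
  assumes "maps_over dist (chase M \<phi>) (chase N \<phi>)" "inj_on val (set (snd \<phi>))"
    and "\<forall>c\<in>N. fires c (img val \<phi>) J" "c \<in> M"
  shows "fires c (img val \<phi>) J"
proof -
  obtain h where h: "\<forall>a. h (Inl a) = val a" "\<forall>f\<in>chase N \<phi>. img h f \<in> J"
    using chase_hom_if_fires[OF assms(3)] by blast
  obtain k where k: "\<forall>a. k (Inl a) = Inl a" "\<forall>f\<in>chase M \<phi>. img k f \<in> chase N \<phi>"
    using assms(1) unfolding maps_over_dist by blast
  have "img (h \<circ> k) f \<in> J" if f: "f \<in> chase M \<phi>" for f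
  proof -
    have "img h (img k f) \<in> J" using k(2) h(2) f by blast
    then show ?thesis by simp
  qed
  then show ?thesis
    using fires_if_chase_hom[of "h \<circ> k" val M \<phi> J c] h(1) k(1) assms(2,4) by simp
qed

text \<open>By injectivity of the naming, \<open>fires_transfer\<close> carries the comparison of
  chases from a pattern to all source facts of this pattern.\<close>

lemma equivalent_if_chase_maps:
  assumes M: "lav_mapping S T M" and N: "lav_mapping S T N"
    and maps: "\<And>\<phi>. \<phi> \<in> patterns S \<Longrightarrow> maps_over dist (chase M \<phi>) (chase N \<phi>) \<and> maps_over dist (chase N \<phi>) (chase M \<phi>)"
  shows "logically_equivalent S T M N"
proof -
  have "positive_example S T M e = positive_example S T N e" for e
  proof (cases "mapping_example S T e")
    case False then show ?thesis unfolding positive_example_def by blast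
  next
    case True
    obtain I J where e: "e = (I, J)" by (cases e)
    have "(\<forall>c\<in>M. fires c \<psi> (facts J)) \<longleftrightarrow> (\<forall>c\<in>N. fires c \<psi> (facts J))" if psi: "\<psi> \<in> facts I" for \<psi>
    proof -
      have ok: "arity_ok S \<psi>"
        using True psi unfolding e mapping_example_def finite_structure_def arity_ok_nat by auto
      let ?bs = "snd \<psi>"
      define idx where "idx b = (LEAST i. i < length ?bs \<and> ?bs ! i = b)" for b
      have idx: "idx b < length ?bs \<and> ?bs ! idx b = b" if "b \<in> set ?bs" for b
        unfolding idx_def by (rule LeastI_ex) (use that in \<open>simp add: in_set_conv_nth\<close>)
      define \<phi> where "\<phi> = img idx \<psi>"
      have "\<phi> \<in> patterns S" using ok idx unfolding patterns_def \<phi>_def by (auto simp: arity_ok_img)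
      note mp = maps[OF this]
      have val: "img (\<lambda>i. ?bs ! i) \<phi> = \<psi>"
        unfolding \<phi>_def using idx by (simp add: map_idI prod_eq_iff)
      have inj: "inj_on (\<lambda>i. ?bs ! i) (set (snd \<phi>))"
        unfolding \<phi>_def by (auto simp: inj_on_def) (metis idx)
      have mn: "maps_over dist (chase M \<phi>) (chase N \<phi>)" and nm: "maps_over dist (chase N \<phi>) (chase M \<phi>)"
        using mp by auto
      show ?thesis
        using fires_transfer[OF mn inj, of "facts J", unfolded val] fires_transfer[OF nm inj, of "facts J", unfolded val]
        by blast
    qed
    then show ?thesis
      using True unfolding e positive_iff_fires[OF M True[unfolded e]] positive_iff_fires[OF N True[unfolded e]]
      by blast
  qed
  then show ?thesis unfolding logically_equivalent_def by blast
qed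

text \<open>The positive example of a pattern forces the chase of a competitor \<open>N\<close> to
  map into the core. If the core did not map back, the chase of \<open>N\<close> would map into some
  weakening, and this negative example would be positive for \<open>N\<close>.\<close>

lemma uniquely_characterizes_by_cores:
  fixes core :: "fact \<Rightarrow> velem atom list"
    and wk :: "fact \<Rightarrow> velem atom \<Rightarrow> (velem \<times> velem lab) atom list"
  assumes M: "lav_mapping S T M" and pats: "set pats = patterns S"
    and core: "\<And>\<phi>. \<phi> \<in> patterns S \<Longrightarrow> set (core \<phi>) \<subseteq> chase M \<phi> \<and> maps_over dist (chase M \<phi>) (set (core \<phi>)) \<and>
      forest dist (set (core \<phi>)) \<and> rigid dist (set (core \<phi>))"
    and wk: "\<And>\<phi> f. \<phi> \<in> patterns S \<Longrightarrow> f \<in> set (core \<phi>) \<Longrightarrow> set (wk \<phi> f) = weaken dist (set (core \<phi>)) f"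
  shows "uniquely_characterizes S T
    (examples_of (map (\<lambda>\<phi>. example (img (\<lambda>a. (Inl a, Full)) \<phi>) (map (img (\<lambda>e. (e, Full :: velem lab))) (core \<phi>))) pats))
    (examples_of (concat (map (\<lambda>\<phi>. map (\<lambda>f. example (img (\<lambda>a. (Inl a, Full)) \<phi>) (wk \<phi> f)) (core \<phi>)) pats))) M"
proof -
  \<comment> \<open>The \<open>Full\<close> replicas give the positive examples the same element
    type as the negative ones.\<close>
  let ?d = "\<lambda>a. (Inl a, Full) :: velem \<times> velem lab"
  let ?p = "\<lambda>\<phi>. ex_struct (example (img ?d \<phi>) (map (img (\<lambda>e. (e, Full))) (core \<phi>)))"
  let ?n = "\<lambda>\<phi> f. ex_struct (example (img ?d \<phi>) (wk \<phi> f))"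
  have P: "examples_of (map (\<lambda>\<phi>. example (img ?d \<phi>) (map (img (\<lambda>e. (e, Full))) (core \<phi>))) pats) = ?p ` patterns S"
    unfolding examples_of_def pats[symmetric] by (simp add: image_image)
  have Nn: "examples_of (concat (map (\<lambda>\<phi>. map (\<lambda>f. example (img ?d \<phi>) (wk \<phi> f)) (core \<phi>)) pats)) =
      (\<Union>\<phi>\<in>patterns S. ?n \<phi> ` set (core \<phi>))"
    unfolding examples_of_def pats[symmetric] by (simp add: image_UN image_image)
  have inj: "inj ?d" by (simp add: inj_def)
  have ok: "arity_ok S \<phi>" if "\<phi> \<in> patterns S" for \<phi> using that unfolding patterns_def by blast
  have okc: "arity_ok T f" if "\<phi> \<in> patterns S" "f \<in> set (core \<phi>)" for \<phi> f
    using core[OF that(1)] that(2) arity_ok_chase[OF M] by blast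
  have okp: "\<forall>f\<in>set (map (img (\<lambda>e. (e, Full :: velem lab))) (core \<phi>)). arity_ok T f" if "\<phi> \<in> patterns S" for \<phi>
    using okc[OF that] by (auto simp: arity_ok_img)
  have okw: "\<forall>g\<in>set (wk \<phi> f). arity_ok T g" if pf: "\<phi> \<in> patterns S" "f \<in> set (core \<phi>)" for \<phi> f
  proof
    fix g assume "g \<in> set (wk \<phi> f)"
    then obtain g' rs where "g = (fst g', rs)" "g' \<in> set (core \<phi>)" "map fst rs = snd g'"
      unfolding wk[OF pf] weaken_def by blast
    moreover from this have "length rs = length (snd g')" by (metis length_map)
    ultimately show "arity_ok T g" using okc[OF pf(1), of g'] by (simp add: arity_ok_def)
  qed
  have pos: "positive_example S T N (?p \<phi>) \<longleftrightarrow> maps_over dist (chase N \<phi>) (set (core \<phi>))"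
    if N: "lav_mapping S T N" and phi: "\<phi> \<in> patterns S" for N \<phi>
  proof -
    have "(\<exists>h. (\<forall>a. h (Inl a) = ?d a) \<and> (\<forall>f\<in>chase N \<phi>. img h f \<in> set (map (img (\<lambda>e. (e, Full))) (core \<phi>)))) \<longleftrightarrow>
      maps_over dist (chase N \<phi>) (set (core \<phi>))" (is "?L \<longleftrightarrow> ?R")
    proof
      assume ?L
      then obtain h where h: "\<forall>a. h (Inl a) = ?d a"
        "\<forall>f\<in>chase N \<phi>. img h f \<in> set (map (img (\<lambda>e. (e, Full))) (core \<phi>))" by blast
      have "img (fst \<circ> h) f \<in> set (core \<phi>)" if f: "f \<in> chase N \<phi>" for f
      proof -
        obtain x where x: "x \<in> set (core \<phi>)" "img h f = img (\<lambda>e. (e, Full)) x" using h(2) f by auto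
        have "map (fst \<circ> h) (snd f) = map fst (map h (snd f))" by simp
        also have "map h (snd f) = map (\<lambda>e. (e, Full)) (snd x)" using x(2) by blast
        also have "map fst \<dots> = snd x" by (simp add: comp_def)
        finally have "img (fst \<circ> h) f = x" using x(2) by (simp only: prod_eq_iff fst_conv snd_conv)
        then show ?thesis using x(1) by simp
      qed
      then show ?R unfolding maps_over_dist using h(1) by (intro exI[of _ "fst \<circ> h"]) simp
    next
      assume ?R
      then obtain h where h: "\<forall>a. h (Inl a) = Inl a" "\<forall>f\<in>chase N \<phi>. img h f \<in> set (core \<phi>)"
        unfolding maps_over_dist by blast
      have "img (\<lambda>e. (h e, Full)) f \<in> set (map (img (\<lambda>e. (e, Full :: velem lab))) (core \<phi>))" if "f \<in> chase N \<phi>" for f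
      proof -
        have "img (\<lambda>e. (e, Full)) (img h f) \<in> img (\<lambda>e. (e, Full :: velem lab)) ` set (core \<phi>)" using h(2) that by blast
        then show ?thesis by (simp add: comp_def)
      qed
      then show ?L using h(1) by (intro exI[of _ "\<lambda>e. (h e, Full)"]) simp
    qed
    then show ?thesis using example_positive_iff[OF N ok[OF phi] okp[OF phi] inj] by simp
  qed
  have neg: "positive_example S T N (?n \<phi> f) \<longleftrightarrow>
      (\<exists>h. (\<forall>a. h (Inl a) = ?d a) \<and> (\<forall>g\<in>chase N \<phi>. img h g \<in> weaken dist (set (core \<phi>)) f))"
    if N: "lav_mapping S T N" and phi: "\<phi> \<in> patterns S" and f: "f \<in> set (core \<phi>)" for N \<phi> f
    using example_positive_iff[OF N ok[OF phi] okw[OF phi f] inj] unfolding wk[OF phi f] .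
  have mex: "mapping_example S T (?n \<phi> f)" if "\<phi> \<in> patterns S" "f \<in> set (core \<phi>)" for \<phi> f
    by (rule mapping_example_example) (use ok[OF that(1)] okw[OF that] in \<open>simp_all add: arity_ok_img\<close>)
  have fitsM: "fits S T M (?p ` patterns S) (\<Union>\<phi>\<in>patterns S. ?n \<phi> ` set (core \<phi>))"
  proof -
    have "\<not> positive_example S T M (?n \<phi> f)" if pf: "\<phi> \<in> patterns S" "f \<in> set (core \<phi>)" for \<phi> f
    proof
      assume "positive_example S T M (?n \<phi> f)"
      then obtain h where h: "\<forall>a. h (Inl a) = ?d a" "\<forall>g\<in>chase M \<phi>. img h g \<in> weaken dist (set (core \<phi>)) f"
        unfolding neg[OF M pf] by blast
      show False
        by (rule weaken_avoids[of "set (core \<phi>)" dist f h]) (use core[OF pf(1)] pf(2) h in auto)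
    qed
    then show ?thesis
      unfolding fits_def negative_example_def using pos[OF M] core mex by auto
  qed
  have "logically_equivalent S T N M"
    if N: "lav_mapping S T N" and fN: "fits S T N (?p ` patterns S) (\<Union>\<phi>\<in>patterns S. ?n \<phi> ` set (core \<phi>))" for N
  proof (rule equivalent_if_chase_maps[OF N M])
    fix \<phi> assume phi: "\<phi> \<in> patterns S"
    let ?q = "set (core \<phi>)"
    have "positive_example S T N (?p \<phi>)" using fN phi unfolding fits_def by blast
    then have NM: "maps_over dist (chase N \<phi>) ?q" unfolding pos[OF N phi] .
    then obtain g where g: "hom_over dist g (chase N \<phi>) ?q" unfolding maps_over_def by blast
    have fin: "finite (chase N \<phi>)" using N finite_chase unfolding lav_mapping_def by blast
    have MN: "maps_over dist ?q (chase N \<phi>)"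
    proof (rule ccontr)
      assume no: "\<not> maps_over dist ?q (chase N \<phi>)"
      have fo: "forest dist ?q" using core[OF phi] by blast
      obtain f h where f: "f \<in> ?q" and h: "\<forall>a\<in>dist. h a = (a, Full)"
        "\<forall>f'\<in>chase N \<phi>. img h f' \<in> weaken dist ?q f"
        using weaken_complete[OF List.finite_set fin fo g no] by blast
      have "positive_example S T N (?n \<phi> f)"
        unfolding neg[OF N phi f] using h by auto
      moreover have "?n \<phi> f \<in> (\<Union>\<phi>\<in>patterns S. ?n \<phi> ` set (core \<phi>))" using phi f by blast
      ultimately show False using fN unfolding fits_def negative_example_def by blast
    qed
    show "maps_over dist (chase N \<phi>) (chase M \<phi>) \<and> maps_over dist (chase M \<phi>) (chase N \<phi>)"
    proof
      have "?q \<subseteq> chase M \<phi>" "maps_over dist (chase M \<phi>) ?q" using core[OF phi] by blast+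
      then show "maps_over dist (chase N \<phi>) (chase M \<phi>)" "maps_over dist (chase M \<phi>) (chase N \<phi>)"
        using maps_over_trans[OF NM maps_over_mono] maps_over_trans[OF _ MN] by blast+
    qed
  qed
  then show ?thesis unfolding uniquely_characterizes_def P Nn using fitsM by blast
qed

end

section \<open>Computing the examples\<close>

definition cmatch :: "nat \<Rightarrow> ctup \<Rightarrow> fact \<Rightarrow> bool" where
  "cmatch K c \<phi> \<longleftrightarrow> fst (fst c) = fst \<phi> \<and>
     (\<forall>p\<in>set (bzip K (snd (fst c)) (snd \<phi>)). \<forall>p'\<in>set (bzip K (snd (fst c)) (snd \<phi>)). fst p = fst p' \<longrightarrow> snd p = snd p')"

definition cplace :: "nat \<Rightarrow> ctup \<Rightarrow> fact \<Rightarrow> nat \<Rightarrow> velem" where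
  "cplace K c \<phi> v =
     (if filter (\<lambda>p. fst p = v) (bzip K (snd (fst c)) (snd \<phi>)) = [] then Inr (c, v)
      else Inl (snd (hd (filter (\<lambda>p. fst p = v) (bzip K (snd (fst c)) (snd \<phi>))))))"

definition chase_list :: "nat \<Rightarrow> ctup list \<Rightarrow> fact \<Rightarrow> velem atom list" where
  "chase_list K cs \<phi> = concat (map (\<lambda>c. if cmatch K c \<phi> then map (\<lambda>f. (fst f, map (cplace K c \<phi>) (snd f))) (snd (snd c)) else []) cs)"

definition revise_list :: "nat \<Rightarrow> velem atom list \<Rightarrow> velem atom list \<Rightarrow> (velem \<times> velem) list \<Rightarrow> (velem \<times> velem) list" where
  "revise_list K q p W = filter (\<lambda>be. \<forall>f\<in>set q. fst be \<in> set (snd f) \<longrightarrow> (\<exists>f'\<in>set p. fst f = fst f' \<and>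
     (\<forall>xy\<in>set (bzip K (snd f) (snd f')). (if isl (fst xy) then snd xy = fst xy else xy \<in> set W) \<and>
        (fst xy = fst be \<longrightarrow> snd xy = snd be)))) W"

definition pairs_list :: "velem atom list \<Rightarrow> velem atom list \<Rightarrow> (velem \<times> velem) list" where
  "pairs_list q p = concat (map (\<lambda>x. map (\<lambda>y. (x, y)) (concat (map snd p))) (concat (map snd q)))"

text \<open>The list of pairs also acts as the clock: only its length matters to the fold, and there
  cannot be more effective rounds than pairs.\<close>

definition stage_list :: "nat \<Rightarrow> velem atom list \<Rightarrow> velem atom list \<Rightarrow> (velem \<times> velem) list" where
  "stage_list K q p = foldr (\<lambda>_ W. revise_list K q p W) (pairs_list q p) (pairs_list q p)"

definition hom_test :: "nat \<Rightarrow> velem atom list \<Rightarrow> velem atom list \<Rightarrow> bool" where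
  "hom_test K q p \<longleftrightarrow> (\<forall>f\<in>set q. \<exists>f'\<in>set p. fst f = fst f' \<and>
     (\<forall>xy\<in>set (bzip K (snd f) (snd f')). if isl (fst xy) then snd xy = fst xy else xy \<in> set (stage_list K q p)))"

definition drop_redundant :: "nat \<Rightarrow> velem atom \<Rightarrow> velem atom list \<Rightarrow> velem atom list" where
  "drop_redundant K f q = (if hom_test K q (filter (\<lambda>g. g \<noteq> f) q) then filter (\<lambda>g. g \<noteq> f) q else q)"

definition core_list :: "nat \<Rightarrow> velem atom list \<Rightarrow> velem atom list" where
  "core_list K q = foldr (drop_redundant K) q q"

definition reps_list :: "velem atom list \<Rightarrow> velem \<Rightarrow> (velem \<times> velem lab) list" where
  "reps_list q x = (x, Full) # (if isl x then [(x, Fake)]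
     else map (\<lambda>r. (x, Excl r)) (filter (\<lambda>r. x \<in> set (snd r)) q))"

definition weaken_list :: "nat \<Rightarrow> velem atom list \<Rightarrow> velem atom \<Rightarrow> (velem \<times> velem lab) atom list" where
  "weaken_list K q f = concat (map (\<lambda>g. map (\<lambda>rs. (fst g, rs))
     (filter (allowed f g) (bprod K (map (reps_list q) (snd g))))) q)"

lemma ptime_number': "ptime f \<Longrightarrow> ptime (\<lambda>x. number (f x))"
  using ptime_comp ptime_number by blast

lemma ptime_Excl: "ptime f \<Longrightarrow> ptime (\<lambda>x. Excl (f x) :: 'b::encodable lab)"
  by (rule ptime_Node[OF ptime_const[of "Node Leaf Leaf"]]) (auto simp: encode_lab_def encode_tree_def)

lemmas [ptime_intros] = ptime_number' ptime_Excl ptime_const ptime_id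

lemma ptime_app3:
  assumes "ptime (\<lambda>z. F (fst z) (fst (snd z)) (snd (snd z)))" "ptime f" "ptime g" "ptime h"
  shows "ptime (\<lambda>x. F (f x) (g x) (h x))"
  using ptime_comp[OF ptime_Pair[OF assms(2) ptime_Pair[OF assms(3,4)]] assms(1)] by simp

lemma ptime_cmatch [ptime_intros]: "ptime f \<Longrightarrow> ptime g \<Longrightarrow> ptime (\<lambda>x. cmatch K (f x) (g x))"
  by (rule ptime_app2[where F = "cmatch K"]; (unfold cmatch_def)?; (intro ptime_intros)?; assumption?)

lemma ptime_cplace [ptime_intros]:
  "ptime f \<Longrightarrow> ptime g \<Longrightarrow> ptime h \<Longrightarrow> ptime (\<lambda>x. cplace K (f x) (g x) (h x))"
  by (rule ptime_app3[where F = "cplace K"]; (unfold cplace_def)?; (intro ptime_intros)?; assumption?)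

lemma ptime_chase_list [ptime_intros]:
  "ptime f \<Longrightarrow> ptime g \<Longrightarrow> ptime (\<lambda>x. chase_list K (f x) (g x))"
  by (rule ptime_app2[where F = "chase_list K"]; (unfold chase_list_def)?; (intro ptime_intros)?; assumption?)

lemma ptime_revise_list [ptime_intros]:
  "ptime f \<Longrightarrow> ptime g \<Longrightarrow> ptime h \<Longrightarrow> ptime (\<lambda>x. revise_list K (f x) (g x) (h x))"
  by (rule ptime_app3[where F = "revise_list K"]; (unfold revise_list_def)?; (intro ptime_intros)?; assumption?)

lemma ptime_pairs_list [ptime_intros]:
  "ptime f \<Longrightarrow> ptime g \<Longrightarrow> ptime (\<lambda>x. pairs_list (f x) (g x))"
  by (rule ptime_app2[where F = pairs_list]; (unfold pairs_list_def)?; (intro ptime_intros)?; assumption?)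

text \<open>Arc consistency and core computation only delete, so their accumulators never outgrow
  the initial value.\<close>

lemma ptime_foldr_shrinking:
  fixes L :: "'a::encodable \<Rightarrow> 'b::encodable list" and I :: "'a \<Rightarrow> 'c::encodable"
  assumes "ptime L" "ptime I" "ptime (\<lambda>z. G (fst z) (fst (snd z)) (snd (snd z)))"
    and shrink: "\<And>x a s. size_of (G x a s) \<le> size_of s"
  shows "ptime (\<lambda>x. foldr (G x) (L x) (I x))"
proof -
  obtain b where b: "\<And>x. size_of (I x) \<le> poly b (size_of x)" using ptime_size[OF assms(2)] by blast
  let ?G = "\<lambda>z. G (fst z) (fst (snd z)) (snd (snd z))"
  have "ptime (\<lambda>x. foldr (\<lambda>a s. ?G (x, a, s)) (L x) (I x))"
  proof (rule ptime_foldr[OF assms(1-3), where b = b])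
    fix x ys zs
    have "size_of (foldr (\<lambda>a s. ?G (x, a, s)) ys (I x)) \<le> size_of (I x)"
    proof (induction ys)
      case (Cons y ys)
      then show ?case using shrink[of x y "foldr (\<lambda>a s. ?G (x, a, s)) ys (I x)"] by simp
    qed simp
    then show "size_of (foldr (\<lambda>a s. ?G (x, a, s)) ys (I x)) \<le> poly b (size_of x)" using b[of x] by simp
  qed
  then show ?thesis by simp
qed

lemma ptime_stage_list [ptime_intros]:
  assumes "ptime f" "ptime g" shows "ptime (\<lambda>x. stage_list K (f x) (g x))"
proof (rule ptime_app2[OF _ assms, where F = "stage_list K"])
  show "ptime (\<lambda>z. stage_list K (fst z) (snd z))"
    unfolding stage_list_def
    by (rule ptime_foldr_shrinking)
      ((intro ptime_intros)+, simp add: revise_list_def size_filter)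
qed

lemma ptime_hom_test [ptime_intros]:
  "ptime f \<Longrightarrow> ptime g \<Longrightarrow> ptime (\<lambda>x. hom_test K (f x) (g x))"
  by (rule ptime_app2[where F = "hom_test K"]; (unfold hom_test_def)?; (intro ptime_intros)?; assumption?)

lemma ptime_drop_redundant [ptime_intros]:
  "ptime f \<Longrightarrow> ptime g \<Longrightarrow> ptime (\<lambda>x. drop_redundant K (f x) (g x))"
  by (rule ptime_app2[where F = "drop_redundant K"]; (unfold drop_redundant_def)?; (intro ptime_intros)?; assumption?)

lemma ptime_core_list [ptime_intros]:
  assumes "ptime f" shows "ptime (\<lambda>x. core_list K (f x))"
proof (rule ptime_comp[OF assms])
  show "ptime (core_list K)"
    unfolding core_list_def
    by (rule ptime_foldr_shrinking[where G = "\<lambda>_. drop_redundant K"])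
      ((intro ptime_intros)+, simp add: drop_redundant_def size_filter)
qed

lemma ptime_reps_list [ptime_intros]:
  "ptime f \<Longrightarrow> ptime g \<Longrightarrow> ptime (\<lambda>x. reps_list (f x) (g x))"
  by (rule ptime_app2[where F = reps_list]; (unfold reps_list_def)?; (intro ptime_intros)?; assumption?)

lemma ptime_allowed [ptime_intros]:
  fixes f :: "'a::encodable \<Rightarrow> 'b::encodable atom"
  shows "ptime f \<Longrightarrow> ptime g \<Longrightarrow> ptime h \<Longrightarrow> ptime (\<lambda>x. allowed (f x) (g x) (h x))"
  by (rule ptime_app3[where F = allowed]; (unfold allowed_def)?; (intro ptime_intros)?; assumption?)

lemma ptime_weaken_list [ptime_intros]:
  "ptime f \<Longrightarrow> ptime g \<Longrightarrow> ptime (\<lambda>x. weaken_list K (f x) (g x))"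
  by (rule ptime_app2[where F = "weaken_list K"]; (unfold weaken_list_def)?; (intro ptime_intros)?; assumption?)

definition positives :: "nat \<Rightarrow> fact list \<Rightarrow> ctup list \<Rightarrow> (listed_struct \<times> listed_struct) list" where
  "positives K pats cs = map (\<lambda>\<phi>. example (img (\<lambda>a. (Inl a, Full)) \<phi>)
     (map (img (\<lambda>e. (e, Full :: velem lab))) (core_list K (chase_list K cs \<phi>)))) pats"

definition negatives :: "nat \<Rightarrow> fact list \<Rightarrow> ctup list \<Rightarrow> (listed_struct \<times> listed_struct) list" where
  "negatives K pats cs = concat (map (\<lambda>\<phi>. map (\<lambda>f. example (img (\<lambda>a. (Inl a, Full)) \<phi>)
     (weaken_list K (core_list K (chase_list K cs \<phi>)) f)) (core_list K (chase_list K cs \<phi>))) pats)"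

text \<open>The list of patterns comes from the fixed source schema and is therefore a constant of
  the program.\<close>

lemma ptime_examples: "ptime (\<lambda>cs. (positives K pats cs, negatives K pats cs))"
  unfolding positives_def negatives_def example_def listed_def
  by (intro ptime_intros)

lemma map_exists_iff:
  assumes "length xs = length ys"
  shows "(\<exists>h. map h xs = ys) \<longleftrightarrow>
    (\<forall>p\<in>set (zip xs ys). \<forall>p'\<in>set (zip xs ys). fst p = fst p' \<longrightarrow> snd p = snd p')" (is "?L \<longleftrightarrow> ?R")
proof
  assume ?L
  then obtain h where "ys = map h xs" by blast
  then show ?R by (auto simp: in_set_zip)
next
  assume R: ?R
  have "map (\<lambda>x. SOME y. (x, y) \<in> set (zip xs ys)) xs = ys"
  proof (rule zip_map_eq[OF assms])
    fix x y assume xy: "(x, y) \<in> set (zip xs ys)"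
    then have "(x, SOME y. (x, y) \<in> set (zip xs ys)) \<in> set (zip xs ys)" by (rule someI)
    from bspec[OF bspec[OF R this] xy] show "(SOME y. (x, y) \<in> set (zip xs ys)) = y" by simp
  qed
  then show ?L by blast
qed

lemma isl_dist: "isl x \<longleftrightarrow> x \<in> dist"
  by (cases x) auto

section \<open>Correctness of the list versions for arities up to \<open>K\<close>\<close>

context
  fixes S T :: schema and K :: nat
  assumes disj: "dom S \<inter> dom T = {}"
    and S_le: "\<And>R n. S R = Some n \<Longrightarrow> n \<le> K" and T_le: "\<And>R n. T R = Some n \<Longrightarrow> n \<le> K"
begin

lemma cplace_tup:
  assumes "length (snd (lhs c)) \<le> K"
  shows "cplace K (tup c) \<phi> v = place c \<phi> v"
  using assms by (simp add: cplace_def place_def tup_def bzip_eq Let_def)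

lemma cmatch_tup:
  assumes "over_schema S (lhs c)" "arity_ok S \<phi>"
  shows "cmatch K (tup c) \<phi> \<longleftrightarrow> matches c \<phi>"
proof (cases "fst (lhs c) = fst \<phi>")
  case True
  then have len: "length (snd (lhs c)) = length (snd \<phi>)"
    using assms unfolding over_schema_def arity_ok_def by simp
  have "length (snd (lhs c)) \<le> K" using assms(1) S_le unfolding over_schema_def by blast
  then show ?thesis
    unfolding cmatch_def matches_def map_exists_iff[OF len] using True by (simp add: tup_def bzip_eq)
qed (simp add: cmatch_def matches_def tup_def)

lemma set_chase_list:
  assumes "lav_mapping S T (set cs)" "arity_ok S \<phi>"
  shows "set (chase_list K (map tup cs) \<phi>) = chase (set cs) \<phi>"
proof -
  have c: "over_schema S (lhs c)" if "c \<in> set cs" for c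
    using assms(1) that unfolding lav_mapping_def lav_constraint_def by blast
  have le: "length (snd (lhs c)) \<le> K" if "c \<in> set cs" for c
    using c[OF that] S_le unfolding over_schema_def by blast
  have pl: "cplace K (tup c) \<phi> = place c \<phi>" if "c \<in> set cs" for c
    using cplace_tup[OF le[OF that]] by blast
  have eq: "set (if cmatch K (tup c) \<phi> then map (\<lambda>f. (fst f, map (cplace K (tup c) \<phi>) (snd f))) (snd (snd (tup c))) else [])
      = {img (place c \<phi>) f |f. matches c \<phi> \<and> f \<in> set (rhs c)}" if "c \<in> set cs" for c
    unfolding cmatch_tup[OF c[OF that] assms(2)] pl[OF that]
    unfolding tup_def snd_conv
    by (cases "matches c \<phi>") (simp only: if_True set_map, blast, simp)
  have "set (chase_list K (map tup cs) \<phi>) = (\<Union>c\<in>set cs. {img (place c \<phi>) f |f. matches c \<phi> \<and> f \<in> set (rhs c)})"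
    unfolding chase_list_def set_concat set_map image_image using eq by simp
  also have "\<dots> = chase (set cs) \<phi>" unfolding chase_def by blast
  finally show ?thesis .
qed

abbreviation arities_ok :: "'b atom list \<Rightarrow> bool" where
  "arities_ok q \<equiv> \<forall>f\<in>set q. arity_ok T f"

lemma same_length:
  assumes "arity_ok T f" "arity_ok T g" "fst f = fst g"
  shows "length (snd f) = length (snd g)" "bzip K (snd f) (snd g) = zip (snd f) (snd g)"
  using assms T_le by (auto simp: arity_ok_def intro!: bzip_eq)

lemma set_revise_list:
  assumes "arities_ok q" "arities_ok p"
  shows "set (revise_list K q p W) = revise dist (set q) (set p) (set W)"
proof -
  have "(fst f = fst f' \<and> (\<forall>xy\<in>set (bzip K (snd f) (snd f')).
      (if isl (fst xy) then snd xy = fst xy else xy \<in> set W) \<and> (fst xy = fst be \<longrightarrow> snd xy = snd be)))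
    \<longleftrightarrow> supports dist (set W) be f f'" if "f \<in> set q" "f' \<in> set p" for be f f'
  proof (cases "fst f = fst f'")
    case True
    have "arity_ok T f" "arity_ok T f'" using assms that by auto
    note sl = same_length[OF this True]
    show ?thesis unfolding supports_def sl(2) isl_dist using True sl(1)
      by (simp add: case_prod_unfold)
  qed (simp add: supports_def)
  then show ?thesis unfolding revise_list_def revise_def by auto
qed

lemma set_stage_list:
  assumes "arities_ok q" "arities_ok p"
  shows "set (stage_list K q p) = stage dist (set q) (set p) (length (pairs_list q p))"
    and "card (elems (set q) \<times> elems (set p)) \<le> length (pairs_list q p)"
proof -
  have s: "set (pairs_list q p) = elems (set q) \<times> elems (set p)"
    unfolding pairs_list_def elems_def by auto
  then show "card (elems (set q) \<times> elems (set p)) \<le> length (pairs_list q p)" by (metis card_length)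
  have "set (foldr (\<lambda>_ W. revise_list K q p W) l (pairs_list q p)) = stage dist (set q) (set p) (length l)" for l :: "(velem \<times> velem) list"
    by (induction l) (simp_all add: stage_def s set_revise_list[OF assms])
  then show "set (stage_list K q p) = stage dist (set q) (set p) (length (pairs_list q p))"
    unfolding stage_list_def .
qed

lemma hom_test_iff:
  assumes "arities_ok q" "arities_ok p" "forest dist (set q)"
  shows "hom_test K q p \<longleftrightarrow> maps_over dist (set q) (set p)"
proof -
  let ?W = "stage dist (set q) (set p) (length (pairs_list q p))"
  have "maps_over dist (set q) (set p) \<longleftrightarrow> (\<forall>f\<in>set q. \<exists>f'\<in>set p. fst f = fst f' \<and> length (snd f) = length (snd f') \<and>
     (\<forall>(x, y)\<in>set (zip (snd f) (snd f')). if x \<in> dist then y = x else (x, y) \<in> ?W))"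
  proof (rule arc_consistency_decides[OF _ assms(3)])
    show "?W = revise dist (set q) (set p) ?W"
      using stage_stable[OF _ _ set_stage_list(2)[OF assms(1,2)]] by simp
  qed (use hom_in_stage in \<open>blast | simp\<close>)+
  also have "\<dots> \<longleftrightarrow> hom_test K q p"
    unfolding hom_test_def
  proof (intro ball_cong bex_cong refl)
    fix f f' assume ff: "f \<in> set q" "f' \<in> set p"
    show "(fst f = fst f' \<and> length (snd f) = length (snd f') \<and>
       (\<forall>(x, y)\<in>set (zip (snd f) (snd f')). if x \<in> dist then y = x else (x, y) \<in> ?W)) =
      (fst f = fst f' \<and> (\<forall>xy\<in>set (bzip K (snd f) (snd f')). if isl (fst xy) then snd xy = fst xy else xy \<in> set (stage_list K q p)))"
    proof (cases "fst f = fst f'")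
      case True
      have "arity_ok T f" "arity_ok T f'" using assms ff by auto
      note sl = same_length[OF this True]
      show ?thesis unfolding sl(2) isl_dist set_stage_list(1)[OF assms(1,2)] using True sl(1)
        by (simp add: case_prod_unfold)
    qed simp
  qed
  finally show ?thesis by blast
qed

text \<open>One greedy pass is enough. If a fact that resisted deletion became deletable after a
  later one, composing the two homomorphisms would show that it was deletable before.\<close>

lemma core_list_props:
  assumes "arities_ok q" "forest dist (set q)"
  shows "set (core_list K q) \<subseteq> set q" "maps_over dist (set q) (set (core_list K q))" "rigid dist (set (core_list K q))"
proof -
  have inv: "set (foldr (drop_redundant K) ys q) \<subseteq> set q \<and> maps_over dist (set q) (set (foldr (drop_redundant K) ys q)) \<and>
    (\<forall>f\<in>set ys \<inter> set (foldr (drop_redundant K) ys q).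
       \<not> maps_over dist (set (foldr (drop_redundant K) ys q)) (set (foldr (drop_redundant K) ys q) - {f}))" for ys
  proof (induction ys)
    case Nil show ?case using maps_over_mono by auto
  next
    case (Cons y ys)
    let ?c = "foldr (drop_redundant K) ys q"
    let ?d = "filter (\<lambda>g. g \<noteq> y) ?c"
    have sub: "set ?c \<subseteq> set q" and to: "maps_over dist (set q) (set ?c)" using Cons by auto
    have d: "set ?d = set ?c - {y}" by auto
    have test: "hom_test K ?c ?d \<longleftrightarrow> maps_over dist (set ?c) (set ?c - {y})"
      unfolding d[symmetric]
      by (rule hom_test_iff) (use assms sub forest_subset[OF assms(2) sub] in auto)
    show ?case
    proof (cases "hom_test K ?c ?d")
      case True
      then have eq: "foldr (drop_redundant K) (y # ys) q = ?d" by (simp add: drop_redundant_def)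
      have cd: "maps_over dist (set ?c) (set ?c - {y})" using True test by blast
      have "\<not> maps_over dist (set ?c - {y}) (set ?c - {y} - {f})" if f: "f \<in> set ys" "f \<in> set ?c - {y}" for f
      proof
        assume "maps_over dist (set ?c - {y}) (set ?c - {y} - {f})"
        then have "maps_over dist (set ?c) (set ?c - {f})"
          using maps_over_trans[OF cd] maps_over_trans[OF _ maps_over_mono[of "set ?c - {y} - {f}" "set ?c - {f}"]] by blast
        then show False using Cons f by blast
      qed
      then show ?thesis unfolding eq d using sub maps_over_trans[OF to cd] by auto
    next
      case False
      then have eq: "foldr (drop_redundant K) (y # ys) q = ?c" by (simp add: drop_redundant_def)
      show ?thesis unfolding eq using Cons False test by auto
    qed
  qed
  show "set (core_list K q) \<subseteq> set q" "maps_over dist (set q) (set (core_list K q))"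
    using inv[of q] unfolding core_list_def by auto
  show "rigid dist (set (core_list K q))"
    using inv[of q] unfolding core_list_def rigid_def by auto
qed

lemma set_reps_list: "set (reps_list q x) = reps dist (set q) x"
  unfolding reps_list_def reps_def isl_dist by auto

lemma set_weaken_list:
  assumes "arities_ok q"
  shows "set (weaken_list K q f) = weaken dist (set q) f"
proof -
  have prod: "set (bprod K (map (reps_list q) (snd g))) = {rs. map fst rs = snd g \<and> (\<forall>r\<in>set rs. r \<in> reps dist (set q) (fst r))}"
    if g: "g \<in> set q" for g
  proof -
    have "length (snd g) \<le> K" using assms g T_le unfolding arity_ok_def by blast
    then have "set (bprod K (map (reps_list q) (snd g))) = {rs. list_all2 (\<lambda>r x. r \<in> reps dist (set q) x) rs (snd g)}"
      using set_bprod[of "map (reps_list q) (snd g)" K] by (simp add: list_all2_map2 set_reps_list)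
    moreover have "list_all2 (\<lambda>r x. r \<in> reps dist (set q) x) rs xs \<longleftrightarrow>
        map fst rs = xs \<and> (\<forall>r\<in>set rs. r \<in> reps dist (set q) (fst r))" for rs xs
    proof -
      have fst_reps: "r \<in> reps dist (set q) x \<Longrightarrow> fst r = x" for r x
        unfolding reps_def by (auto split: if_splits)
      show ?thesis
      proof (induction rs arbitrary: xs)
        case (Cons r rs)
        then show ?case by (cases xs) (auto dest: fst_reps)
      qed auto
    qed
    ultimately show ?thesis by simp
  qed
  have "set (weaken_list K q f) = (\<Union>g\<in>set q. (\<lambda>rs. (fst g, rs)) ` {rs \<in> set (bprod K (map (reps_list q) (snd g))). allowed f g rs})"
    unfolding weaken_list_def by simp
  also have "\<dots> = (\<Union>g\<in>set q. {(fst g, rs) |rs. map fst rs = snd g \<and> (\<forall>r\<in>set rs. r \<in> reps dist (set q) (fst r)) \<and> allowed f g rs})"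
    by (rule SUP_cong[OF refl]) (unfold prod, blast)
  also have "\<dots> = weaken dist (set q) f" unfolding weaken_def by blast
  finally show ?thesis .
qed

lemma examples_characterize:
  assumes M: "lav_mapping S T (set cs)" and acyc: "c_acyclic_mapping (set cs)" and pats: "set pats = patterns S"
  shows "uniquely_characterizes S T (examples_of (positives K pats (map tup cs)))
    (examples_of (negatives K pats (map tup cs))) (set cs)"
proof -
  let ?q = "\<lambda>\<phi>. chase_list K (map tup cs) \<phi>"
  let ?c = "\<lambda>\<phi>. core_list K (?q \<phi>)"
  have fo: "forest (univars c) (set (rhs c))" if "c \<in> set cs" for c
    using c_acyclic_forest[of "canonical_structure c" "distinguished c"] acyc that
    unfolding c_acyclic_mapping_def by (simp add: canonical_structure_def distinguished_def)
  have q: "set (?q \<phi>) = chase (set cs) \<phi>" "arities_ok (?q \<phi>)" "forest dist (set (?q \<phi>))" if "\<phi> \<in> patterns S" for \<phi>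
  proof -
    show 1: "set (?q \<phi>) = chase (set cs) \<phi>"
      using set_chase_list[OF M] that unfolding patterns_def by blast
    show "arities_ok (?q \<phi>)" unfolding 1 using arity_ok_chase[OF disj M] by blast
    show "forest dist (set (?q \<phi>))" unfolding 1 by (rule forest_chase) (rule fo)
  qed
  show ?thesis
    unfolding positives_def negatives_def
  proof (rule uniquely_characterizes_by_cores[OF disj M pats])
    fix \<phi> assume phi: "\<phi> \<in> patterns S"
    note c = core_list_props[OF q(2,3)[OF phi]]
    show "set (?c \<phi>) \<subseteq> chase (set cs) \<phi> \<and> maps_over dist (chase (set cs) \<phi>) (set (?c \<phi>)) \<and>
        forest dist (set (?c \<phi>)) \<and> rigid dist (set (?c \<phi>))"
      using c forest_subset[OF q(3)[OF phi] c(1)] unfolding q(1)[OF phi] by blast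
    show "set (weaken_list K (?c \<phi>) f) = weaken dist (set (?c \<phi>)) f" for f
      by (rule set_weaken_list) (use c(1) q(2)[OF phi] in blast)
  qed
qed

end

text \<open>The tuples have exactly the prescribed encoding of the constraints, so a program for
  tuples runs on \<open>enc_mapping\<close> unchanged.\<close>

lemma encode_tups: "encode (map tup cs) = enc_mapping cs"
  by (induction cs)
    (simp_all add: enc_mapping_def encode_list_def encode_prod_def tup_def enc_lav_def enc_fact_def encode_nat_def[abs_def])

lemma enc_examples_eq: "enc_examples es = encode es"
  by (simp add: enc_examples_def Let_def encode_list_def[abs_def] encode_prod_def[abs_def] enc_fact_def encode_nat_def[abs_def])

lemma finite_patterns:
  assumes "finite (dom S)"
  shows "finite (patterns S)"
proof -
  have "patterns S \<subseteq> (\<Union>R\<in>dom S. Pair R ` {xs. set xs \<subseteq> {..<the (S R)} \<and> length xs = the (S R)})"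
    unfolding patterns_def arity_ok_def by force
  moreover have "finite (\<Union>R\<in>dom S. Pair R ` {xs :: nat list. set xs \<subseteq> {..<the (S R)} \<and> length xs = the (S R)})"
    using assms finite_lists_length_eq by auto
  ultimately show ?thesis by (rule finite_subset)
qed

lemma arity_bound:
  assumes "finite (dom S)"
  shows "\<exists>K. \<forall>R n. S R = Some n \<longrightarrow> n \<le> (K :: nat)"
proof -
  have "finite ((\<lambda>R. the (S R)) ` dom S)" using assms by simp
  then obtain K where K: "\<forall>n\<in>(\<lambda>R. the (S R)) ` dom S. n \<le> K" using finite_nat_set_iff_bounded_le by blast
  have "n \<le> K" if "S R = Some n" for R n using K that by force
  then show ?thesis by blast
qed

theorem polytime_characterization:
  assumes fin: "finite (dom S)" "finite (dom T)" and disj: "dom S \<inter> dom T = {}"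
  shows "\<exists>(P :: program) (p :: nat poly). \<forall>cs :: lav list.
        lav_mapping S T (set cs) \<and> c_acyclic_mapping (set cs) \<longrightarrow>
        (\<exists>ps ns t.
           runs P (enc_mapping cs) (Node (enc_examples ps) (enc_examples ns)) t \<and>
           t \<le> poly p (tsize (enc_mapping cs)) \<and>
           uniquely_characterizes S T (examples_of ps) (examples_of ns) (set cs))"
proof -
  obtain K1 K2 where K: "\<forall>R n. S R = Some n \<longrightarrow> n \<le> K1" "\<forall>R n. T R = Some n \<longrightarrow> n \<le> K2"
    using arity_bound[OF fin(1)] arity_bound[OF fin(2)] by blast
  define K where "K = max K1 K2"
  have KS: "S R = Some n \<Longrightarrow> n \<le> K" and KT: "T R = Some n \<Longrightarrow> n \<le> K" for R n
    using K unfolding K_def by (auto simp: le_max_iff_disj)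
  obtain pats where pats: "set pats = patterns S" using finite_list[OF finite_patterns[OF fin(1)]] by blast
  let ?F = "\<lambda>cs. (positives K pats cs, negatives K pats cs)"
  obtain P e p where P: "computes P e p ?F" using ptime_examples unfolding ptime_def by blast
  \<comment> \<open>Execution starts with function 0, so the expression goes first and all calls
    move up by one.\<close>
  let ?P = "[shift 1 e] @ map (shift 1) P"
  have "\<exists>t. runs ?P (encode cs) (encode (?F cs)) t \<and> t \<le> poly (p + [:1, 1:]) (size_of cs)" for cs
  proof -
    obtain t where t: "eval P (encode cs) e (encode (?F cs)) t" "t \<le> poly p (size_of cs)"
      by (rule computesD[OF P]) (rule that)
    have "eval ?P (encode cs) (shift 1 e) (encode (?F cs)) t"
      using eval_shift[OF t(1), of "[shift 1 e]"] by simp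
    then have *: "eval ?P (encode cs) (ECall 0 Arg) (encode (?F cs)) (Suc (size_of cs + t))"
      by (intro eval_call'[OF _ _ eval_arg]) auto
    show ?thesis unfolding runs_def by (rule eval_le[OF *]) (use t(2) in simp_all)
  qed
  note run = this
  show ?thesis
  proof (intro exI[of _ ?P] exI[of _ "p + [:1, 1:]"] allI impI)
    fix cs assume cs: "lav_mapping S T (set cs) \<and> c_acyclic_mapping (set cs)"
    let ?ps = "positives K pats (map tup cs)" and ?ns = "negatives K pats (map tup cs)"
    obtain t where "runs ?P (encode (map tup cs)) (encode (?ps, ?ns)) t" "t \<le> poly (p + [:1, 1:]) (size_of (map tup cs))"
      using run by blast
    moreover have "uniquely_characterizes S T (examples_of ?ps) (examples_of ?ns) (set cs)"
      by (rule examples_characterize[OF disj _ _ _ _ pats]) (use cs KS KT in blast)+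
    ultimately show "\<exists>ps ns t. runs ?P (enc_mapping cs) (Node (enc_examples ps) (enc_examples ns)) t \<and>
        t \<le> poly (p + [:1, 1:]) (tsize (enc_mapping cs)) \<and>
        uniquely_characterizes S T (examples_of ps) (examples_of ns) (set cs)"
      unfolding encode_tups enc_examples_eq encode_pair by blast
  qed
qed

section \<open>Characterizable mappings are c-acyclic\<close>

definition constraint :: "fact \<Rightarrow> fact list \<Rightarrow> lav" where
  "constraint l R = \<lparr>lhs = l, exvars = sorted_list_of_set (elems (set R) - set (snd l)), rhs = R\<rparr>"

lemma constraint_sel [simp]: "lhs (constraint l R) = l" "rhs (constraint l R) = R"
  by (simp_all add: constraint_def)

lemma lav_constraint_constraint:
  assumes "over_schema S l" "\<forall>f\<in>set R. over_schema T f"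
  shows "lav_constraint S T (constraint l R)"
proof -
  have "finite (elems (set R) - set (snd l))" by (simp add: finite_elems)
  then show ?thesis using assms
    unfolding lav_constraint_def constraint_def by (auto simp: elems_def)
qed

text \<open>Variable \<open>v\<close> of copy \<open>s\<close> is \<open>ren c s v\<close>; the offset keeps it apart from the shared
  universally quantified variables.\<close>

definition offset :: "lav \<Rightarrow> nat" where "offset c = Suc (sum_list (snd (lhs c)))"

definition ren :: "lav \<Rightarrow> nat \<Rightarrow> nat \<Rightarrow> nat" where
  "ren c s v = (if v \<in> univars c then v else offset c + prod_encode (v, s))"

definition unren :: "lav \<Rightarrow> nat \<Rightarrow> nat" where
  "unren c y = (if y \<in> univars c then y else fst (prod_decode (y - offset c)))"

definition twisted :: "lav \<Rightarrow> fact \<Rightarrow> nat \<Rightarrow> nat \<Rightarrow> nat \<Rightarrow> fact" where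
  "twisted c f i s t = (fst f, (map (ren c s) (snd f))[i := ren c t (snd f ! i)])"

text \<open>All pairs \<open>s < t\<close> are included because the pigeonhole principle does not
  tell which two copies will agree. No untwisted copy of \<open>f\<close> remains.\<close>

definition twist :: "lav \<Rightarrow> fact \<Rightarrow> nat \<Rightarrow> nat \<Rightarrow> lav" where
  "twist c f i N = constraint (lhs c)
     (concat (map (\<lambda>s. map (img (ren c s)) (filter (\<lambda>g. g \<noteq> f) (rhs c))) [0..<N]) @
      concat (map (\<lambda>t. map (\<lambda>s. twisted c f i s t) [0..<t]) [0..<N]))"

lemma lhs_twist [simp]: "lhs (twist c f i N) = lhs c"
  by (simp add: twist_def)

lemma rhs_twist:
  "set (rhs (twist c f i N)) = {img (ren c s) g |s g. s < N \<and> g \<in> set (rhs c) \<and> g \<noteq> f} \<union>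
     {twisted c f i s t |s t. s < t \<and> t < N}"
proof -
  have "set (rhs (twist c f i N)) = (\<Union>s\<in>{..<N}. img (ren c s) ` {g\<in>set (rhs c). g \<noteq> f}) \<union>
     (\<Union>t\<in>{..<N}. (\<lambda>s. twisted c f i s t) ` {..<t})"
    by (simp add: twist_def atLeast0LessThan lessThan_atLeast0[symmetric])
  also have "\<dots> = {img (ren c s) g |s g. s < N \<and> g \<in> set (rhs c) \<and> g \<noteq> f} \<union>
     {twisted c f i s t |s t. s < t \<and> t < N}"
    unfolding image_def by blast
  finally show ?thesis .
qed

lemma offset_notin: "offset c + k \<notin> univars c"
proof
  assume "offset c + k \<in> univars c"
  then have "offset c + k \<le> sum_list (snd (lhs c))" by (intro member_le_sum_list) simp_all
  then show False unfolding offset_def by simp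
qed

lemma unren_ren [simp]: "unren c (ren c s v) = v"
  unfolding unren_def ren_def using offset_notin by simp

lemma map_twisted:
  assumes "i < length (snd f)"
  shows "map k (snd (twisted c f i s t)) = (map (\<lambda>v. k (ren c s v)) (snd f))[i := k (ren c t (snd f ! i))]"
  unfolding twisted_def snd_conv map_update by (simp add: comp_def)

text \<open>Collapsing all copies onto one turns every twisted fact back into \<open>f\<close>, so
  the twist is a consequence of \<open>c\<close>.\<close>

lemma fires_twist:
  assumes "fires c \<psi> J" "f \<in> set (rhs c)" "i < length (snd f)"
  shows "fires (twist c f i N) \<psi> J"
  unfolding fires_def
proof (intro allI impI)
  fix h assume "img h (lhs (twist c f i N)) = \<psi>"
  then obtain g where g: "\<forall>x\<in>univars c. g x = h x" "\<forall>f\<in>set (rhs c). img g f \<in> J"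
    using assms(1) unfolding fires_def lhs_twist by blast
  let ?g = "\<lambda>y. g (unren c y)"
  have J: "img ?g F \<in> J" if F: "F \<in> set (rhs (twist c f i N))" for F
  proof -
    consider s G where "F = img (ren c s) G" "G \<in> set (rhs c)" | s t where "F = twisted c f i s t"
      using F unfolding rhs_twist by blast
    then show ?thesis
    proof cases
      case 1
      have "img ?g F = img g G" unfolding 1(1) by simp
      then show ?thesis using bspec[OF g(2) 1(2)] by simp
    next
      case 2
      have "map ?g (snd F) = map g (snd f)"
        unfolding 2 map_twisted[OF assms(3)] by (simp add: list_update_same_conv assms(3))
      moreover have "fst F = fst f" unfolding 2 twisted_def by simp
      ultimately show ?thesis using bspec[OF g(2) assms(2)] by simp
    qed
  qed
  show "\<exists>g. (\<forall>x\<in>set (snd (lhs (twist c f i N))). g x = h x) \<and>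
      (\<forall>f\<in>set (rhs (twist c f i N)). img g f \<in> J)"
  proof (intro exI[of _ ?g] conjI ballI)
    show "?g x = h x" if "x \<in> set (snd (lhs (twist c f i N)))" for x
      using that g(1) by (simp add: unren_def)
  qed (rule J)
qed

text \<open>Two of the many copies are mapped in the same way; closing up the twist between them
  gives a match of the original right-hand side.\<close>

lemma fires_if_twist_fires:
  fixes J :: "fact set"
  assumes fr: "fires (twist c f i N) \<psi> J" and f: "f \<in> set (rhs c)" "i < length (snd f)"
    and U: "finite U" "elems J \<subseteq> U" and N: "card (insert 0 U) ^ card (elems (set (rhs c))) < N"
  shows "fires c \<psi> J"
  unfolding fires_def
proof (intro allI impI)
  fix h assume "img h (lhs c) = \<psi>"
  then obtain G where G: "\<forall>x\<in>univars c. G x = h x" "\<forall>f\<in>set (rhs (twist c f i N)). img G f \<in> J"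
    using fr unfolding fires_def lhs_twist by blast
  let ?A = "univars c" and ?V = "elems (set (rhs c))" and ?U = "insert 0 U"
  \<comment> \<open>\<open>G\<close> may take values outside \<open>U\<close> on variables that no
    fact constrains. Sending these to 0 leaves only finitely many vectors.\<close>
  define adj where "adj s v = (if G (ren c s v) \<in> ?U then G (ren c s v) else 0)" for s v
  define vec where "vec s = restrict (adj s) ?V" for s
  have "vec s \<in> ?V \<rightarrow>\<^sub>E ?U" for s unfolding vec_def adj_def by auto
  then have "vec ` {..<N} \<subseteq> ?V \<rightarrow>\<^sub>E ?U" by (rule image_subsetI)
  moreover have "finite (?V \<rightarrow>\<^sub>E ?U)" using U(1) by (intro finite_PiE) (auto simp: finite_elems)
  ultimately have "card (vec ` {..<N}) \<le> card (?V \<rightarrow>\<^sub>E ?U)" by (rule card_mono[rotated])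
  also have "\<dots> = card ?U ^ card ?V" by (simp add: card_PiE finite_elems)
  also have "\<dots> < card {..<N}" using N by simp
  finally have "\<not> inj_on vec {..<N}" by (rule pigeonhole)
  then obtain a b where "a < N" "b < N" "a \<noteq> b" "vec a = vec b" unfolding inj_on_def by blast
  then obtain s t where st: "s < t" "t < N" "vec s = vec t" by (metis linorder_neqE_nat)
  have adj_eq: "adj s v = adj t v" if "v \<in> ?V" for v
    using fun_cong[OF st(3), of v] that unfolding vec_def by simp
  define k where "k v = (if v \<in> ?A then h v else adj s v)" for v
  have k_eq: "k v = G (ren c r v)" if "G (ren c r v) \<in> U" "v \<in> ?V" "r = s \<or> r = t" for r v
  proof (cases "v \<in> ?A")
    case True then show ?thesis using G(1) unfolding k_def ren_def by simp
  next
    case False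
    then have "k v = adj r v" using adj_eq that unfolding k_def by auto
    then show ?thesis using that(1) unfolding adj_def by simp
  qed
  have el: "x \<in> U" if "img G F \<in> J" "x \<in> set (map G (snd F))" for F x
    using that U(2) unfolding elems_def by force
  have J: "img k g \<in> J" if g: "g \<in> set (rhs c)" for g
  proof (cases "g = f")
    case False
    have "img (ren c s) g \<in> set (rhs (twist c f i N))" 
      unfolding rhs_twist using g False st by (intro UnI1 CollectI exI[of _ s] exI[of _ g]) simp
    then have gJ: "img G (img (ren c s) g) \<in> J" using G(2) by blast
    have "k v = G (ren c s v)" if "v \<in> set (snd g)" for v
      by (rule k_eq) (use el[OF gJ] that g in \<open>auto simp: elems_def\<close>)
    then have eq: "map k (snd g) = map G (map (ren c s) (snd g))" by simp
    show ?thesis unfolding eq using gJ by simp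
  next
    case True
    have "twisted c f i s t \<in> set (rhs (twist c f i N))" using st unfolding rhs_twist by blast
    then have fJ: "img G (twisted c f i s t) \<in> J" using G(2) by blast
    have eq: "map k (snd f) = map G (snd (twisted c f i s t))"
    proof (rule nth_equalityI)
      show len: "length (map k (snd f)) = length (map G (snd (twisted c f i s t)))" by (simp add: twisted_def)
      fix p assume p: "p < length (map k (snd f))"
      let ?r = "if p = i then t else s"
      have nth: "map G (snd (twisted c f i s t)) ! p = G (ren c ?r (snd f ! p))"
        using p f(2) unfolding map_twisted[OF f(2)] by (simp add: nth_list_update)
      have "G (ren c ?r (snd f ! p)) \<in> U"
        unfolding nth[symmetric] by (rule el[OF fJ]) (use p len in \<open>simp only: nth_mem\<close>)
      moreover have "snd f ! p \<in> ?V" unfolding elems_def by (rule UN_I[OF f(1)]) (use p in simp)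
      ultimately have "k (snd f ! p) = G (ren c ?r (snd f ! p))" by (intro k_eq) auto
      then show "map k (snd f) ! p = map G (snd (twisted c f i s t)) ! p" using nth p by simp
    qed
    have "fst f = fst (twisted c f i s t)" by (simp add: twisted_def)
    then show ?thesis unfolding True eq using fJ by simp
  qed
  show "\<exists>g. (\<forall>x\<in>?A. g x = h x) \<and> (\<forall>f\<in>set (rhs c). img g f \<in> J)"
    by (intro exI[of _ k] conjI ballI J) (simp_all add: k_def)
qed

text \<open>The value is constant along all edges except the first, so going round the cycle forces
  it to agree at the two ends of the first edge as well.\<close>

lemma incidence_cycle_potential:
  assumes cyc: "incidence_cycle A vs es"
    and pot: "\<And>G p. (G, p) \<in> incidence_edges A \<Longrightarrow> Elem (snd G ! p) \<in> set vs \<Longrightarrow>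
      lv (snd G ! p) = Lv G \<longleftrightarrow> (G, p) \<noteq> es ! 0"
  shows False
proof -
  let ?n = "length es"
  define w where "w x = (case x of Elem u \<Rightarrow> lv u | Fact G \<Rightarrow> Lv G)" for x
  have n: "0 < ?n" "length vs = ?n" using cyc unfolding incidence_cycle_def by auto
  have step: "w (vs ! k) = w (vs ! (Suc k mod ?n)) \<longleftrightarrow> k \<noteq> 0" if k: "k < ?n" for k
  proof -
    obtain G p where e: "es ! k = (G, p)" by (cases "es ! k")
    have in_e: "(G, p) \<in> incidence_edges A" using cyc k e unfolding incidence_cycle_def by (metis nth_mem subsetD)
    have ends: "{Elem (snd G ! p), Fact G} = {vs ! k, vs ! (Suc k mod ?n)}"
      using cyc k e unfolding incidence_cycle_def ends_def by fastforce
    have "vs ! k \<in> set vs" "vs ! (Suc k mod ?n) \<in> set vs" using k n by auto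
    then have "Elem (snd G ! p) \<in> set vs" using ends by (auto simp: doubleton_eq_iff)
    then have "lv (snd G ! p) = Lv G \<longleftrightarrow> k \<noteq> 0"
      using pot[OF in_e] cyc k n(1) e unfolding incidence_cycle_def by (metis nth_eq_iff_index_eq)
    moreover have "(vs ! k = Elem (snd G ! p) \<and> vs ! (Suc k mod ?n) = Fact G) \<or>
        (vs ! k = Fact G \<and> vs ! (Suc k mod ?n) = Elem (snd G ! p))"
      using ends unfolding doubleton_eq_iff by metis
    ultimately show ?thesis
      unfolding w_def by (elim disjE conjE) (simp_all only: inode.case eq_commute[of "Lv G"])
  qed
  have const: "w (vs ! (Suc k mod ?n)) = w (vs ! (1 mod ?n))" if "k < ?n" for k
    using that
  proof (induction k)
    case (Suc k)
    then show ?case using step[of "Suc k"] by simp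
  qed simp
  have "w (vs ! 0) = w (vs ! (1 mod ?n))" using const[of "?n - 1"] n by simp
  then show False using step[of 0] n by simp
qed

section \<open>Minimal equivalent mappings and redundant facts\<close>

definition weight :: "lav set \<Rightarrow> nat" where "weight M = (\<Sum>c\<in>M. card (set (rhs c)))"

lemma weight_replace:
  assumes "finite M" "c \<in> M" "card (set (rhs d)) < card (set (rhs c))"
  shows "weight (insert d (M - {c})) < weight M"
proof -
  have "weight (insert d (M - {c})) \<le> card (set (rhs d)) + weight (M - {c})"
    unfolding weight_def using assms(1) by (simp add: sum.insert_if)
  also have "\<dots> < card (set (rhs c)) + weight (M - {c})" using assms(3) by simp
  also have "\<dots> = weight M" unfolding weight_def using assms(1,2) by (simp add: sum.remove)
  finally show ?thesis .
qed

lemma place_lhs: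
  assumes "lhs d = lhs c"
  shows "place d (lhs c) v = (if v \<in> univars c then Inl v else Inr (tup d, v))"
  using place_eq[of id d "lhs c" v] assms by simp

lemma matches_lhs: "lhs d = lhs c \<Longrightarrow> matches d (lhs c)"
  unfolding matches_def by (auto intro: exI[of _ id])

lemma chase_elem_tag:
  assumes "f \<in> chase M \<phi>" "Inr (d, v) \<in> set (snd f)"
  shows "\<exists>c\<in>M. d = tup c"
proof -
  obtain c g where c: "c \<in> M" "matches c \<phi>" "f = img (place c \<phi>) g"
    using assms(1) unfolding chase_def by blast
  then obtain w where "place c \<phi> w = Inr (d, v)" using assms(2) by auto
  then show ?thesis using iffD1[OF place_Inr[OF c(2)]] c(1) by blast
qed

context
  fixes S T :: schema
  assumes disj: "dom S \<inter> dom T = {}"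
begin

text \<open>\<open>\<theta>\<close> folds the right-hand side of \<open>c\<close> into the facts
  \<open>R\<close> and the facts that the other constraints produce from the same source fact.
  Witnesses for those, composed with \<open>\<theta>\<close>, are witnesses for
  \<open>c\<close>.\<close>

lemma equivalent_subconstraint:
  assumes M: "lav_mapping S T M" and c: "c \<in> M" and R: "set R \<subseteq> set (rhs c)"
    and th: "\<forall>x\<in>univars c. \<theta> x = Inl x"
      "\<forall>g\<in>set (rhs c). img \<theta> g \<in> img (place c (lhs c)) ` set R \<union> chase (M - {c}) (lhs c)"
  defines "N \<equiv> insert (constraint (lhs c) R) (M - {c})"
  shows "lav_mapping S T N" "logically_equivalent S T M N"
proof -
  let ?d = "constraint (lhs c) R" and ?A = "univars c"
  have "lav_constraint S T ?d"
    by (rule lav_constraint_constraint) (use M c R in \<open>auto simp: lav_mapping_def lav_constraint_def\<close>)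
  then show N: "lav_mapping S T N" using M unfolding lav_mapping_def N_def by auto
  have swap: "(\<forall>e\<in>M. fires e \<psi> J) \<longleftrightarrow> (\<forall>e\<in>N. fires e \<psi> J)" for \<psi> and J :: "fact set"
  proof
    assume all: "\<forall>e\<in>M. fires e \<psi> J"
    have "fires ?d \<psi> J"
      unfolding fires_def constraint_sel
    proof (intro allI impI)
      fix h assume "img h (lhs c) = \<psi>"
      then obtain g where "\<forall>x\<in>?A. g x = h x" "\<forall>f\<in>set (rhs c). img g f \<in> J"
        using bspec[OF all c] unfolding fires_def by blast
      then show "\<exists>g. (\<forall>x\<in>?A. g x = h x) \<and> (\<forall>f\<in>set R. img g f \<in> J)"
        using R by (intro exI[of _ g] conjI ballI) auto
    qed
    then show "\<forall>e\<in>N. fires e \<psi> J" using all unfolding N_def by blast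
  next
    assume all: "\<forall>e\<in>N. fires e \<psi> J"
    have "fires c \<psi> J"
      unfolding fires_def
    proof (intro allI impI)
      fix h assume h: "img h (lhs c) = \<psi>"
      have "\<forall>e\<in>M - {c}. fires e (img h (lhs c)) J" using all unfolding N_def h by blast
      then obtain k1 where k1: "\<forall>a. k1 (Inl a) = h a" "\<forall>f\<in>chase (M - {c}) (lhs c). img k1 f \<in> J"
        using chase_hom_if_fires by blast
      have "fires ?d \<psi> J" using all unfolding N_def by blast
      then obtain g1 where g1: "\<forall>x\<in>?A. g1 x = h x" "\<forall>f\<in>set R. img g1 f \<in> J"
        using h unfolding fires_def constraint_sel by blast
      \<comment> \<open>The tag of an element decides which of the two witnesses applies; on the
        arguments both agree with \<open>h\<close>.\<close>
      define k where "k e = (case e of Inl a \<Rightarrow> h a | Inr (d, v) \<Rightarrow> if d = tup c then g1 v else k1 e)" for e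
      have kK: "img k f \<in> J" if f: "f \<in> chase (M - {c}) (lhs c)" for f
      proof -
        have "k x = k1 x" if x: "x \<in> set (snd f)" for x
        proof (cases x)
          case (Inl a) then show ?thesis using k1(1) unfolding k_def by simp
        next
          case (Inr p)
          obtain d v where dv: "x = Inr (d, v)" using Inr by (cases p) simp
          then obtain c' where "c' \<in> M - {c}" "d = tup c'" using chase_elem_tag[OF f] x by blast
          then have "d \<noteq> tup c" by (simp add: tup_inject)
          then show ?thesis unfolding k_def dv by simp
        qed
        then have eq: "map k (snd f) = map k1 (snd f)" by simp
        show ?thesis unfolding eq using k1(2) f by blast
      qed
      have kp: "k (place c (lhs c) v) = g1 v" for v
        unfolding place_lhs[OF refl] k_def using g1(1) by auto
      have J: "img (k \<circ> \<theta>) g \<in> J" if g: "g \<in> set (rhs c)" for g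
      proof -
        have "img k (img \<theta> g) \<in> J" using bspec[OF th(2) g]
        proof
          assume "img \<theta> g \<in> img (place c (lhs c)) ` set R"
          then obtain f where f: "f \<in> set R" "img \<theta> g = img (place c (lhs c)) f" by blast
          have eq: "map k (map (place c (lhs c)) (snd f)) = map g1 (snd f)" using kp by simp
          show ?thesis unfolding f(2) fst_conv snd_conv eq using g1(2) f(1) by blast
        qed (rule kK)
        then show ?thesis by simp
      qed
      show "\<exists>g. (\<forall>x\<in>?A. g x = h x) \<and> (\<forall>f\<in>set (rhs c). img g f \<in> J)"
        by (intro exI[of _ "k \<circ> \<theta>"] conjI ballI J) (use th(1) in \<open>simp_all add: k_def\<close>)
    qed
    then show "\<forall>e\<in>M. fires e \<psi> J" using all unfolding N_def by blast
  qed
  have "positive_example S T M e \<longleftrightarrow> positive_example S T N e" for e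
  proof (cases "mapping_example S T e")
    case True
    then have E: "mapping_example S T (fst e, snd e)" by simp
    let ?X = "facts (fst e)" and ?J = "facts (snd e)"
    have "(\<forall>c\<in>M. \<forall>\<psi>\<in>?X. fires c \<psi> ?J) \<longleftrightarrow> (\<forall>\<psi>\<in>?X. \<forall>c\<in>M. fires c \<psi> ?J)" by blast
    also have "\<dots> \<longleftrightarrow> (\<forall>\<psi>\<in>?X. \<forall>c\<in>N. fires c \<psi> ?J)" by (simp only: swap)
    also have "\<dots> \<longleftrightarrow> (\<forall>c\<in>N. \<forall>\<psi>\<in>?X. fires c \<psi> ?J)" by blast
    finally show ?thesis using positive_iff_fires[OF disj M E] positive_iff_fires[OF disj N E] by simp
  qed (simp add: positive_example_def)
  then show "logically_equivalent S T M N" unfolding logically_equivalent_def by blast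
qed

text \<open>Positive examples stay positive because the twist follows from \<open>c\<close>. A
  summand of \<open>N\<close> bounds the number of assignments of the variables of \<open>c\<close>
  in one target, with 0 as default, so \<open>N\<close> exceeds this number for every negative
  example and there the twist implies \<open>c\<close>.\<close>

lemma fits_twist:
  assumes M: "lav_mapping S T M" and c: "c \<in> M" and f: "f \<in> set (rhs c)" "i < length (snd f)"
    and fits: "fits S T M Ep En" and fin: "finite En"
  defines "N \<equiv> Suc (\<Sum>e\<in>En. card (insert 0 (univ (snd e))) ^ card (elems (set (rhs c))))"
  defines "M' \<equiv> insert (twist c f i N) (M - {c})"
  shows "lav_mapping S T M'" "fits S T M' Ep En"
proof -
  let ?t = "twist c f i N"
  have cc: "over_schema S (lhs c)" "\<And>g. g \<in> set (rhs c) \<Longrightarrow> over_schema T g"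
    using M c unfolding lav_mapping_def lav_constraint_def by auto
  have "over_schema T g" if "g \<in> set (rhs ?t)" for g
    using that cc(2) f(1) unfolding rhs_twist by (auto simp: over_schema_def twisted_def)
  then have "lav_constraint S T ?t"
    using cc(1) unfolding twist_def by (intro lav_constraint_constraint) simp_all
  then show M': "lav_mapping S T M'" using M unfolding lav_mapping_def M'_def by auto
  have "positive_example S T M' e" if e: "positive_example S T M e" for e
  proof -
    have E: "mapping_example S T (fst e, snd e)" using e unfolding positive_example_def by simp
    have all: "\<forall>d\<in>M. \<forall>\<psi>\<in>facts (fst e). fires d \<psi> (facts (snd e))"
      using e positive_iff_fires[OF disj M E] by simp
    have "\<forall>\<psi>\<in>facts (fst e). fires ?t \<psi> (facts (snd e))"
      using fires_twist[OF _ f] bspec[OF all c] by blast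
    then have "\<forall>d\<in>M'. \<forall>\<psi>\<in>facts (fst e). fires d \<psi> (facts (snd e))"
      using all unfolding M'_def by blast
    then show ?thesis using positive_iff_fires[OF disj M' E] by simp
  qed
  moreover have "positive_example S T M e" if e: "positive_example S T M' e" "e \<in> En" for e
  proof -
    have E: "mapping_example S T (fst e, snd e)" using e unfolding positive_example_def by simp
    have "elems (facts (snd e)) \<subseteq> univ (snd e)" "finite (univ (snd e))"
      using E unfolding mapping_example_def finite_structure_def elems_def by auto
    moreover have "card (insert 0 (univ (snd e))) ^ card (elems (set (rhs c))) < N"
      unfolding N_def using member_le_sum[OF e(2), of "\<lambda>e. card (insert 0 (univ (snd e))) ^ card (elems (set (rhs c)))"] fin
      by simp
    ultimately have tc: "fires ?t \<psi> (facts (snd e)) \<Longrightarrow> fires c \<psi> (facts (snd e))" for \<psi>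
      using fires_if_twist_fires[OF _ f] by blast
    have all: "\<forall>d\<in>M'. \<forall>\<psi>\<in>facts (fst e). fires d \<psi> (facts (snd e))"
      using e(1) positive_iff_fires[OF disj M' E] by simp
    have "fires d \<psi> (facts (snd e))" if "d \<in> M" "\<psi> \<in> facts (fst e)" for d \<psi>
      using that all tc unfolding M'_def by (cases "d = c") blast+
    then show ?thesis using positive_iff_fires[OF disj M E] by simp
  qed
  ultimately show "fits S T M' Ep En"
    using fits unfolding fits_def negative_example_def by blast
qed


text \<open>If no fact of the right-hand side of \<open>c\<close> is redundant, a homomorphism into the twisted
  canonical structure permutes the facts, and the index of the copy becomes a potential that is
  constant along all edges except the twisted one.\<close>

lemma twist_potential:
  assumes M: "lav_mapping S T M" and c: "c \<in> M" and f: "f \<in> set (rhs c)" "i < length (snd f)"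
    and irr: "\<And>R. lav_mapping S T (insert (constraint (lhs c) R) (M - {c})) \<Longrightarrow>
      logically_equivalent S T M (insert (constraint (lhs c) R) (M - {c})) \<Longrightarrow>
      card (set (rhs c)) \<le> card (set R)"
    and new: "twist c f i N \<notin> M - {c}"
    and M': "lav_mapping S T (insert (twist c f i N) (M - {c}))"
    and eqv: "logically_equivalent S T M (insert (twist c f i N) (M - {c}))"
  shows "\<exists>lv Lv. \<forall>G\<in>set (rhs c). \<forall>p<length (snd G). snd G ! p \<notin> univars c \<longrightarrow>
    (lv (snd G ! p) = (Lv G :: nat) \<longleftrightarrow> (G, p) \<noteq> (f, i))"
proof -
  let ?t = "twist c f i N" and ?A = "univars c" and ?F = "set (rhs c)" and ?l = "lhs c"
  let ?M' = "insert ?t (M - {c})"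
  let ?r = "chase ?M' ?l" and ?K = "chase (M - {c}) ?l"
  let ?s = "place c ?l" and ?st = "place ?t ?l"
  have s: "?s v = (if v \<in> ?A then Inl v else Inr (tup c, v))" for v by (rule place_lhs) simp
  have st: "?st v = (if v \<in> ?A then Inl v else Inr (tup ?t, v))" for v by (rule place_lhs) simp
  have inj_s: "inj ?s" unfolding inj_def s by auto
  have "arity_ok S ?l" using M c unfolding lav_mapping_def lav_constraint_def arity_ok_nat by blast
  then have "maps_over dist (chase M ?l) ?r" by (rule chase_maps_if_equivalent[OF disj M M' eqv])
  then obtain \<kappa> where k: "\<forall>a. \<kappa> (Inl a) = Inl a" "\<forall>f\<in>chase M ?l. img \<kappa> f \<in> ?r"
    unfolding maps_over_dist by (elim exE conjE) (rule that)
  define g where "g v = \<kappa> (?s v)" for v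
  have gr: "img g G \<in> ?r" if "G \<in> ?F" for G
  proof -
    have "img ?s G \<in> chase M ?l" unfolding chase_def using c that matches_lhs[of c c] by blast
    then have "img \<kappa> (img ?s G) \<in> ?r" using k(2) by blast
    then show ?thesis unfolding g_def by (simp add: comp_def)
  qed
  \<comment> \<open>\<open>\<rho>\<close> folds the twisted copies back onto \<open>c\<close> and
    fixes the witnesses of the other constraints. Hence \<open>\<theta>\<close> maps the right-hand
    side of \<open>c\<close> into itself together with the chase of the others.\<close>
  define \<rho> where "\<rho> e = (case e of Inl a \<Rightarrow> Inl a | Inr (d, y) \<Rightarrow> if d = tup ?t then ?s (unren c y) else e)" for e
  have rho_t: "\<rho> (?st y) = ?s (unren c y)" for y
    unfolding st \<rho>_def by (auto simp: s unren_def)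
  define \<theta> where "\<theta> v = \<rho> (g v)" for v
  have thA: "\<theta> x = Inl x" if "x \<in> ?A" for x
    using that k(1) unfolding \<theta>_def g_def \<rho>_def by (simp add: s)
  have split: "(x \<in> ?K \<and> img \<rho> x = x) \<or> (\<exists>G\<in>set (rhs ?t). x = img ?st G)" if x: "x \<in> ?r" for x
  proof -
    obtain d G where d: "d \<in> ?M'" "matches d ?l" "G \<in> set (rhs d)" "x = img (place d ?l) G"
      using x unfolding chase_def by blast
    show ?thesis
    proof (cases "d = ?t")
      case True then show ?thesis using d by blast
    next
      case False
      then have xK: "x \<in> ?K" unfolding chase_def using d by blast
      have "\<rho> e = e" if e: "e \<in> set (snd x)" for e
      proof (cases e)
        case (Inl a) then show ?thesis unfolding \<rho>_def by simp
      next
        case (Inr p)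
        obtain d' v where dv: "e = Inr (d', v)" using Inr by (cases p) simp
        then obtain c' where "c' \<in> M - {c}" "d' = tup c'" using chase_elem_tag[OF xK] e by blast
        then have "d' \<noteq> tup ?t" using new by (auto simp: tup_inject)
        then show ?thesis unfolding \<rho>_def dv by simp
      qed
      then show ?thesis using xK by (simp add: map_idI)
    qed
  qed
  \<comment> \<open>A uniform view of the facts of the twist: each lies over one \<open>G0\<close>
    and carries two indices, equal unless \<open>G0\<close> is \<open>f\<close>, the second of which
    is used only at position \<open>i\<close> of \<open>f\<close>.\<close>
  have twF: "\<exists>G0\<in>?F. \<exists>s t. (G0 \<noteq> f \<longrightarrow> s = t) \<and> (G0 = f \<longrightarrow> s \<noteq> t) \<and> fst G = fst G0 \<and> length (snd G) = length (snd G0) \<and>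
      (\<forall>p<length (snd G0). snd G ! p = ren c (if (G0, p) = (f, i) then t else s) (snd G0 ! p))"
    if G: "G \<in> set (rhs ?t)" for G
  proof -
    consider (copy) s H where "G = img (ren c s) H" "H \<in> ?F" "H \<noteq> f" | (tw) s t where "G = twisted c f i s t" "s < t"
      using G unfolding rhs_twist by (elim UnE CollectE exE conjE) blast+
    then show ?thesis
    proof cases
      case copy
      show ?thesis by (rule bexI[OF _ copy(2)], rule exI[of _ s], rule exI[of _ s]) (use copy in auto)
    next
      case tw
      show ?thesis by (rule bexI[OF _ f(1)], rule exI[of _ s], rule exI[of _ t])
        (use tw f(2) in \<open>auto simp: twisted_def nth_list_update\<close>)
    qed
  qed
  have rho_img: "img \<rho> (img ?st G) \<in> img ?s ` ?F" if G: "G \<in> set (rhs ?t)" for G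
  proof -
    obtain G0 s t where G0: "G0 \<in> ?F" "fst G = fst G0" "length (snd G) = length (snd G0)"
      "\<forall>p<length (snd G0). snd G ! p = ren c (if (G0, p) = (f, i) then t else s) (snd G0 ! p)"
      using twF[OF G] by blast
    have "map \<rho> (map ?st (snd G)) = map ?s (snd G0)"
      by (rule nth_equalityI) (use G0(3,4) in \<open>simp_all add: rho_t\<close>)
    then show ?thesis using G0(1,2) by (intro image_eqI[of _ _ G0]) simp_all
  qed
  have th_img: "img \<theta> G \<in> img ?s ` ?F \<union> ?K" if "G \<in> ?F" for G
  proof -
    have eq: "img \<theta> G = img \<rho> (img g G)" unfolding \<theta>_def by (simp add: comp_def)
    from split[OF gr[OF that]] show ?thesis
    proof
      assume a: "img g G \<in> ?K \<and> img \<rho> (img g G) = img g G"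
      show ?thesis unfolding eq conjunct2[OF a] by (rule UnI2) (rule conjunct1[OF a])
    next
      assume "\<exists>H\<in>set (rhs ?t). img g G = img ?st H"
      then obtain H where H: "H \<in> set (rhs ?t)" "img g G = img ?st H" by blast
      show ?thesis unfolding eq H(2) using rho_img[OF H(1)] by (rule UnI1)
    qed
  qed
  \<comment> \<open>The facts outside \<open>R\<close> are redundant, so there are none.\<close>
  define R where "R = filter (\<lambda>G. img ?s G \<in> img \<theta> ` ?F) (rhs c)"
  have RF: "set R \<subseteq> ?F" unfolding R_def by auto
  have thR: "\<forall>G\<in>?F. img \<theta> G \<in> img ?s ` set R \<union> ?K"
  proof
    fix G assume G: "G \<in> ?F"
    from th_img[OF G] show "img \<theta> G \<in> img ?s ` set R \<union> ?K"
    proof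
      assume "img \<theta> G \<in> img ?s ` ?F"
      then obtain H where H: "H \<in> ?F" "img \<theta> G = img ?s H" by blast
      have "img ?s H \<in> img \<theta> ` ?F" unfolding H(2)[symmetric] using G by (rule imageI)
      then have "H \<in> set R" unfolding R_def using H(1) by simp
      then show ?thesis unfolding H(2) by blast
    qed simp
  qed
  have "card ?F \<le> card (set R)"
    by (rule irr) (use equivalent_subconstraint[OF M c RF _ thR] thA in blast)+
  then have "set R = ?F" using RF by (simp add: card_seteq)
  then have sub: "img ?s ` ?F \<subseteq> img \<theta> ` ?F" unfolding R_def by auto
  have "inj_on (img ?s) ?F"
    using inj_s by (auto simp: inj_on_def inj_map_eq_map prod_eq_iff)
  then have "card (img ?s ` ?F) = card ?F" by (rule card_image)
  moreover have "card (img \<theta> ` ?F) \<le> card ?F" by (simp add: card_image_le)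
  ultimately have imgs: "img ?s ` ?F = img \<theta> ` ?F"
    using card_seteq[OF _ sub] by simp
  have el: "\<theta> ` elems ?F = ?s ` elems ?F"
    using arg_cong[OF imgs, of elems] unfolding elems_img by simp
  have "card (\<theta> ` elems ?F) = card (elems ?F)"
    unfolding el by (rule card_image) (use inj_s in \<open>auto simp: inj_def inj_on_def\<close>)
  then have inj_th: "inj_on \<theta> (elems ?F)" by (simp add: eq_card_imp_inj_on finite_elems)
  \<comment> \<open>By now every \<open>G\<close> has a preimage \<open>H\<close> under
    \<open>\<theta>\<close>. If \<open>G\<close> has an existential element, \<open>g\<close> sends
    \<open>H\<close> to a fact of the twist over \<open>G\<close>, and the index of its copy is the
    potential of \<open>G\<close>.\<close>
  have "\<exists>L. \<forall>p<length (snd G). snd G ! p \<notin> ?A \<longrightarrow>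
      (\<exists>v\<in>elems ?F. \<exists>l. \<theta> v = ?s (snd G ! p) \<and> g v = Inr (tup ?t, offset c + prod_encode (snd G ! p, l)) \<and>
        (l = (L :: nat) \<longleftrightarrow> (G, p) \<noteq> (f, i)))" if G: "G \<in> ?F" for G
  proof -
    have "img ?s G \<in> img \<theta> ` ?F" using sub G by blast
    then obtain H where H: "H \<in> ?F" "img ?s G = img \<theta> H" by blast
    have eq: "img \<theta> H = img \<rho> (img g H)" unfolding \<theta>_def by (simp add: comp_def)
    have len: "length (snd H) = length (snd G)" using H(2) by (metis length_map snd_conv)
    have thp: "\<theta> (snd H ! p) = ?s (snd G ! p)" if "p < length (snd G)" for p
    proof -
      have "map ?s (snd G) = map \<theta> (snd H)" using H(2) by blast
      then show ?thesis using that len by (metis nth_map)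
    qed
    show ?thesis
    proof (cases "set (snd G) \<subseteq> ?A")
      case True
      then have "snd G ! p \<in> ?A" if "p < length (snd G)" for p using nth_mem[OF that] by blast
      then show ?thesis by blast
    next
      case False
      then obtain u where u: "u \<in> set (snd G)" "u \<notin> ?A" by blast
      \<comment> \<open>Facts from the other constraints carry no witness tagged with
        \<open>c\<close>, but the placed \<open>G\<close> contains one for \<open>u\<close>.\<close>
      have "\<not> (img g H \<in> ?K \<and> img \<rho> (img g H) = img g H)"
      proof
        assume a: "img g H \<in> ?K \<and> img \<rho> (img g H) = img g H"
        have sK: "img ?s G \<in> ?K" unfolding H(2) eq conjunct2[OF a] by (rule conjunct1[OF a])
        have "Inr (tup c, u) \<in> set (snd (img ?s G))" using u s by force
        then obtain c' where "c' \<in> M - {c}" "tup c = tup c'" using chase_elem_tag[OF sK] by blast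
        then show False by (simp add: tup_inject)
      qed
      then obtain X where X: "X \<in> set (rhs ?t)" "img g H = img ?st X" using split[OF gr[OF H(1)]] by blast
      obtain G0 a b where G0: "G0 \<in> ?F" "G0 \<noteq> f \<longrightarrow> a = b" "G0 = f \<longrightarrow> a \<noteq> b" "fst X = fst G0" "length (snd X) = length (snd G0)"
        "\<forall>p<length (snd G0). snd X ! p = ren c (if (G0, p) = (f, i) then b else a) (snd G0 ! p)"
        using twF[OF X(1)] by blast
      have "map \<rho> (map ?st (snd X)) = map ?s (snd G0)"
        by (rule nth_equalityI) (use G0(5,6) in \<open>simp_all add: rho_t\<close>)
      moreover have "img ?s G = img \<rho> (img ?st X)" unfolding H(2) eq X(2) ..
      ultimately have "map ?s (snd G) = map ?s (snd G0)" "fst G = fst G0" using G0(4) by simp_all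
      then have GG: "G = G0" using inj_s by (simp add: inj_map_eq_map prod_eq_iff)
      have gp: "g (snd H ! p) = ?st (ren c (if (G, p) = (f, i) then b else a) (snd G ! p))" if p: "p < length (snd G)" for p
      proof -
        have "map g (snd H) = map ?st (snd X)" using X(2) by blast
        then have "g (snd H ! p) = ?st (snd X ! p)" using p len G0(5) GG by (metis nth_map)
        then show ?thesis using G0(6) p GG by simp
      qed
      \<comment> \<open>For \<open>f\<close> the potential is the index \<open>a\<close> used away
        from position \<open>i\<close>; for all other facts \<open>a\<close> and \<open>b\<close>
        coincide.\<close>
      show ?thesis
      proof (intro exI[of _ "if (G, i) = (f, i) then a else b"] allI impI)
        fix p assume p: "p < length (snd G)" "snd G ! p \<notin> ?A"
        let ?l = "if (G, p) = (f, i) then b else a"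
        have "g (snd H ! p) = Inr (tup ?t, offset c + prod_encode (snd G ! p, ?l))"
          using gp[OF p(1)] p(2) offset_notin unfolding st by (simp add: ren_def)
        moreover have "snd H ! p \<in> elems ?F" unfolding elems_def by (rule UN_I[OF H(1)]) (use p(1) len in simp)
        moreover have "(?l = (if (G, i) = (f, i) then a else b)) = ((G, p) \<noteq> (f, i))"
          using G0(2,3) GG by auto
        ultimately show "\<exists>v\<in>elems ?F. \<exists>l. \<theta> v = ?s (snd G ! p) \<and>
            g v = Inr (tup ?t, offset c + prod_encode (snd G ! p, l)) \<and>
            (l = (if (G, i) = (f, i) then a else b)) = ((G, p) \<noteq> (f, i))"
          using thp[OF p(1)] by blast
      qed
    qed
  qed
  then obtain Lv where Lv: "\<And>G p. G \<in> ?F \<Longrightarrow> p < length (snd G) \<Longrightarrow> snd G ! p \<notin> ?A \<Longrightarrow>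
      \<exists>v\<in>elems ?F. \<exists>l. \<theta> v = ?s (snd G ! p) \<and> g v = Inr (tup ?t, offset c + prod_encode (snd G ! p, l)) \<and>
        (l = (Lv G :: nat) \<longleftrightarrow> (G, p) \<noteq> (f, i))"
    by metis
  \<comment> \<open>The preimage under \<open>\<theta>\<close> is unique by injectivity, so the
    index of an element does not depend on the fact through which the element is reached.\<close>
  define lv where "lv u = (SOME l. \<exists>v\<in>elems ?F. \<theta> v = ?s u \<and> g v = Inr (tup ?t, offset c + prod_encode (u, l)))" for u
  have lv: "lv u = l" if v: "v \<in> elems ?F" "\<theta> v = ?s u" "g v = Inr (tup ?t, offset c + prod_encode (u, l))" for u l v
  proof -
    have "\<exists>w\<in>elems ?F. \<theta> w = ?s u \<and> g w = Inr (tup ?t, offset c + prod_encode (u, lv u))"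
      unfolding lv_def by (rule someI_ex) (use v in blast)
    then obtain w where w: "w \<in> elems ?F" "\<theta> w = ?s u" "g w = Inr (tup ?t, offset c + prod_encode (u, lv u))" by blast
    have "w = v" using inj_th w(1,2) v(1,2) by (simp add: inj_on_def)
    then show ?thesis using w(3) v(3) by simp
  qed
  show ?thesis
  proof (intro exI[of _ lv] exI[of _ Lv] ballI allI impI)
    fix G p assume "G \<in> ?F" "p < length (snd G)" "snd G ! p \<notin> ?A"
    from Lv[OF this] obtain v l where vl: "v \<in> elems ?F" "\<theta> v = ?s (snd G ! p)"
      "g v = Inr (tup ?t, offset c + prod_encode (snd G ! p, l))" "l = Lv G \<longleftrightarrow> (G, p) \<noteq> (f, i)" by blast
    show "lv (snd G ! p) = Lv G \<longleftrightarrow> (G, p) \<noteq> (f, i)" using lv[OF vl(1-3)] vl(4) by simp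
  qed
qed

text \<open>Minimal weight among the mappings equivalent to \<open>M\<close> is used twice: no
  right-hand side contains a redundant fact, and the twist is not already one of the other
  constraints.\<close>

theorem c_acyclic_if_characterizable:
  assumes M: "lav_mapping S T M" and fin: "finite En" and uc: "uniquely_characterizes S T Ep En M"
  shows "\<exists>N. lav_mapping S T N \<and> c_acyclic_mapping N \<and> logically_equivalent S T M N"
proof -
  let ?P = "\<lambda>N. lav_mapping S T N \<and> logically_equivalent S T M N"
  have "?P M" using M unfolding logically_equivalent_def by blast
  then obtain N where N: "?P N" and min: "\<And>N'. ?P N' \<Longrightarrow> weight N \<le> weight N'"
    using ex_has_least_nat[of ?P M weight] by blast
  have finN: "finite N" using N unfolding lav_mapping_def by blast
  have trans: "logically_equivalent S T N N' \<Longrightarrow> logically_equivalent S T M N'" for N'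
    using N unfolding logically_equivalent_def by blast
  have fitsN: "fits S T N Ep En"
    using uc N unfolding uniquely_characterizes_def fits_def negative_example_def logically_equivalent_def by blast
  have "c_acyclic (canonical_structure c) (distinguished c)" if c: "c \<in> N" for c
  proof (rule ccontr)
    assume "\<not> ?thesis"
    then obtain vs es where cyc: "incidence_cycle (canonical_structure c) vs es"
      and avoid: "\<And>x. x \<in> univars c \<Longrightarrow> Elem x \<notin> set vs"
      unfolding c_acyclic_def distinguished_def by auto
    have es: "es \<noteq> []" "set es \<subseteq> incidence_edges (canonical_structure c)"
      using cyc unfolding incidence_cycle_def by auto
    obtain f i where fi: "es ! 0 = (f, i)" by (cases "es ! 0")
    have "(f, i) \<in> incidence_edges (canonical_structure c)" using es fi by (metis length_greater_0_conv nth_mem subsetD)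
    then have f: "f \<in> set (rhs c)" "i < length (snd f)"
      unfolding incidence_edges_def canonical_structure_def by auto
    define K where "K = Suc (\<Sum>e\<in>En. card (insert 0 (univ (snd e))) ^ card (elems (set (rhs c))))"
    let ?t = "twist c f i K"
    let ?M' = "insert ?t (N - {c})"
    have M': "lav_mapping S T ?M'" "fits S T ?M' Ep En"
      using fits_twist[OF _ c f fitsN fin] N unfolding K_def by blast+
    have "logically_equivalent S T ?M' M" using uc M' unfolding uniquely_characterizes_def by blast
    then have MM': "logically_equivalent S T M ?M'" and NM': "logically_equivalent S T N ?M'"
      using N unfolding logically_equivalent_def by blast+
    \<comment> \<open>Otherwise replacing \<open>c\<close> by its twist would amount to deleting
      \<open>c\<close>, whose right-hand side contains \<open>f\<close>, and this would lower the
      weight.\<close>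
    have new: "?t \<notin> N - {c}"
    proof
      assume t: "?t \<in> N - {c}"
      then have "?M' = N - {c}" by (rule insert_absorb)
      then have "weight N \<le> weight (N - {c})" using min M'(1) MM' by metis
      moreover have "weight N = card (set (rhs c)) + weight (N - {c})"
        unfolding weight_def using finN c by (simp add: sum.remove)
      moreover have "card (set (rhs c)) > 0" using f(1) by (auto simp: card_gt_0_iff)
      ultimately show False by simp
    qed
    have irr: "card (set (rhs c)) \<le> card (set R)"
      if "lav_mapping S T (insert (constraint (lhs c) R) (N - {c}))"
        "logically_equivalent S T N (insert (constraint (lhs c) R) (N - {c}))" for R
    proof (rule ccontr)
      assume "\<not> ?thesis"
      then have "weight (insert (constraint (lhs c) R) (N - {c})) < weight N"
        by (intro weight_replace[OF finN c]) simp
      moreover have "weight N \<le> weight (insert (constraint (lhs c) R) (N - {c}))"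
        using min that trans by blast
      ultimately show False by simp
    qed
    have N1: "lav_mapping S T N" using N by blast
    obtain lv Lv where pot: "\<forall>G\<in>set (rhs c). \<forall>p<length (snd G). snd G ! p \<notin> univars c \<longrightarrow>
      (lv (snd G ! p) = (Lv G :: nat) \<longleftrightarrow> (G, p) \<noteq> (f, i))"
      using twist_potential[OF N1 c f irr new M'(1) NM'] by blast
    show False
    proof (rule incidence_cycle_potential[OF cyc])
      fix G p assume Gp: "(G, p) \<in> incidence_edges (canonical_structure c)" "Elem (snd G ! p) \<in> set vs"
      then have "G \<in> set (rhs c)" "p < length (snd G)" "snd G ! p \<notin> univars c"
        using avoid unfolding incidence_edges_def canonical_structure_def by auto
      then show "lv (snd G ! p) = Lv G \<longleftrightarrow> (G, p) \<noteq> es ! 0" using pot fi by metis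
    qed
  qed
  then show ?thesis using N unfolding c_acyclic_mapping_def by blast
qed

end

theorem theorem6p5:
  fixes S T :: schema
  assumes "finite (dom S)" and "finite (dom T)" and "dom S \<inter> dom T = {}"
  shows
    "(\<forall>M. lav_mapping S T M \<longrightarrow>
        (\<exists>Ep En. finite Ep \<and> finite En \<and> uniquely_characterizes S T Ep En M) \<longleftrightarrow>
        (\<exists>N. lav_mapping S T N \<and> c_acyclic_mapping N \<and> logically_equivalent S T M N)) \<and>
     (\<exists>(P :: program) (p :: nat poly). \<forall>cs :: lav list.
        lav_mapping S T (set cs) \<and> c_acyclic_mapping (set cs) \<longrightarrow>
        (\<exists>ps ns t.
           runs P (enc_mapping cs) (Node (enc_examples ps) (enc_examples ns)) t \<and>
           t \<le> poly p (tsize (enc_mapping cs)) \<and>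
           uniquely_characterizes S T (examples_of ps) (examples_of ns) (set cs)))"
proof (intro conjI allI impI iffI)
  fix M assume M: "lav_mapping S T M"
  {
    assume "\<exists>Ep En. finite Ep \<and> finite En \<and> uniquely_characterizes S T Ep En M"
    then show "\<exists>N. lav_mapping S T N \<and> c_acyclic_mapping N \<and> logically_equivalent S T M N"
      using c_acyclic_if_characterizable[OF assms(3) M] by blast
  next
    assume "\<exists>N. lav_mapping S T N \<and> c_acyclic_mapping N \<and> logically_equivalent S T M N"
    then obtain N where N: "lav_mapping S T N" "c_acyclic_mapping N" "logically_equivalent S T M N" by blast
    obtain cs where cs: "set cs = N" using finite_list N(1) unfolding lav_mapping_def by blast
    obtain ps ns where "uniquely_characterizes S T (examples_of ps) (examples_of ns) N"
      using polytime_characterization[OF assms] N(1,2) cs by metis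
    moreover have "positive_example S T M = positive_example S T N"
      using N(3) unfolding logically_equivalent_def by (intro ext) blast
    ultimately have "uniquely_characterizes S T (examples_of ps) (examples_of ns) M"
      unfolding uniquely_characterizes_def fits_def negative_example_def logically_equivalent_def
      by simp
    moreover have "finite (examples_of es)" for es unfolding examples_of_def by simp
    ultimately show "\<exists>Ep En. finite Ep \<and> finite En \<and> uniquely_characterizes S T Ep En M" by blast
  }
qed (rule polytime_characterization[OF assms])

end
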